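(* Let $T$ be a tree with $\kappa_{\mathrm m}(T)=2$ and $M_T=fg$, where $f,g\in\mathbb Z[x]$ are distinct, monic and irreducible over $\mathbb Q$. Let $\Gamma_T=\Gamma_f+\Gamma_g$ be the canonical factor-coronal decomposition, and let $w_k^{(h)}$ ($h\in\{f,g\}$, $k\ge0$) be the factor moments. If $T$ has a disconnected generalized cospectral mate, then that mate is of the form $R\cup U$ with $R$ a tree and $U$ a connected bipartite unicyclic graph, and there is an ordering $(p,q)\in\{(f,g),(g,f)\}$ such that $p$ corresponds to the tree component and $q$ to the connected bipartite unicyclic component (that is, $M_R=p$ and $M_U=q$). Set $n_p:=w_0^{(p)}$, $n_q:=w_0^{(q)}$. Then: (i) $w_k^{(p)},w_k^{(q)}\in\mathbb Z_{\ge0}$ for all $k\ge0$, with $n_p\ge1$ and $n_q\ge4$. (ii) For $\delta_h:=w_1^{(h)}-2w_0^{(h)}$, one has $\delta_p=-2$ and $\delta_q=0$. (iii) The second moments $w_2^{(p)},w_2^{(q)}$ are even and satisfy $w_2^{(p)}\ge\max\{0,4n_p-6\}$ and $w_2^{(q)}\ge 4n_q$. If $n_p\ge2$, equality in $w_2^{(p)}\ge 4n_p-6$ holds exactly when the tree component is a path. Equality in $w_2^{(q)}\ge4n_q$ holds exactly when the unicyclic component is a cycle. (iv) If $p(x)=x-a$, then $(a,n_p)\in\{(0,1),(1,2)\}$, and the corresponding tree is $K_1$ or $K_2$, respectively. If $q(x)=x-a$, then $a=2$ and the corresponding component is the even cycle $C_{n_q}$.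
   Context: All graphs are finite, simple and undirected. For a graph $G$, $A(G)$ is its adjacency matrix, $\phi_G(x)=\det(xI-A(G))$, $\mathbf 1$ is the all-one vector, and the coronal is $\Gamma_G(x)=\mathbf 1^{T}(xI-A(G))^{-1}\mathbf 1$. Two graphs are generalized cospectral if they have the same adjacency spectrum and their complements have the same adjacency spectrum; a generalized cospectral mate of $T$ is a graph generalized cospectral with $T$. An adjacency eigenvalue is main if its eigenspace is not orthogonal to $\mathbf 1$; the main polynomial $M_G(x)$ is the product of $(x-\lambda)$ over the distinct main eigenvalues $\lambda$ of $G$; it divides $\phi_G$ in $\mathbb Z[x]$ and is the monic reduced denominator of $\Gamma_G$. If $\phi_G=\prod_{i=1}^r f_i^{m_i}$ with $f_i$ distinct, monic and irreducible over $\mathbb Q$, the main-factor multiplicity is $\kappa_{\mathrm m}(G):=\sum_{i:\,f_i\mid M_G} m_i$. When $T$ is a tree with $\kappa_{\mathrm m}(T)=2$, $M_T=fg$ with $f,g$ distinct monic irreducible. The canonical factor-coronal decomposition is the unique proper partial-fraction decomposition $\Gamma_T=\Gamma_f+\Gamma_g$ with $\Gamma_f=A/f$, $\Gamma_g=B/g$, $A,B\in\mathbb Q[x]$, $\deg A<\deg f$, $\deg B<\deg g$. The factor moments are defined by the Laurent expansion at infinity $\Gamma_h(x)=\sum_{k\ge0} w_k^{(h)}x^{-k-1}$, $h\in\{f,g\}$. A connected graph is unicyclic if it contains exactly one cycle. *)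

theory Defs
  imports
    "Jordan_Normal_Form.Char_Poly"
    "Jordan_Normal_Form.Gauss_Jordan_Elimination"
    "HOL-Computational_Algebra.Computational_Algebra"
    "HOL-Computational_Algebra.Field_as_Ring"
begin

section \<open>Finite simple graphs\<close>

record 'v ugraph =
  verts :: "'v set"
  edges :: "'v set set"

definition simple_graph :: "'v ugraph \<Rightarrow> bool" where
  "simple_graph G \<longleftrightarrow> finite (verts G) \<and> (\<forall>e\<in>edges G. e \<subseteq> verts G \<and> card e = 2)"

definition complement_graph :: "'v ugraph \<Rightarrow> 'v ugraph" where
  "complement_graph G =
     \<lparr>verts = verts G, edges = {e. e \<subseteq> verts G \<and> card e = 2 \<and> e \<notin> edges G}\<rparr>"

definition graph_union :: "'v ugraph \<Rightarrow> 'v ugraph \<Rightarrow> 'v ugraph" where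
  "graph_union G H = \<lparr>verts = verts G \<union> verts H, edges = edges G \<union> edges H\<rparr>"

definition adj_rel :: "'v ugraph \<Rightarrow> ('v \<times> 'v) set" where
  "adj_rel G = {(u, v). {u, v} \<in> edges G}"

definition connected_graph :: "'v ugraph \<Rightarrow> bool" where
  "connected_graph G \<longleftrightarrow>
     verts G \<noteq> {} \<and> (\<forall>u\<in>verts G. \<forall>v\<in>verts G. (u, v) \<in> (adj_rel G)\<^sup>*)"

definition path_edges :: "'v list \<Rightarrow> 'v set set" where
  "path_edges vs = {{vs ! i, vs ! Suc i} | i. Suc i < length vs}"

definition cycle_edges :: "'v list \<Rightarrow> 'v set set" where
  "cycle_edges vs = {{vs ! i, vs ! (Suc i mod length vs)} | i. i < length vs}"

text \<open>A cycle is identified with its edge set, so that the rotations and reflections of a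
  vertex list describe one and the same cycle.\<close>

definition cycles_of :: "'v ugraph \<Rightarrow> 'v set set set" where
  "cycles_of G = {cycle_edges vs | vs. distinct vs \<and> 3 \<le> length vs \<and> cycle_edges vs \<subseteq> edges G}"

definition tree_graph :: "'v ugraph \<Rightarrow> bool" where
  "tree_graph G \<longleftrightarrow> simple_graph G \<and> connected_graph G \<and> cycles_of G = {}"

definition unicyclic_graph :: "'v ugraph \<Rightarrow> bool" where
  "unicyclic_graph G \<longleftrightarrow> simple_graph G \<and> connected_graph G \<and> (\<exists>!C. C \<in> cycles_of G)"

definition bipartite_graph :: "'v ugraph \<Rightarrow> bool" where
  "bipartite_graph G \<longleftrightarrow>
     (\<exists>X Y. X \<union> Y = verts G \<and> X \<inter> Y = {} \<and> (\<forall>e\<in>edges G. \<exists>x\<in>X. \<exists>y\<in>Y. e = {x, y}))"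

definition is_path_graph :: "'v ugraph \<Rightarrow> bool" where
  "is_path_graph G \<longleftrightarrow>
     (\<exists>vs. vs \<noteq> [] \<and> distinct vs \<and> verts G = set vs \<and> edges G = path_edges vs)"

definition is_cycle_graph :: "nat \<Rightarrow> 'v ugraph \<Rightarrow> bool" where
  "is_cycle_graph n G \<longleftrightarrow> 3 \<le> n \<and>
     (\<exists>vs. length vs = n \<and> distinct vs \<and> verts G = set vs \<and> edges G = cycle_edges vs)"

definition is_complete_graph :: "nat \<Rightarrow> 'v ugraph \<Rightarrow> bool" where
  "is_complete_graph n G \<longleftrightarrow>
     finite (verts G) \<and> card (verts G) = n \<and> edges G = {e. e \<subseteq> verts G \<and> card e = 2}"

section \<open>Adjacency spectrum, coronal, main polynomial\<close>

text \<open>The rows and columns of the adjacency matrix are indexed by an arbitrarily chosen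
  enumeration of the vertices; a different choice conjugates the matrix by a permutation
  matrix, which changes none of the notions below.\<close>

definition vertex_list :: "'v ugraph \<Rightarrow> 'v list" where
  "vertex_list G = (SOME vs. distinct vs \<and> set vs = verts G)"

definition adj_mat :: "'v ugraph \<Rightarrow> 'r :: {zero, one} mat" where
  "adj_mat G = mat (card (verts G)) (card (verts G))
     (\<lambda>(i, j). if {vertex_list G ! i, vertex_list G ! j} \<in> edges G then 1 else 0)"

abbreviation graph_poly :: "'v ugraph \<Rightarrow> 'r :: comm_ring_1 poly" where
  "graph_poly G \<equiv> char_poly (adj_mat G)"

definition ones :: "nat \<Rightarrow> 'r :: one vec" where
  "ones n = vec n (\<lambda>_. 1)"

text \<open>Eigenvalues with multiplicity; nothing is lost by taking real roots, since the matrix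
  is symmetric.\<close>

definition adj_spectrum :: "'v ugraph \<Rightarrow> real multiset" where
  "adj_spectrum G = proots (graph_poly G)"

definition gen_cospectral :: "'v ugraph \<Rightarrow> 'w ugraph \<Rightarrow> bool" where
  "gen_cospectral G H \<longleftrightarrow>
     adj_spectrum G = adj_spectrum H \<and>
     adj_spectrum (complement_graph G) = adj_spectrum (complement_graph H)"

text \<open>The coronal as an element of the field of rational functions over the rationals.
  \<open>char_poly_matrix A\<close> is the polynomial matrix \<open>xI - A\<close>; over the fraction field it is
  invertible, its determinant being a monic polynomial.\<close>

definition coronal :: "'v ugraph \<Rightarrow> rat poly fract" where
  "coronal G =
     (let n = card (verts G);
          B = the (mat_inverse (map_mat to_fract (char_poly_matrix (adj_mat G :: rat mat))))
      in scalar_prod (ones n) (B *\<^sub>v ones n))"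

definition main_eigenvalues :: "'v ugraph \<Rightarrow> real set" where
  "main_eigenvalues G =
     {l. \<exists>v. eigenvector (adj_mat G) v l \<and> scalar_prod (ones (card (verts G))) v \<noteq> 0}"

definition main_poly :: "'v ugraph \<Rightarrow> real poly" where
  "main_poly G = (\<Prod>l\<in>main_eigenvalues G. [:- l, 1:])"

definition main_factors :: "'v ugraph \<Rightarrow> rat poly set" where
  "main_factors G = {h. irreducible h \<and> lead_coeff h = 1 \<and> h dvd graph_poly G
                        \<and> map_poly of_rat h dvd main_poly G}"

definition main_factor_mult :: "'v ugraph \<Rightarrow> nat" where
  "main_factor_mult G = (\<Sum>h\<in>main_factors G. multiplicity h (graph_poly G))"

section \<open>Factor moments\<close>

text \<open>Expansion at infinity: Laurent series in the local parameter \<open>1/x\<close>, so the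
  indeterminate of the polynomial is sent to \<open>fls_X_inv\<close>.\<close>

definition poly_at_infinity :: "rat poly \<Rightarrow> rat fls" where
  "poly_at_infinity p = poly (map_poly fls_const p) fls_X_inv"

text \<open>\<open>factor_moment a b k\<close> is the coefficient of \<open>x^(-k-1)\<close> in the expansion of \<open>a/b\<close>.\<close>

definition factor_moment :: "rat poly \<Rightarrow> rat poly \<Rightarrow> nat \<Rightarrow> rat" where
  "factor_moment a b k = fls_nth (poly_at_infinity a / poly_at_infinity b) (int k + 1)"

definition factor_coronal_decomp ::
    "'v ugraph \<Rightarrow> rat poly \<Rightarrow> rat poly \<Rightarrow> rat poly \<Rightarrow> rat poly \<Rightarrow> bool" where
  "factor_coronal_decomp G f g a b \<longleftrightarrow>
     coronal G = Fract a f + Fract b g \<and> degree a < degree f \<and> degree b < degree g"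

end

theory Submission
  imports Defs "Jordan_Normal_Form.Schur_Decomposition"
begin

text \<open>Generalized cospectral graphs have equal numbers \<open>w\<^sub>k = \<one>\<^sup>T A\<^sup>k \<one>\<close> of walks, because the
  characteristic polynomials of a graph and its complement determine the coronal. The condition
  \<open>h(A) \<one> = 0\<close> means \<open>\<one>\<^sup>T h(A)\<^sup>2 \<one> = 0\<close>, so it depends on the walk counts only, and \<open>f g\<close>
  annihilates the all-one vector of the mate and of each of its components. By Cayley-Hamilton and
  Bezout the characteristic polynomial of every component is then divisible by \<open>f\<close> or by \<open>g\<close>. Both
  are simple factors of the whole characteristic polynomial, so there are exactly two
  components, with main polynomials \<open>f\<close> and \<open>g\<close>, and uniqueness of partial fractions identifies the
  factor moments with their walk counts. Counting edges makes one component a tree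
  and the other one unicyclic; the latter is bipartite because traces of odd powers of \<open>A\<close> vanish for
  the tree \<open>T\<close>, hence for its mate. What remains are identities for \<open>\<Sum>d\<close> and \<open>\<Sum>d\<^sup>2\<close>.\<close>

section \<open>Trees and unicyclic graphs\<close>

text \<open>The argument does not reveal which of the two irreducible factors belongs to the tree
  component, so everything that depends on the assignment is proved for a fixed pair of roles and
  then used for either order. Both factors are simple because each divides the characteristic
  polynomial at least once and \<open>main_factor_mult T = 2\<close> leaves room for no more. The
  tree \<open>T\<close> itself does not split; only its walk counts are sums of those of the two
  components. Annihilation therefore passes between \<open>T\<close> and the mate through the
  quadratic form, which is where an ordered field enters. The vectors h(A)1 are functions on
  vertices: a walk that starts in a union of components stays there, so restricting to a component
  costs nothing. Matrices come in for determinants, inverses, traces and eigenvectors. Divisibility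
  takes place over the rationals, main eigenvalues are real, and the complex numbers serve to split
  characteristic polynomials. The bound 4 is the length of the shortest even cycle.\<close>

definition nbrs :: "'v ugraph \<Rightarrow> 'v \<Rightarrow> 'v set" where
  "nbrs G v = {u. {u, v} \<in> edges G}"

lemma nbrs_sym: "u \<in> nbrs G v \<longleftrightarrow> v \<in> nbrs G u"
  by (simp add: nbrs_def insert_commute)

lemma simple_graph_edgeD:
  assumes "simple_graph G" "{u, v} \<in> edges G"
  shows "u \<in> verts G" "v \<in> verts G" "u \<noteq> v"
proof -
  have "{u, v} \<subseteq> verts G" "card {u, v} = 2"
    using assms unfolding simple_graph_def by blast+
  then show "u \<in> verts G" "v \<in> verts G" "u \<noteq> v"
    by (auto split: if_splits)
qed

lemma simple_graph_edgeE:
  assumes "simple_graph G" "e \<in> edges G"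
  obtains u v where "e = {u, v}" "u \<noteq> v" "u \<in> verts G" "v \<in> verts G"
proof -
  have "card e = 2" "e \<subseteq> verts G" using assms unfolding simple_graph_def by blast+
  then show ?thesis using that by (metis card_2_iff insert_subset)
qed

lemma finite_verts: "simple_graph G \<Longrightarrow> finite (verts G)"
  by (simp add: simple_graph_def)

lemma finite_edges: "simple_graph G \<Longrightarrow> finite (edges G)"
  by (rule finite_subset[of _ "Pow (verts G)"]) (auto simp: simple_graph_def)

lemma nbrs_subset: "simple_graph G \<Longrightarrow> nbrs G v \<subseteq> verts G"
  by (auto simp: nbrs_def dest: simple_graph_edgeD)

lemma finite_nbrs: "simple_graph G \<Longrightarrow> finite (nbrs G v)"
  using nbrs_subset finite_verts finite_subset by metis

text \<open>Symmetry of A: the adjacency operator moves from one factor of an inner product to the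
  other. In this form the symmetry enters the arguments about walks, degrees and
  eigenvectors.\<close>

lemma sum_nbrs_swap:
  fixes x y :: "'v \<Rightarrow> 'a :: comm_semiring_0"
  assumes "simple_graph G"
  shows "(\<Sum>v\<in>verts G. (\<Sum>u\<in>nbrs G v. x u) * y v) = (\<Sum>v\<in>verts G. x v * (\<Sum>u\<in>nbrs G v. y u))"
proof -
  have nb: "nbrs G v = {u \<in> verts G. u \<in> nbrs G v}" for v
    using nbrs_subset[OF assms] by blast
  have nb': "{v \<in> verts G. u \<in> nbrs G v} = nbrs G u" for u
    using nbrs_subset[OF assms] nbrs_sym[of u G] by blast
  have "(\<Sum>v\<in>verts G. (\<Sum>u\<in>nbrs G v. x u) * y v) = (\<Sum>v\<in>verts G. \<Sum>u\<in>{u \<in> verts G. u \<in> nbrs G v}. x u * y v)"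
    by (simp add: sum_distrib_right nb[symmetric])
  also have "\<dots> = (\<Sum>u\<in>verts G. \<Sum>v\<in>{v \<in> verts G. u \<in> nbrs G v}. x u * y v)"
    by (rule sum.swap_restrict) (use finite_verts[OF assms] in auto)
  also have "\<dots> = (\<Sum>u\<in>verts G. x u * (\<Sum>v\<in>nbrs G u. y v))"
    by (simp add: sum_distrib_left nb')
  finally show ?thesis .
qed

lemma sum_card_nbrs:
  assumes G: "simple_graph G"
  shows "(\<Sum>v\<in>verts G. card (nbrs G v)) = 2 * card (edges G)"
proof -
  have bij: "card {e \<in> edges G. v \<in> e} = card (nbrs G v)" for v
  proof -
    have "bij_betw (\<lambda>u. {u, v}) (nbrs G v) {e \<in> edges G. v \<in> e}"
    proof (rule bij_betwI')
      fix x y assume "x \<in> nbrs G v" "y \<in> nbrs G v"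
      then show "({x, v} = {y, v}) = (x = y)"
        by (auto simp: doubleton_eq_iff)
    next
      fix x assume "x \<in> nbrs G v" then show "{x, v} \<in> {e \<in> edges G. v \<in> e}" by (auto simp: nbrs_def)
    next
      fix e assume e: "e \<in> {e \<in> edges G. v \<in> e}"
      then obtain a b where "e = {a, b}" using simple_graph_edgeE[OF G] by blast
      with e show "\<exists>x\<in>nbrs G v. e = {x, v}"
        by (auto simp: nbrs_def insert_commute)
    qed
    then show ?thesis by (simp add: bij_betw_same_card)
  qed
  have "(\<Sum>v\<in>verts G. card {e \<in> edges G. v \<in> e}) = 2 * card (edges G)"
  proof (rule sum_multicount[OF finite_verts[OF G] finite_edges[OF G]])
    show "\<forall>e\<in>edges G. card {v \<in> verts G. v \<in> e} = 2"
    proof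
      fix e assume "e \<in> edges G"
      then have "e \<subseteq> verts G" "card e = 2" using G unfolding simple_graph_def by blast+
      then have "{v \<in> verts G. v \<in> e} = e" "card e = 2" by blast+
      then show "card {v \<in> verts G. v \<in> e} = 2" by simp
    qed
  qed
  then show ?thesis by (simp add: bij)
qed

section \<open>Connectedness and breadth-first trees\<close>

lemma adj_rel_sym: "sym (adj_rel G)"
  by (auto simp: sym_def adj_rel_def insert_commute)

lemma adj_rel_iff: "(u, v) \<in> adj_rel G \<longleftrightarrow> u \<in> nbrs G v"
  by (simp add: adj_rel_def nbrs_def)

text \<open>A walk that starts in \<open>S\<close> never leaves it. The principle is used to show
  that a longest path or a cycle already covers a connected graph.\<close>

lemma connected_graph_closed:
  assumes "connected_graph G" "S \<inter> verts G \<noteq> {}" "\<And>u v. u \<in> S \<Longrightarrow> v \<in> nbrs G u \<Longrightarrow> v \<in> S"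
  shows "verts G \<subseteq> S"
proof
  fix v assume v: "v \<in> verts G"
  obtain s where s: "s \<in> S" "s \<in> verts G" using assms(2) by blast
  have "(s, v) \<in> (adj_rel G)\<^sup>*" using assms(1) s v unfolding connected_graph_def by blast
  then show "v \<in> S"
    by (induction rule: rtrancl_induct) (use s assms(3) in \<open>auto simp: adj_rel_iff nbrs_sym\<close>)
qed

lemma connected_nbrs_nonempty:
  assumes "connected_graph G" "v \<in> verts G" "card (verts G) \<ge> 2"
  shows "nbrs G v \<noteq> {}"
proof
  assume "nbrs G v = {}"
  then have "verts G \<subseteq> {v}" using connected_graph_closed[OF assms(1), of "{v}"] assms(2) by auto
  then have "card (verts G) \<le> 1" using card_mono[of "{v}"] by auto
  with assms(3) show False by simp
qed

text \<open>The function \<open>d\<close> is the distance from the root \<open>r\<close>.\<close>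

lemma connected_parents:
  assumes G: "simple_graph G" "connected_graph G" and r: "r \<in> verts G"
  obtains par d where "\<And>v. v \<in> verts G \<Longrightarrow> v \<noteq> r \<Longrightarrow> {v, par v} \<in> edges G \<and> d v = Suc (d (par v))"
proof -
  define R where "R = adj_rel G"
  define d where "d v = (LEAST n. (r, v) \<in> R ^^ n)" for v
  have ex: "\<exists>n. (r, v) \<in> R ^^ n" if "v \<in> verts G" for v
    using G(2) that r unfolding connected_graph_def R_def by (meson rtrancl_imp_relpow)
  have dI: "(r, v) \<in> R ^^ d v" if "v \<in> verts G" for v
    unfolding d_def using LeastI_ex[OF ex[OF that]] .
  have "\<exists>y. {v, y} \<in> edges G \<and> d v = Suc (d y)" if v: "v \<in> verts G" "v \<noteq> r" for v
  proof -
    have "d v \<noteq> 0" using dI[OF v(1)] v(2) by (metis relpow_0_E)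
    then obtain m where m: "d v = Suc m" using not0_implies_Suc by blast
    then obtain y where y: "(r, y) \<in> R ^^ m" "(y, v) \<in> R" using dI[OF v(1)] by (metis relpow_Suc_E)
    have e: "{v, y} \<in> edges G" using y(2) by (simp add: R_def adj_rel_def insert_commute)
    have yV: "y \<in> verts G" using simple_graph_edgeD[OF G(1) e] by simp
    have "d y \<le> m" unfolding d_def using y(1) by (rule Least_le)
    moreover have "(r, v) \<in> R ^^ Suc (d y)" using dI[OF yV] y(2) by auto
    then have "d v \<le> Suc (d y)" unfolding d_def[of v] by (rule Least_le)
    ultimately show ?thesis using e m by auto
  qed
  then obtain par where "\<And>v. v \<in> verts G \<Longrightarrow> v \<noteq> r \<Longrightarrow> {v, par v} \<in> edges G \<and> d v = Suc (d (par v))"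
    by metis
  then show ?thesis using that by blast
qed

text \<open>If two distinct vertices gave the same edge, each would be the parent of the other, and
  each depth would exceed the other by one.\<close>

lemma parent_edges_inj:
  assumes "\<And>v. v \<in> S \<Longrightarrow> d v = Suc (d (par v))"
  shows "inj_on (\<lambda>v. {v, par v}) S"
proof (rule inj_onI)
  fix u v assume uv: "u \<in> S" "v \<in> S" "{u, par u} = {v, par v}"
  then have "u = v \<or> (u = par v \<and> v = par u)" by (auto simp: doubleton_eq_iff)
  moreover have False if "u = par v" "v = par u"
    using assms[OF uv(1)] assms[OF uv(2)] unfolding that(1)[symmetric] that(2)[symmetric] by linarith
  ultimately show "u = v" by blast
qed

text \<open>The parent edges are distinct, one for every vertex other than the root.\<close>

lemma connected_card_le:
  assumes G: "simple_graph G" "connected_graph G"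
  shows "card (verts G) \<le> card (edges G) + 1"
proof -
  obtain r where r: "r \<in> verts G" using G(2) unfolding connected_graph_def by blast
  obtain par d where pd: "\<And>v. v \<in> verts G \<Longrightarrow> v \<noteq> r \<Longrightarrow> {v, par v} \<in> edges G \<and> d v = Suc (d (par v))"
    using connected_parents[OF G r] by blast
  have "card ((\<lambda>v. {v, par v}) ` (verts G - {r})) = card (verts G - {r})"
    by (rule card_image, rule parent_edges_inj[of _ d]) (use pd in blast)
  moreover have "(\<lambda>v. {v, par v}) ` (verts G - {r}) \<subseteq> edges G" using pd by blast
  ultimately have "card (verts G - {r}) \<le> card (edges G)"
    using card_mono[OF finite_edges[OF G(1)]] by metis
  then show ?thesis using r finite_verts[OF G(1)] by simp
qed

text \<open>With so few edges every edge joins a vertex to its parent, so the parity of the distance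
  to the root is a proper colouring.\<close>

lemma connected_card_eq_bipartite:
  assumes G: "simple_graph G" "connected_graph G" and eq: "card (verts G) = card (edges G) + 1"
  obtains c :: "'v \<Rightarrow> bool" where "\<And>u v. {u, v} \<in> edges G \<Longrightarrow> c u \<noteq> c v"
proof -
  obtain r where r: "r \<in> verts G" using G(2) unfolding connected_graph_def by blast
  obtain par d where pd: "\<And>v. v \<in> verts G \<Longrightarrow> v \<noteq> r \<Longrightarrow> {v, par v} \<in> edges G \<and> d v = Suc (d (par v))"
    using connected_parents[OF G r] by blast
  have "card ((\<lambda>v. {v, par v}) ` (verts G - {r})) = card (verts G - {r})"
    by (rule card_image, rule parent_edges_inj[of _ d]) (use pd in blast)
  then have "card ((\<lambda>v. {v, par v}) ` (verts G - {r})) = card (edges G)"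
    using eq r finite_verts[OF G(1)] by simp
  moreover have "(\<lambda>v. {v, par v}) ` (verts G - {r}) \<subseteq> edges G" using pd by blast
  ultimately have im: "(\<lambda>v. {v, par v}) ` (verts G - {r}) = edges G"
    using card_subset_eq[OF finite_edges[OF G(1)]] by blast
  have "even (d u) \<noteq> even (d v)" if "{u, v} \<in> edges G" for u v
  proof -
    have "{u, v} \<in> (\<lambda>v. {v, par v}) ` (verts G - {r})" using that im by simp
    then obtain w where w: "w \<in> verts G" "w \<noteq> r" "{u, v} = {w, par w}" by blast
    have "d w = Suc (d (par w))" using pd w by blast
    with w(3) show ?thesis by (auto simp: doubleton_eq_iff)
  qed
  then show ?thesis by (rule that[of "\<lambda>v. even (d v)"])
qed

section \<open>Edge sets of paths and cycles\<close>

lemma path_edges_simps [simp]: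
  "path_edges [] = {}" "path_edges [x] = {}"
  "path_edges (x # y # zs) = insert {x, y} (path_edges (y # zs))"
proof -
  show "path_edges (x # y # zs) = insert {x, y} (path_edges (y # zs))"
  proof (rule equalityI; rule subsetI)
    fix e assume "e \<in> path_edges (x # y # zs)"
    then obtain i where i: "Suc i < length (x # y # zs)"
      "e = {(x # y # zs) ! i, (x # y # zs) ! Suc i}" unfolding path_edges_def by blast
    show "e \<in> insert {x, y} (path_edges (y # zs))"
    proof (cases i)
      case (Suc j)
      then have "Suc j < length (y # zs)" "e = {(y # zs) ! j, (y # zs) ! Suc j}" using i by auto
      then show ?thesis unfolding path_edges_def by blast
    qed (use i in simp)
  next
    fix e assume "e \<in> insert {x, y} (path_edges (y # zs))"
    then consider "e = {x, y}" | j where "Suc j < length (y # zs)" "e = {(y # zs) ! j, (y # zs) ! Suc j}"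
      unfolding path_edges_def by blast
    then show "e \<in> path_edges (x # y # zs)"
    proof cases
      case 1 then show ?thesis unfolding path_edges_def by (intro CollectI exI[of _ 0]) auto
    next
      case 2 then show ?thesis unfolding path_edges_def by (intro CollectI exI[of _ "Suc j"]) auto
    qed
  qed
qed (auto simp: path_edges_def)

lemma path_edges_append:
  "vs \<noteq> [] \<Longrightarrow> path_edges (vs @ [x]) = insert {last vs, x} (path_edges vs)"
proof (induction vs)
  case (Cons a vs)
  then show ?case by (cases vs) auto
qed simp

lemma path_edges_rev: "path_edges (rev vs) = path_edges vs"
proof (induction vs)
  case (Cons a vs)
  show ?case
  proof (cases vs)
    case (Cons b ws)
    have "path_edges (rev (a # vs)) = insert {last (rev vs), a} (path_edges (rev vs))"
      using path_edges_append[of "rev vs" a] Cons by simp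
    also have "\<dots> = path_edges (a # vs)" using Cons.IH Cons by (simp add: insert_commute)
    finally show ?thesis .
  qed simp
qed simp

lemma cycle_edges_eq:
  assumes "vs \<noteq> []"
  shows "cycle_edges vs = insert {last vs, hd vs} (path_edges vs)"
proof -
  have "{i. i < length vs} = insert (length vs - 1) {i. Suc i < length vs}" using assms by auto
  then have "cycle_edges vs = (\<lambda>i. {vs ! i, vs ! (Suc i mod length vs)}) ` insert (length vs - 1) {i. Suc i < length vs}"
    unfolding cycle_edges_def by blast
  also have "\<dots> = insert {last vs, hd vs} ((\<lambda>i. {vs ! i, vs ! (Suc i mod length vs)}) ` {i. Suc i < length vs})"
    using assms by (simp add: last_conv_nth hd_conv_nth)
  also have "(\<lambda>i. {vs ! i, vs ! (Suc i mod length vs)}) ` {i. Suc i < length vs} = path_edges vs"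
    unfolding path_edges_def by (auto simp: image_def)
  finally show ?thesis .
qed

lemma card_path_edges:
  assumes "distinct vs"
  shows "card (path_edges vs) = length vs - 1"
proof -
  have "path_edges vs = (\<lambda>i. {vs ! i, vs ! Suc i}) ` {..<length vs - 1}"
    unfolding path_edges_def by auto
  moreover have "inj_on (\<lambda>i. {vs ! i, vs ! Suc i}) {..<length vs - 1}"
    by (rule inj_onI) (auto simp: doubleton_eq_iff nth_eq_iff_index_eq[OF assms])
  ultimately show ?thesis by (simp add: card_image)
qed

text \<open>Two different positions give the same edge only if each is the cyclic successor of the
  other, which forces the length to divide 2; the bound 3 excludes this.\<close>

lemma cycle_edge_inj:
  assumes "distinct vs" "3 \<le> length vs"
  shows "inj_on (\<lambda>i. {vs ! i, vs ! (Suc i mod length vs)}) {..<length vs}"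
proof (rule inj_onI)
  fix k l assume k: "k \<in> {..<length vs}" and l: "l \<in> {..<length vs}"
    and e: "{vs ! k, vs ! (Suc k mod length vs)} = {vs ! l, vs ! (Suc l mod length vs)}"
  have ml: "Suc j mod length vs < length vs" for j using assms(2) by (intro mod_less_divisor) linarith
  have "k = l \<or> (k = Suc l mod length vs \<and> Suc k mod length vs = l)"
    using e k l ml by (auto simp: doubleton_eq_iff nth_eq_iff_index_eq[OF assms(1)])
  moreover have False if "k = Suc l mod length vs" "Suc k mod length vs = l"
    using that k l assms(2) by (auto simp: mod_Suc split: if_splits)
  ultimately show "k = l" by blast
qed

lemma card_cycle_edges:
  assumes "distinct vs" "3 \<le> length vs"
  shows "card (cycle_edges vs) = length vs"
proof -
  have "cycle_edges vs = (\<lambda>i. {vs ! i, vs ! (Suc i mod length vs)}) ` {..<length vs}"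
    unfolding cycle_edges_def by auto
  then show ?thesis using card_image[OF cycle_edge_inj[OF assms]] by simp
qed

section \<open>Longest paths and leaves\<close>

definition path_in :: "'v ugraph \<Rightarrow> 'v list \<Rightarrow> bool" where
  "path_in G vs \<longleftrightarrow> vs \<noteq> [] \<and> distinct vs \<and> set vs \<subseteq> verts G \<and> path_edges vs \<subseteq> edges G"

lemma path_in_rev: "path_in G (rev vs) \<longleftrightarrow> path_in G vs"
  by (simp add: path_in_def path_edges_rev)

lemma path_in_Cons:
  assumes "path_in G vs" "u \<in> nbrs G (hd vs)" "u \<in> verts G" "u \<notin> set vs"
  shows "path_in G (u # vs)"
  using assms by (cases vs) (auto simp: path_in_def nbrs_def)

lemma path_in_nth_nbrs:
  assumes "path_in G vs" "Suc i < length vs"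
  shows "vs ! i \<in> nbrs G (vs ! Suc i)"
  using assms unfolding path_in_def path_edges_def nbrs_def by blast

lemma longest_path:
  assumes "finite (verts G)" "path_in G ws"
  obtains vs where "path_in G vs" "\<And>us. path_in G us \<Longrightarrow> length us \<le> length vs"
proof -
  have bd: "length us \<le> card (verts G)" if "path_in G us" for us
    using that assms(1) unfolding path_in_def by (metis card_mono distinct_card)
  have "\<exists>m. (\<exists>vs. path_in G vs \<and> length vs = m) \<and> (\<forall>y. (\<exists>vs. path_in G vs \<and> length vs = y) \<longrightarrow> y \<le> m)"
    by (rule Nat.ex_has_greatest_nat[where b = "card (verts G)"]) (use assms(2) bd in auto)
  then show ?thesis using that by blast
qed

lemma maximal_path_nbrs_hd:
  assumes G: "simple_graph G" and p: "path_in G vs"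
    and m: "\<And>us. path_in G us \<Longrightarrow> length us \<le> length vs"
  shows "nbrs G (hd vs) \<subseteq> set vs"
proof
  fix u assume u: "u \<in> nbrs G (hd vs)"
  show "u \<in> set vs"
  proof (rule ccontr)
    assume "u \<notin> set vs"
    then have "path_in G (u # vs)" using path_in_Cons[OF p u] nbrs_subset[OF G] u by blast
    then show False using m by fastforce
  qed
qed

lemma path_edges_take: "path_edges (take k vs) \<subseteq> path_edges vs"
  unfolding path_edges_def by auto

lemma path_in_edge:
  assumes "simple_graph G" "{u, v} \<in> edges G"
  shows "path_in G [u, v]"
  using simple_graph_edgeD[OF assms] assms(2) by (auto simp: path_in_def)

text \<open>The leaf is the head of a longest path: by maximality its neighbours lie on the path,
  and any neighbour other than the next vertex would close a cycle.\<close>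

lemma acyclic_leaf:
  assumes G: "simple_graph G" and ac: "cycles_of G = {}" and e: "edges G \<noteq> {}"
  obtains v w where "v \<in> verts G" "nbrs G v = {w}"
proof -
  obtain a b where ab: "{a, b} \<in> edges G" using e simple_graph_edgeE[OF G] by (metis ex_in_conv)
  obtain vs where vs: "path_in G vs" and m: "\<And>us. path_in G us \<Longrightarrow> length us \<le> length vs"
    using longest_path[OF finite_verts[OF G] path_in_edge[OF G ab]] by blast
  have len: "2 \<le> length vs" using m[OF path_in_edge[OF G ab]] by simp
  have "nbrs G (hd vs) = {vs ! 1}"
  proof
    show "{vs ! 1} \<subseteq> nbrs G (hd vs)"
      using path_in_nth_nbrs[OF vs, of 0] len
      by (simp add: nbrs_sym[of _ _ "vs ! 0"] hd_conv_nth vs[unfolded path_in_def])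
  next
    show "nbrs G (hd vs) \<subseteq> {vs ! 1}"
    proof
      fix u assume u: "u \<in> nbrs G (hd vs)"
      then obtain j where j: "j < length vs" "u = vs ! j"
        using maximal_path_nbrs_hd[OF G vs m] by (metis in_set_conv_nth subsetD)
      have "u \<noteq> hd vs" using u simple_graph_edgeD(3)[OF G] by (auto simp: nbrs_def)
      then have "j \<noteq> 0" using j len by (metis hd_conv_nth list.size(3) not_numeral_le_zero)
      have "\<not> 2 \<le> j"
      proof
        assume j2: "2 \<le> j"
        \<comment> \<open>The initial segment ending in \<open>u\<close> has \<open>j + 1\<close>,
          hence at least 3, vertices, and the edge from \<open>u\<close> back to the head closes
          it.\<close>
        define ws where "ws = take (Suc j) vs"
        have ws: "distinct ws" "3 \<le> length ws" "ws \<noteq> []" "last ws = u" "hd ws = hd vs"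
          using vs j j2 len unfolding ws_def path_in_def
          by (simp_all add: last_conv_nth)
        have "path_edges ws \<subseteq> edges G"
          using path_edges_take vs unfolding path_in_def ws_def by blast
        then have "cycle_edges ws \<subseteq> edges G"
          using u ws by (simp add: cycle_edges_eq nbrs_def)
        then have "cycle_edges ws \<in> cycles_of G" using ws unfolding cycles_of_def by blast
        then show False using ac by simp
      qed
      then have "j = 1" using \<open>j \<noteq> 0\<close> by simp
      then show "u \<in> {vs ! 1}" using j by simp
    qed
  qed
  moreover have "hd vs \<in> verts G" using vs unfolding path_in_def by (meson hd_in_set subsetD)
  ultimately show ?thesis using that by blast
qed

text \<open>A leaf is deleted together with its edge, so both numbers drop by one. The other end of
  that edge remains, which keeps the smaller graph nonempty.\<close>

lemma acyclic_card_le: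
  assumes "simple_graph G" "cycles_of G = {}" "verts G \<noteq> {}"
  shows "card (edges G) + 1 \<le> card (verts G)"
  using assms
proof (induction "card (edges G)" arbitrary: G rule: less_induct)
  case less
  note G = less.prems(1)
  show ?case
  proof (cases "edges G = {}")
    case True
    then show ?thesis using less.prems(3) finite_verts[OF G] by (simp add: Suc_leI card_gt_0_iff)
  next
    case False
    obtain v w where vw: "v \<in> verts G" "nbrs G v = {w}"
      using acyclic_leaf[OF G less.prems(2) False] by blast
    have e: "{w, v} \<in> edges G" using vw by (auto simp: nbrs_def)
    note wv = simple_graph_edgeD[OF G e]
    define G' :: "'a ugraph" where "G' = \<lparr>verts = verts G - {v}, edges = edges G - {{w, v}}\<rparr>"
    have G': "simple_graph G'"
      unfolding simple_graph_def
    proof (intro conjI ballI)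
      show "finite (verts G')" using finite_verts[OF G] by (simp add: G'_def)
    next
      fix f assume f: "f \<in> edges G'"
      then have f': "f \<in> edges G" "f \<noteq> {w, v}" by (auto simp: G'_def)
      obtain a b where ab: "f = {a, b}" "a \<noteq> b" "a \<in> verts G" "b \<in> verts G"
        using simple_graph_edgeE[OF G f'(1)] by blast
      \<comment> \<open>The deleted edge is the only one at the leaf, so all other edges survive
        within the remaining vertices.\<close>
      have "v \<notin> f"
      proof
        assume "v \<in> f"
        then have "\<exists>c. f = {c, v}" using ab by (auto simp: insert_commute)
        then obtain c where "f = {c, v}" by blast
        then have "c \<in> nbrs G v" using f' by (simp add: nbrs_def)
        then show False using vw f' \<open>f = {c, v}\<close> by simp
      qed
      then show "f \<subseteq> verts G'" using ab by (auto simp: G'_def)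
      show "card f = 2" using ab by simp
    qed
    have c: "card (edges G') = card (edges G) - 1" using e finite_edges[OF G] by (simp add: G'_def)
    have pos: "card (edges G) > 0" using e finite_edges[OF G] by (auto simp: card_gt_0_iff)
    have "cycles_of G' \<subseteq> cycles_of G" unfolding cycles_of_def G'_def by auto
    then have "card (edges G') + 1 \<le> card (verts G')"
      using less.hyps[OF _ G'] less.prems(2) c pos wv by (auto simp: G'_def)
    then show ?thesis using c pos vw(1) finite_verts[OF G] by (simp add: G'_def)
  qed
qed

section \<open>Deleting an edge of a cycle\<close>

definition delete_edge :: "'v ugraph \<Rightarrow> 'v set \<Rightarrow> 'v ugraph" where
  "delete_edge G e = \<lparr>verts = verts G, edges = edges G - {e}\<rparr>"

lemma delete_edge_simple: "simple_graph G \<Longrightarrow> simple_graph (delete_edge G e)"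
  by (auto simp: simple_graph_def delete_edge_def)

lemma cycle_edges_card3:
  assumes "C \<in> cycles_of G"
  shows "card C \<ge> 3" "C \<subseteq> edges G"
  using assms unfolding cycles_of_def by (auto simp: card_cycle_edges)

text \<open>The rest of the cycle bypasses the deleted edge.\<close>

lemma delete_edge_connected:
  assumes con: "connected_graph G" and C: "C \<in> cycles_of G" and e: "e \<in> C"
  shows "connected_graph (delete_edge G e)"
proof -
  obtain vs where vs: "C = cycle_edges vs" "distinct vs" "3 \<le> length vs" "cycle_edges vs \<subseteq> edges G"
    using C unfolding cycles_of_def by blast
  define n where "n = length vs"
  obtain i where i: "i < n" "e = {vs ! i, vs ! (Suc i mod n)}"
    using e vs(1) unfolding cycle_edges_def n_def by blast
  define R where "R = adj_rel (delete_edge G e)"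
  \<comment> \<open>\<open>F\<close> runs around the cycle from the far end of the deleted edge. Its
    first \<open>n - 1\<close> steps never start at position \<open>i\<close>, so they avoid that
    edge and end at its other end.\<close>
  define F where "F j = vs ! ((Suc i + j) mod n)" for j
  have symR: "sym (R\<^sup>*)" unfolding R_def by (intro sym_rtrancl adj_rel_sym)
  have step: "(F j, F (Suc j)) \<in> R" if j: "j < n - 1" for j
  proof -
    define k where "k = (Suc i + j) mod n"
    have k: "k < n" "k \<noteq> i"
      using j i unfolding k_def by (auto simp: mod_if mod_Suc split: if_splits)
    have eq: "{F j, F (Suc j)} = {vs ! k, vs ! (Suc k mod n)}"
      unfolding F_def k_def by (simp add: mod_Suc_eq)
    have "{vs ! k, vs ! (Suc k mod n)} \<noteq> e"
      using inj_onD[OF cycle_edge_inj[OF vs(2,3)], of k i] k i unfolding n_def by auto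
    moreover have "{vs ! k, vs ! (Suc k mod n)} \<in> edges G"
      using vs(4) k unfolding cycle_edges_def n_def by blast
    ultimately show ?thesis unfolding R_def adj_rel_def delete_edge_def using eq by simp
  qed
  have "(F 0, F j) \<in> R\<^sup>*" if "j \<le> n - 1" for j
    using that
  proof (induction j)
    case (Suc j)
    then show ?case using step[of j] by (meson Suc_le_eq less_or_eq_imp_le rtrancl.rtrancl_into_rtrancl)
  qed simp
  then have "(F 0, F (n - 1)) \<in> R\<^sup>*" by simp
  moreover have "F 0 = vs ! (Suc i mod n)" "F (n - 1) = vs ! i"
    using i by (auto simp: F_def)
  ultimately have bypass: "(vs ! i, vs ! (Suc i mod n)) \<in> R\<^sup>*" "(vs ! (Suc i mod n), vs ! i) \<in> R\<^sup>*"
    using symR by (auto dest: symD)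
  have sub: "adj_rel G \<subseteq> R\<^sup>*"
  proof
    fix x assume "x \<in> adj_rel G"
    then obtain u v where x: "x = (u, v)" "{u, v} \<in> edges G" unfolding adj_rel_def by blast
    show "x \<in> R\<^sup>*"
    proof (cases "{u, v} = e")
      case True
      then show ?thesis using x i bypass by (auto simp: doubleton_eq_iff)
    next
      case False
      then have "x \<in> R" using x unfolding R_def adj_rel_def delete_edge_def by simp
      then show ?thesis by blast
    qed
  qed
  have "(adj_rel G)\<^sup>* \<subseteq> R\<^sup>*" using rtrancl_mono[OF sub] by simp
  then show ?thesis using con unfolding connected_graph_def R_def[symmetric]
    by (auto simp: delete_edge_def)
qed

text \<open>One direction combines the two opposite inequalities. For the other, deleting an edge of
  a cycle would leave a connected graph with too few edges.\<close>

lemma connected_acyclic_iff: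
  assumes G: "simple_graph G" "connected_graph G"
  shows "cycles_of G = {} \<longleftrightarrow> card (verts G) = card (edges G) + 1"
proof
  assume "cycles_of G = {}"
  then show "card (verts G) = card (edges G) + 1"
    using acyclic_card_le[OF G(1)] connected_card_le[OF G] G(2) unfolding connected_graph_def by simp
next
  assume eq: "card (verts G) = card (edges G) + 1"
  show "cycles_of G = {}"
  proof (rule ccontr)
    assume "cycles_of G \<noteq> {}"
    then obtain C where C: "C \<in> cycles_of G" by blast
    then obtain e where e: "e \<in> C" using cycle_edges_card3[OF C] by fastforce
    have "card (verts G) \<le> card (edges (delete_edge G e)) + 1"
      using connected_card_le[OF delete_edge_simple[OF G(1)] delete_edge_connected[OF G(2) C e]]
      by (simp add: delete_edge_def)
    moreover have "e \<in> edges G" using cycle_edges_card3[OF C] e by blast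
    then have "card (edges (delete_edge G e)) < card (edges G)"
      using finite_edges[OF G(1)] unfolding delete_edge_def by (simp only: ugraph.simps card_Diff1_less)
    ultimately show False using eq by simp
  qed
qed

lemma tree_graph_card: "tree_graph G \<Longrightarrow> card (verts G) = card (edges G) + 1"
  unfolding tree_graph_def using connected_acyclic_iff by blast

text \<open>Deleting any edge of one cycle leaves a connected graph with the edge count of a tree,
  hence no cycle. A cycle that avoids this edge would survive the deletion, so any two cycles
  contain each other.\<close>

lemma connected_card_eq_unicyclic:
  assumes G: "simple_graph G" "connected_graph G" and eq: "card (verts G) = card (edges G)"
  shows "unicyclic_graph G"
proof -
  have "cycles_of G \<noteq> {}" using connected_acyclic_iff[OF G] eq by simp
  then obtain C where C: "C \<in> cycles_of G" by blast
  have sub: "C \<subseteq> D" if C: "C \<in> cycles_of G" and D: "D \<in> cycles_of G" for C D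
  proof
    fix e assume e: "e \<in> C"
    show "e \<in> D"
    proof (rule ccontr)
      assume eD: "e \<notin> D"
      have "e \<in> edges G" using cycle_edges_card3[OF C] e by blast
      then have "card (verts (delete_edge G e)) = card (edges (delete_edge G e)) + 1"
        using eq card_Suc_Diff1[OF finite_edges[OF G(1)]] by (simp add: delete_edge_def)
      then have "cycles_of (delete_edge G e) = {}"
        using connected_acyclic_iff[OF delete_edge_simple[OF G(1)] delete_edge_connected[OF G(2) C e]] by simp
      moreover have "D \<in> cycles_of (delete_edge G e)"
        using D eD unfolding cycles_of_def delete_edge_def by auto
      ultimately show False by simp
    qed
  qed
  have "\<exists>!C. C \<in> cycles_of G"
  proof (rule ex1I[of _ C])
    fix D assume "D \<in> cycles_of G"
    then show "D = C" using sub[OF C] sub[of D C] C by blast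
  qed (rule C)
  then show ?thesis using G unfolding unicyclic_graph_def by blast
qed

section \<open>Graphs with all degrees at most two\<close>

lemma card_le_2_of_subset: "A \<subseteq> {a, b} \<Longrightarrow> card A \<le> 2"
  using card_mono[of "{a, b}" A] card_insert_le_m1[of 2 "{b}" a] by simp

lemma path_graph_card_nbrs:
  assumes "is_path_graph G" "v \<in> verts G"
  shows "card (nbrs G v) \<le> 2"
proof -
  obtain vs where vs: "vs \<noteq> []" "distinct vs" "verts G = set vs" "edges G = path_edges vs"
    using assms(1) unfolding is_path_graph_def by blast
  obtain i where i: "i < length vs" "v = vs ! i" using assms(2) vs(3) by (metis in_set_conv_nth)
  have "nbrs G v \<subseteq> {vs ! (i - 1), vs ! Suc i}"
  proof
    fix u assume "u \<in> nbrs G v"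
    then obtain j where j: "Suc j < length vs" "{u, v} = {vs ! j, vs ! Suc j}"
      unfolding nbrs_def vs(4) path_edges_def by blast
    then have "(u = vs ! j \<and> i = Suc j) \<or> (u = vs ! Suc j \<and> i = j)"
      using i vs(2) by (auto simp: doubleton_eq_iff nth_eq_iff_index_eq)
    then show "u \<in> {vs ! (i - 1), vs ! Suc i}" by auto
  qed
  then show ?thesis by (rule card_le_2_of_subset)
qed

lemma three_le_card:
  assumes "finite A" "a \<in> A" "b \<in> A" "c \<in> A" "a \<noteq> b" "a \<noteq> c" "b \<noteq> c"
  shows "3 \<le> card A"
proof -
  have "card {a, b, c} \<le> card A" using assms by (intro card_mono) auto
  then show ?thesis using assms by simp
qed

text \<open>The vertices of a longest path are closed under adjacency: at the ends by maximality,
  inside because two neighbours on the path exhaust the degree. Thus the path is spanning, and a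
  tree has no more edges than a spanning path.\<close>

lemma tree_max_degree_2_path:
  assumes T: "tree_graph G" and d: "\<And>v. v \<in> verts G \<Longrightarrow> card (nbrs G v) \<le> 2"
  shows "is_path_graph G"
proof -
  have G: "simple_graph G" "connected_graph G" using T unfolding tree_graph_def by auto
  obtain r where "r \<in> verts G" using G(2) unfolding connected_graph_def by blast
  then have "path_in G [r]" by (simp add: path_in_def)
  then obtain vs where vs: "path_in G vs" and m: "\<And>us. path_in G us \<Longrightarrow> length us \<le> length vs"
    using longest_path[OF finite_verts[OF G(1)]] by blast
  have p: "vs \<noteq> []" "distinct vs" "set vs \<subseteq> verts G" "path_edges vs \<subseteq> edges G"
    using vs unfolding path_in_def by auto
  have "verts G \<subseteq> set vs"
  proof (rule connected_graph_closed[OF G(2)])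
    show "set vs \<inter> verts G \<noteq> {}" using p by (cases vs) auto
  next
    fix v u assume v: "v \<in> set vs" and u: "u \<in> nbrs G v"
    obtain i where i: "i < length vs" "v = vs ! i" using v by (metis in_set_conv_nth)
    consider "i = 0" | "i = length vs - 1" | "0 < i" "Suc i < length vs" using i by linarith
    then show "u \<in> set vs"
    proof cases
      case 1
      then show ?thesis using maximal_path_nbrs_hd[OF G(1) vs m] u i p(1) by (auto simp: hd_conv_nth)
    next
      case 2
      then have "v = hd (rev vs)" using i p(1) by (simp add: hd_rev last_conv_nth)
      then show ?thesis
        using maximal_path_nbrs_hd[OF G(1), of "rev vs"] vs m u by (auto simp: path_in_rev)
    next
      case 3
      show ?thesis
      proof (rule ccontr)
        assume nu: "u \<notin> set vs"
        have "vs ! (i - 1) \<in> nbrs G v" using path_in_nth_nbrs[OF vs, of "i - 1"] 3 i by simp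
        moreover have "vs ! Suc i \<in> nbrs G v"
          using path_in_nth_nbrs[OF vs, of i] 3 i by (simp add: nbrs_sym[of _ _ "vs ! i"])
        moreover have "vs ! (i - 1) \<noteq> vs ! Suc i" using p(2) 3 by (simp add: nth_eq_iff_index_eq)
        moreover have "u \<noteq> vs ! (i - 1)" "u \<noteq> vs ! Suc i" using nu 3 i by auto
        ultimately have "3 \<le> card (nbrs G v)"
          using u three_le_card[OF finite_nbrs[OF G(1)], where a = u and b = "vs ! (i - 1)" and c = "vs ! Suc i"]
          by blast
        then show False using d[of v] v p(3) by fastforce
      qed
    qed
  qed
  then have V: "verts G = set vs" using p(3) by blast
  have "card (edges G) = card (path_edges vs)"
    using tree_graph_card[OF T] V p(2) by (simp add: card_path_edges distinct_card)
  then have "path_edges vs = edges G" using card_subset_eq[OF finite_edges[OF G(1)] p(4)] by simp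
  then show ?thesis unfolding is_path_graph_def using V p by blast
qed

lemma cycle_graph_card_nbrs:
  assumes "is_cycle_graph n G" "v \<in> verts G"
  shows "card (nbrs G v) \<le> 2"
proof -
  obtain vs where vs: "3 \<le> length vs" "distinct vs" "verts G = set vs" "edges G = cycle_edges vs"
    using assms(1) unfolding is_cycle_graph_def by blast
  obtain i where i: "i < length vs" "v = vs ! i" using assms(2) vs(3) by (metis in_set_conv_nth)
  define pred where "pred = (if i = 0 then length vs - 1 else i - 1)"
  have "nbrs G v \<subseteq> {vs ! pred, vs ! (Suc i mod length vs)}"
  proof
    fix u assume "u \<in> nbrs G v"
    then obtain j where j: "j < length vs" "{u, v} = {vs ! j, vs ! (Suc j mod length vs)}"
      unfolding nbrs_def vs(4) cycle_edges_def by blast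
    have "Suc j mod length vs < length vs" using vs(1) by (intro mod_less_divisor) linarith
    then have "(u = vs ! j \<and> i = Suc j mod length vs) \<or> (u = vs ! (Suc j mod length vs) \<and> i = j)"
      using i j vs(2) by (auto simp: doubleton_eq_iff nth_eq_iff_index_eq)
    moreover have "j = pred" if "i = Suc j mod length vs"
      using that j(1) unfolding pred_def by (auto simp: mod_Suc split: if_splits)
    ultimately show "u \<in> {vs ! pred, vs ! (Suc i mod length vs)}"
      by blast
  qed
  then show ?thesis by (rule card_le_2_of_subset)
qed

text \<open>A vertex of the cycle already has its two cyclic neighbours, so the degree bound leaves
  no exit and the cycle is spanning. Equal numbers of vertices and edges then exclude further
  edges.\<close>

lemma unicyclic_regular_cycle:
  assumes U: "unicyclic_graph G" and eq: "card (verts G) = card (edges G)"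
    and d: "\<And>v. v \<in> verts G \<Longrightarrow> card (nbrs G v) \<le> 2"
  shows "is_cycle_graph (card (verts G)) G"
proof -
  have G: "simple_graph G" "connected_graph G" using U unfolding unicyclic_graph_def by auto
  obtain C where "C \<in> cycles_of G" using U unfolding unicyclic_graph_def by blast
  then obtain vs where vs: "distinct vs" "3 \<le> length vs" "cycle_edges vs \<subseteq> edges G"
    unfolding cycles_of_def by blast
  define n where "n = length vs"
  have n: "3 \<le> n" using vs n_def by simp
  have nb: "vs ! i \<in> nbrs G (vs ! (Suc i mod n))" "vs ! (Suc i mod n) \<in> nbrs G (vs ! i)" if "i < n" for i
    using vs(3) that unfolding cycle_edges_def nbrs_def n_def by (auto simp: insert_commute)
  have sub: "set vs \<subseteq> verts G"
  proof
    fix v assume "v \<in> set vs"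
    then obtain i where "i < n" "v = vs ! i" unfolding n_def by (metis in_set_conv_nth)
    then show "v \<in> verts G" using nb(1) nbrs_subset[OF G(1)] by blast
  qed
  have "verts G \<subseteq> set vs"
  proof (rule connected_graph_closed[OF G(2)])
    show "set vs \<inter> verts G \<noteq> {}" using sub vs(2) by (cases vs) auto
  next
    fix v u assume v: "v \<in> set vs" and u: "u \<in> nbrs G v"
    obtain i where i: "i < n" "v = vs ! i" using v unfolding n_def by (metis in_set_conv_nth)
    \<comment> \<open>The cyclic predecessor of \<open>i\<close>. It differs from the successor
      because \<open>n\<close> is at least 3.\<close>
    define j where "j = (if i = 0 then n - 1 else i - 1)"
    have j: "j < n" "Suc j mod n = i" "j \<noteq> Suc i mod n" "Suc i mod n < n"
      using i n unfolding j_def by (auto simp: mod_Suc)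
    show "u \<in> set vs"
    proof (rule ccontr)
      assume nu: "u \<notin> set vs"
      have "vs ! j \<in> nbrs G v" "vs ! (Suc i mod n) \<in> nbrs G v" using nb[of j] nb[of i] i j by auto
      moreover have "vs ! j \<noteq> vs ! (Suc i mod n)" using j vs(1) by (simp add: nth_eq_iff_index_eq n_def)
      moreover have "u \<noteq> vs ! j" "u \<noteq> vs ! (Suc i mod n)" using nu j unfolding n_def by auto
      ultimately have "3 \<le> card (nbrs G v)"
        using u three_le_card[OF finite_nbrs[OF G(1)], where a = u and b = "vs ! j" and c = "vs ! (Suc i mod n)"]
        by blast
      then show False using d[of v] v sub by fastforce
    qed
  qed
  then have V: "verts G = set vs" using sub by blast
  then have cV: "card (verts G) = length vs" using vs(1) by (simp add: distinct_card)
  have "cycle_edges vs = edges G"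
    using card_subset_eq[OF finite_edges[OF G(1)] vs(3)] eq cV by (simp add: card_cycle_edges[OF vs(1,2)])
  then show ?thesis unfolding is_cycle_graph_def using V cV vs by auto
qed

text \<open>The colours alternate along the vertex list, and the closing edge joins position
  \<open>n - 1\<close> to position 0, so \<open>n - 1\<close> is odd.\<close>

lemma bipartite_cycle_even:
  assumes "is_cycle_graph n G" and c: "\<And>u v. {u, v} \<in> edges G \<Longrightarrow> c u \<noteq> (c v :: bool)"
  shows "even n"
proof -
  obtain vs where vs: "3 \<le> n" "length vs = n" "edges G = cycle_edges vs"
    using assms(1) unfolding is_cycle_graph_def by blast
  have step: "c (vs ! i) \<noteq> c (vs ! (Suc i mod n))" if "i < n" for i
    by (rule c) (use that vs in \<open>auto simp: cycle_edges_def\<close>)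
  have "c (vs ! i) = (c (vs ! 0) = even i)" if "i < n" for i
    using that
  proof (induction i)
    case (Suc i)
    then show ?case using step[of i] by auto
  qed simp
  from this[of "n - 1"] step[of "n - 1"] show ?thesis using vs(1) by auto
qed

text \<open>The cycle, taken as a graph of its own, inherits the colouring. Its length is even and
  at least 3, hence at least 4.\<close>

lemma bipartite_unicyclic_card:
  assumes U: "unicyclic_graph G" and c: "\<And>u v. {u, v} \<in> edges G \<Longrightarrow> c u \<noteq> (c v :: bool)"
  shows "4 \<le> card (verts G)"
proof -
  have G: "simple_graph G" using U unfolding unicyclic_graph_def by auto
  obtain C where "C \<in> cycles_of G" using U unfolding unicyclic_graph_def by blast
  then obtain vs where vs: "distinct vs" "3 \<le> length vs" "cycle_edges vs \<subseteq> edges G"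
    unfolding cycles_of_def by blast
  have "is_cycle_graph (length vs) \<lparr>verts = set vs, edges = cycle_edges vs\<rparr>"
    using vs unfolding is_cycle_graph_def by auto
  then have "even (length vs)"
    by (rule bipartite_cycle_even[where c = c]) (use c vs in auto)
  then have "4 \<le> length vs" using vs(2) by presburger
  moreover have "set vs \<subseteq> verts G"
  proof
    fix v assume "v \<in> set vs"
    then obtain i where "i < length vs" "v = vs ! i" by (metis in_set_conv_nth)
    then have "{v, vs ! (Suc i mod length vs)} \<in> edges G" using vs(3) unfolding cycle_edges_def by blast
    then show "v \<in> verts G" using simple_graph_edgeD[OF G] by blast
  qed
  then have "length vs \<le> card (verts G)"
    using card_mono[OF finite_verts[OF G]] distinct_card[OF vs(1)] by metis
  ultimately show ?thesis by simp
qed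

section \<open>Walk counts and degrees\<close>

fun walks :: "'v ugraph \<Rightarrow> nat \<Rightarrow> 'v \<Rightarrow> nat" where
  "walks G 0 v = 1"
| "walks G (Suc k) v = (\<Sum>u\<in>nbrs G v. walks G k u)"

definition walk_count :: "'v ugraph \<Rightarrow> nat \<Rightarrow> nat" where
  "walk_count G k = (\<Sum>v\<in>verts G. walks G k v)"

text \<open>\<open>walk_eval G h v\<close> is the \<open>v\<close>-component of the vector \<open>h(A) \<one>\<close>, and
  \<open>walk_functional G h\<close> is \<open>\<one>\<^sup>T h(A) \<one>\<close>.\<close>

definition walk_eval :: "'v ugraph \<Rightarrow> 'a :: comm_ring_1 poly \<Rightarrow> 'v \<Rightarrow> 'a" where
  "walk_eval G h v = (\<Sum>i\<le>degree h. coeff h i * of_nat (walks G i v))"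

definition walk_functional :: "'v ugraph \<Rightarrow> 'a :: comm_ring_1 poly \<Rightarrow> 'a" where
  "walk_functional G h = (\<Sum>i\<le>degree h. coeff h i * of_nat (walk_count G i))"

text \<open>The equation h(A)1 = 0, stated vertex by vertex so that it restricts to unions of
  components.\<close>

definition walk_annih :: "'v ugraph \<Rightarrow> 'a :: comm_ring_1 poly \<Rightarrow> bool" where
  "walk_annih G h \<longleftrightarrow> (\<forall>v\<in>verts G. walk_eval G h v = 0)"

lemma walk_functional_eq: "walk_functional G h = (\<Sum>v\<in>verts G. walk_eval G h v)"
  unfolding walk_functional_def walk_eval_def walk_count_def
  by (subst sum.swap) (simp add: sum_distrib_left)

lemma walk_eval_bound:
  assumes "degree h \<le> N"
  shows "walk_eval G h v = (\<Sum>i\<le>N. coeff h i * of_nat (walks G i v))"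
  unfolding walk_eval_def
  by (rule sum.mono_neutral_left) (use assms in \<open>auto simp: coeff_eq_0\<close>)

lemma walk_eval_0 [simp]: "walk_eval G 0 v = 0"
  by (simp add: walk_eval_def)

lemma walk_eval_1 [simp]: "walk_eval G 1 v = 1"
  by (simp add: walk_eval_def)

lemma walk_eval_add: "walk_eval G (h + r) v = walk_eval G h v + walk_eval G r v"
proof -
  let ?N = "max (degree h) (degree r)"
  have "walk_eval G (h + r) v = (\<Sum>i\<le>?N. coeff (h + r) i * of_nat (walks G i v))"
    by (rule walk_eval_bound) (rule degree_add_le_max)
  then show ?thesis
    by (simp add: walk_eval_bound[of h ?N] walk_eval_bound[of r ?N] distrib_right sum.distrib)
qed

lemma walk_eval_smult: "walk_eval G (Polynomial.smult a h) v = a * walk_eval G h v"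
  by (subst walk_eval_bound[OF degree_smult_le]) (auto simp: walk_eval_def sum_distrib_left mult.assoc)

text \<open>The Horner step (a + x h)(A)1 = a1 + A h(A)1, on which the inductions over polynomials
  rest.\<close>

lemma walk_eval_pCons: "walk_eval G (pCons a h) v = a + (\<Sum>u\<in>nbrs G v. walk_eval G h u)"
proof -
  have "walk_eval G (pCons a h) v = (\<Sum>i\<le>Suc (degree h). coeff (pCons a h) i * of_nat (walks G i v))"
    by (rule walk_eval_bound) (rule degree_pCons_le)
  also have "\<dots> = a + (\<Sum>i\<le>degree h. coeff h i * (\<Sum>u\<in>nbrs G v. of_nat (walks G i u)))"
    by (subst sum.atMost_Suc_shift) simp
  also have "(\<Sum>i\<le>degree h. coeff h i * (\<Sum>u\<in>nbrs G v. of_nat (walks G i u))) = (\<Sum>u\<in>nbrs G v. walk_eval G h u)"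
    unfolding walk_eval_def by (subst sum.swap) (simp add: sum_distrib_left)
  finally show ?thesis .
qed

lemma walk_eval_diff: "walk_eval G (h - r) v = walk_eval G h v - walk_eval G r v"
  using walk_eval_add[of G "h - r" r v] by simp

lemma walk_annih_add: "walk_annih G h \<Longrightarrow> walk_annih G r \<Longrightarrow> walk_annih G (h + r)"
  by (simp add: walk_annih_def walk_eval_add)

text \<open>Multiplication by x applies A, which sends the zero vector to itself. With closure under
  addition, the annihilating polynomials form an ideal.\<close>

lemma walk_annih_mult:
  assumes "simple_graph G" "walk_annih G h"
  shows "walk_annih G (r * h)"
proof (induction r)
  case 0 then show ?case by (simp add: walk_annih_def)
next
  case (pCons a r)
  have "(\<Sum>u\<in>nbrs G v. walk_eval G (r * h) u) = 0" for v
    by (rule sum.neutral) (use pCons.IH nbrs_subset[OF assms(1)] in \<open>auto simp: walk_annih_def\<close>)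
  then show ?case using assms(2)
    by (simp add: walk_annih_def walk_eval_add walk_eval_smult walk_eval_pCons)
qed

lemma walk_annih_dvd: "simple_graph G \<Longrightarrow> walk_annih G h \<Longrightarrow> h dvd r \<Longrightarrow> walk_annih G r"
  using walk_annih_mult by (metis dvd_def mult.commute)

lemma not_walk_annih_1: "verts G \<noteq> {} \<Longrightarrow> \<not> walk_annih G 1"
  by (auto simp: walk_annih_def)

text \<open>Since A is symmetric, h(A) can be carried over to the second vector, where it merges
  with r(A).\<close>

lemma walk_eval_inner:
  assumes G: "simple_graph G"
  shows "(\<Sum>v\<in>verts G. walk_eval G h v * walk_eval G r v) = walk_functional G (h * r)"
proof (induction h arbitrary: r)
  case 0 then show ?case by (simp add: walk_functional_eq)
next
  case (pCons a h)
  have "(\<Sum>v\<in>verts G. walk_eval G (pCons a h) v * walk_eval G r v)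
      = a * (\<Sum>v\<in>verts G. walk_eval G r v) + (\<Sum>v\<in>verts G. (\<Sum>u\<in>nbrs G v. walk_eval G h u) * walk_eval G r v)"
    by (simp add: walk_eval_pCons distrib_right sum.distrib sum_distrib_left)
  \<comment> \<open>Moving A to the right-hand vector replaces \<open>r\<close> by x times
    \<open>r\<close>, which is why the induction keeps \<open>r\<close> arbitrary.\<close>
  also have "(\<Sum>v\<in>verts G. (\<Sum>u\<in>nbrs G v. walk_eval G h u) * walk_eval G r v)
      = (\<Sum>v\<in>verts G. walk_eval G h v * walk_eval G (pCons 0 r) v)"
    by (simp add: sum_nbrs_swap[OF G] walk_eval_pCons)
  also have "\<dots> = walk_functional G (h * pCons 0 r)" by (rule pCons.IH)
  also have "a * (\<Sum>v\<in>verts G. walk_eval G r v) + walk_functional G (h * pCons 0 r) = walk_functional G (pCons a h * r)"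
    by (simp add: walk_functional_eq walk_eval_add walk_eval_smult sum.distrib sum_distrib_left)
  finally show ?case .
qed

text \<open>In an ordered domain a sum of squares vanishes only if every term does. The right-hand
  side involves walk counts alone, so it can be transferred between graphs that share them.\<close>

lemma walk_annih_iff_functional:
  fixes h :: "'a :: linordered_idom poly"
  assumes "simple_graph G"
  shows "walk_annih G h \<longleftrightarrow> walk_functional G (h * h) = 0"
  unfolding walk_eval_inner[OF assms, symmetric] walk_annih_def
  by (subst sum_nonneg_eq_0_iff) (use finite_verts[OF assms] in auto)

lemma walk_annih_cong:
  fixes h :: "'a :: linordered_idom poly"
  assumes "simple_graph G" "simple_graph H" "\<And>k. walk_count G k = walk_count H k"
  shows "walk_annih G h \<longleftrightarrow> walk_annih H h"
  unfolding walk_annih_iff_functional[OF assms(1)] walk_annih_iff_functional[OF assms(2)]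
  by (simp add: walk_functional_def assms(3))

lemma walk_eval_of_rat:
  "walk_eval G (map_poly of_rat h :: 'a :: field_char_0 poly) v = of_rat (walk_eval G h v)"
  unfolding walk_eval_def by (simp add: of_rat_sum of_rat_mult coeff_map_poly)

lemma walk_annih_of_rat: "walk_annih G (map_poly of_rat h :: 'a :: field_char_0 poly) \<longleftrightarrow> walk_annih G h"
  by (simp add: walk_annih_def walk_eval_of_rat)

lemma walk_eval_linear: "walk_eval G [:- l, 1:] v = (\<Sum>u\<in>nbrs G v. 1) - l"
  by (simp add: walk_eval_pCons)

lemma walk_count_0: "walk_count G 0 = card (verts G)"
  by (simp add: walk_count_def)

lemma walk_count_1: "simple_graph G \<Longrightarrow> walk_count G (Suc 0) = 2 * card (edges G)"
  by (simp add: walk_count_def sum_card_nbrs)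

text \<open>By symmetry the number of walks of length 2 is the squared norm of A1, whose entries are
  the degrees.\<close>

lemma walk_count_2:
  assumes "simple_graph G"
  shows "walk_count G 2 = (\<Sum>v\<in>verts G. (card (nbrs G v))\<^sup>2)"
  using sum_nbrs_swap[OF assms, of "\<lambda>v. card (nbrs G v)" "\<lambda>v. 1"]
  by (simp add: walk_count_def numeral_2_eq_2)

text \<open>Adding the even degree sum turns each d^2 into the product d(d+1) of consecutive
  integers.\<close>

lemma walk_count_2_even:
  assumes "simple_graph G"
  shows "even (walk_count G 2)"
proof -
  have "walk_count G 2 + 2 * card (edges G) = (\<Sum>v\<in>verts G. card (nbrs G v) * (card (nbrs G v) + 1))"
    unfolding walk_count_2[OF assms] sum_card_nbrs[OF assms, symmetric]
    by (simp add: power2_eq_square sum.distrib)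
  moreover have "even (\<Sum>v\<in>verts G. card (nbrs G v) * (card (nbrs G v) + 1))"
    by (rule dvd_sum) simp
  ultimately have "even (walk_count G 2 + 2 * card (edges G))" by simp
  then show ?thesis by simp
qed

text \<open>The excess is \<open>\<Sum>(d-1)(d-2)\<close> for trees and \<open>\<Sum>(d-2)\<^sup>2\<close> for unicyclic graphs.\<close>

lemma tree_walk_count_2:
  assumes T: "tree_graph G"
  shows "int (walk_count G 2) \<ge> 4 * int (card (verts G)) - 6"
    and "card (verts G) \<ge> 2 \<Longrightarrow> int (walk_count G 2) = 4 * int (card (verts G)) - 6 \<longleftrightarrow> is_path_graph G"
proof -
  have G: "simple_graph G" "connected_graph G" using T unfolding tree_graph_def by auto
  let ?d = "\<lambda>v. int (card (nbrs G v))"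
  have s1: "(\<Sum>v\<in>verts G. ?d v) = 2 * (int (card (verts G)) - 1)"
    using sum_card_nbrs[OF G(1)] tree_graph_card[OF T] by (simp flip: of_nat_sum)
  have eq: "int (walk_count G 2) - (4 * int (card (verts G)) - 6) = (\<Sum>v\<in>verts G. (?d v - 1) * (?d v - 2))"
  proof -
    have "(\<Sum>v\<in>verts G. (?d v - 1) * (?d v - 2)) = (\<Sum>v\<in>verts G. (?d v)\<^sup>2 - 3 * ?d v + 2)"
      by (rule sum.cong) (auto simp: algebra_simps power2_eq_square)
    also have "\<dots> = (\<Sum>v\<in>verts G. (?d v)\<^sup>2) - 3 * (\<Sum>v\<in>verts G. ?d v) + 2 * int (card (verts G))"
      by (simp add: sum.distrib sum_subtractf sum_distrib_left)
    also have "(\<Sum>v\<in>verts G. (?d v)\<^sup>2) = int (walk_count G 2)"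
      by (simp add: walk_count_2[OF G(1)])
    finally show ?thesis using s1 by simp
  qed
  have nn: "(?d v - 1) * (?d v - 2) \<ge> 0" for v
  proof -
    consider "?d v = 0" | "?d v = 1" | "?d v \<ge> 2" by linarith
    then show ?thesis by cases simp_all
  qed
  show "int (walk_count G 2) \<ge> 4 * int (card (verts G)) - 6"
    using eq sum_nonneg[of "verts G" "\<lambda>v. (?d v - 1) * (?d v - 2)"] nn by simp
  assume two: "card (verts G) \<ge> 2"
  \<comment> \<open>Degree 0 satisfies the bound 2 but contributes 2 to the sum; in a connected
    graph with two vertices it cannot occur.\<close>
  have pos: "card (nbrs G v) \<noteq> 0" if "v \<in> verts G" for v
    using connected_nbrs_nonempty[OF G(2) that two] finite_nbrs[OF G(1)] by simp
  have "int (walk_count G 2) = 4 * int (card (verts G)) - 6 \<longleftrightarrow> (\<Sum>v\<in>verts G. (?d v - 1) * (?d v - 2)) = 0"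
    using eq by linarith
  also have "\<dots> \<longleftrightarrow> (\<forall>v\<in>verts G. (?d v - 1) * (?d v - 2) = 0)"
    by (rule sum_nonneg_eq_0_iff) (use finite_verts[OF G(1)] nn in auto)
  also have "\<dots> \<longleftrightarrow> (\<forall>v\<in>verts G. card (nbrs G v) \<le> 2)"
  proof (rule ball_cong[OF refl])
    fix v assume "v \<in> verts G"
    then show "(?d v - 1) * (?d v - 2) = 0 \<longleftrightarrow> card (nbrs G v) \<le> 2"
      using pos[of v] by auto
  qed
  also have "\<dots> \<longleftrightarrow> is_path_graph G"
    using tree_max_degree_2_path[OF T] path_graph_card_nbrs[of G] by (intro iffI ballI) simp_all
  finally show "int (walk_count G 2) = 4 * int (card (verts G)) - 6 \<longleftrightarrow> is_path_graph G" .
qed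

lemma unicyclic_walk_count_2:
  assumes U: "unicyclic_graph G" and eq: "card (verts G) = card (edges G)"
  shows "walk_count G 2 \<ge> 4 * card (verts G)"
    and "walk_count G 2 = 4 * card (verts G) \<longleftrightarrow> is_cycle_graph (card (verts G)) G"
proof -
  have G: "simple_graph G" using U unfolding unicyclic_graph_def by auto
  let ?d = "\<lambda>v. int (card (nbrs G v))"
  have s1: "(\<Sum>v\<in>verts G. ?d v) = 2 * int (card (verts G))"
    using sum_card_nbrs[OF G] eq by (simp flip: of_nat_sum)
  have e: "int (walk_count G 2) - 4 * int (card (verts G)) = (\<Sum>v\<in>verts G. (?d v - 2)\<^sup>2)"
  proof -
    have "(\<Sum>v\<in>verts G. (?d v - 2)\<^sup>2) = (\<Sum>v\<in>verts G. (?d v)\<^sup>2 - 4 * ?d v + 4)"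
      by (rule sum.cong) (auto simp: algebra_simps power2_eq_square)
    also have "\<dots> = (\<Sum>v\<in>verts G. (?d v)\<^sup>2) - 4 * (\<Sum>v\<in>verts G. ?d v) + 4 * int (card (verts G))"
      by (simp add: sum.distrib sum_subtractf sum_distrib_left)
    also have "(\<Sum>v\<in>verts G. (?d v)\<^sup>2) = int (walk_count G 2)"
      by (simp add: walk_count_2[OF G])
    finally show ?thesis using s1 by simp
  qed
  have "(\<Sum>v\<in>verts G. (?d v - 2)\<^sup>2) \<ge> 0" by (rule sum_nonneg) simp
  then show "walk_count G 2 \<ge> 4 * card (verts G)" using e by linarith
  have "walk_count G 2 = 4 * card (verts G) \<longleftrightarrow> (\<Sum>v\<in>verts G. (?d v - 2)\<^sup>2) = 0"
    using e by linarith
  also have "\<dots> \<longleftrightarrow> (\<forall>v\<in>verts G. (?d v - 2)\<^sup>2 = 0)"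
    by (rule sum_nonneg_eq_0_iff) (use finite_verts[OF G] in auto)
  also have "\<dots> \<longleftrightarrow> (\<forall>v\<in>verts G. 2 - ?d v = 0)" by auto
  also have "\<dots> \<longleftrightarrow> (\<forall>v\<in>verts G. card (nbrs G v) \<le> 2)"
  proof
    assume le: "\<forall>v\<in>verts G. card (nbrs G v) \<le> 2"
    \<comment> \<open>The average degree is exactly 2, so degrees that never exceed 2 all equal
      2.\<close>
    have "(\<Sum>v\<in>verts G. 2 - ?d v) = 0" using s1 by (simp add: sum_subtractf)
    then show "\<forall>v\<in>verts G. 2 - ?d v = 0"
      by (subst (asm) sum_nonneg_eq_0_iff) (use finite_verts[OF G] le in auto)
  qed auto
  also have "\<dots> \<longleftrightarrow> is_cycle_graph (card (verts G)) G"
    using unicyclic_regular_cycle[OF U eq] cycle_graph_card_nbrs[of "card (verts G)" G] by (intro iffI ballI) simp_all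
  finally show "walk_count G 2 = 4 * card (verts G) \<longleftrightarrow> is_cycle_graph (card (verts G)) G" .
qed

section \<open>The resolvent of the adjacency matrix\<close>

no_notation fps_nth (infixl "$" 75)

lemma vertex_list:
  assumes "simple_graph G"
  shows "distinct (vertex_list G)" "set (vertex_list G) = verts G" "length (vertex_list G) = card (verts G)"
proof -
  have "\<exists>vs. distinct vs \<and> set vs = verts G"
    using finite_distinct_list[OF finite_verts[OF assms]] by blast
  then have "distinct (vertex_list G) \<and> set (vertex_list G) = verts G"
    unfolding vertex_list_def by (rule someI_ex)
  then show "distinct (vertex_list G)" "set (vertex_list G) = verts G" "length (vertex_list G) = card (verts G)"
    by (auto simp: distinct_card[symmetric])
qed

text \<open>The enumeration is a parameter here, so that the vertex lists of two parts can be
  concatenated to obtain a block diagonal matrix.\<close>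

definition adj_mat_of :: "'v ugraph \<Rightarrow> 'v list \<Rightarrow> 'r :: {zero, one} mat" where
  "adj_mat_of G vs = mat (length vs) (length vs) (\<lambda>(i, j). if {vs ! i, vs ! j} \<in> edges G then 1 else 0)"

lemma adj_mat_conv: "simple_graph G \<Longrightarrow> adj_mat G = adj_mat_of G (vertex_list G)"
  by (simp add: adj_mat_def adj_mat_of_def vertex_list)

lemma adj_mat_carrier [simp]: "adj_mat G \<in> carrier_mat (card (verts G)) (card (verts G))"
  by (simp add: adj_mat_def)

lemma sum_verts_conv:
  assumes "distinct vs" "set vs = verts G"
  shows "(\<Sum>v\<in>verts G. x v) = (\<Sum>i\<in>{0..<length vs}. x (vs ! i))"
  using sum.reindex_bij_betw[OF bij_betw_nth[OF assms(1) refl refl], of x] assms(2)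
  by (simp add: atLeast0LessThan)

lemma sum_row_adj:
  fixes x :: "'v \<Rightarrow> 'a :: comm_monoid_add"
  assumes G: "simple_graph G" and vs: "distinct vs" "set vs = verts G"
  shows "(\<Sum>j\<in>{0..<length vs}. if {v, vs ! j} \<in> edges G then x (vs ! j) else 0) = (\<Sum>u\<in>nbrs G v. x u)"
proof -
  have "(\<Sum>j\<in>{0..<length vs}. if {v, vs ! j} \<in> edges G then x (vs ! j) else 0)
      = (\<Sum>u\<in>verts G. if {v, u} \<in> edges G then x u else 0)"
    by (rule sum_verts_conv[OF vs, symmetric])
  also have "\<dots> = (\<Sum>u | u \<in> verts G \<and> {v, u} \<in> edges G. x u)"
    by (simp add: sum.inter_filter finite_verts[OF G])
  also have "{u. u \<in> verts G \<and> {v, u} \<in> edges G} = nbrs G v"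
    using simple_graph_edgeD(2)[OF G] by (auto simp: nbrs_def insert_commute)
  finally show ?thesis .
qed

lemma adj_mat_mult_vec:
  fixes w :: "'a :: comm_ring_1 vec"
  assumes G: "simple_graph G" and vs: "distinct vs" "set vs = verts G"
    and w: "w \<in> carrier_vec (length vs)" "\<And>i. i < length vs \<Longrightarrow> w $ i = x (vs ! i)" and i: "i < length vs"
  shows "(adj_mat_of G vs *\<^sub>v w) $ i = (\<Sum>u\<in>nbrs G (vs ! i). x u)"
proof -
  have "(adj_mat_of G vs *\<^sub>v w) $ i = (\<Sum>j\<in>{0..<length vs}. if {vs ! i, vs ! j} \<in> edges G then x (vs ! j) else 0)"
    using w i by (auto simp: adj_mat_of_def scalar_prod_def intro!: sum.cong)
  then show ?thesis using sum_row_adj[OF G vs] by simp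
qed

lemma char_poly_matrix_mult_vec:
  fixes w :: "'a :: comm_ring_1 poly vec"
  assumes G: "simple_graph G" and vs: "distinct vs" "set vs = verts G"
    and w: "w \<in> carrier_vec (length vs)" "\<And>i. i < length vs \<Longrightarrow> w $ i = z (vs ! i)" and i: "i < length vs"
  shows "(char_poly_matrix (adj_mat_of G vs) *\<^sub>v w) $ i = [:0, 1:] * z (vs ! i) - (\<Sum>u\<in>nbrs G (vs ! i). z u)"
proof -
  have "(char_poly_matrix (adj_mat_of G vs) *\<^sub>v w) $ i
      = (\<Sum>j\<in>{0..<length vs}. (if i = j then [:0, 1:] * z (vs ! j) else 0)
          - (if {vs ! i, vs ! j} \<in> edges G then z (vs ! j) else 0))"
    using w i by (auto simp: adj_mat_of_def char_poly_matrix_def scalar_prod_def algebra_simps intro!: sum.cong)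
  then show ?thesis using sum_row_adj[OF G vs] i by (simp add: sum_subtractf)
qed

text \<open>Cramer's rule: \<open>z\<close> is the adjugate of \<open>xI - A\<close> applied to the all-one vector.\<close>

definition resolvent_numerators :: "'v ugraph \<Rightarrow> ('v \<Rightarrow> 'a :: comm_ring_1 poly) \<Rightarrow> bool" where
  "resolvent_numerators G z \<longleftrightarrow> (\<forall>v\<in>verts G. [:0, 1:] * z v - (\<Sum>u\<in>nbrs G v. z u) = graph_poly G)"

lemma resolvent_numerators_exist:
  assumes G: "simple_graph G"
  obtains z :: "'v \<Rightarrow> 'a :: comm_ring_1 poly" where "resolvent_numerators (G :: 'v ugraph) z"
proof -
  let ?vs = "vertex_list G" and ?n = "card (verts G)"
  note vl = vertex_list[OF G]
  define M :: "'a poly mat" where "M = char_poly_matrix (adj_mat G)"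
  define w where "w = Determinant.adj_mat M *\<^sub>v ones ?n"
  \<comment> \<open>Inverting the enumeration turns the entries of the matrix vector into a function
    on vertices.\<close>
  define z where "z v = w $ (the_inv_into {..<?n} (nth ?vs) v)" for v
  have M: "M \<in> carrier_mat ?n ?n" unfolding M_def by simp
  note A = Determinant.adj_mat[OF M]
  have w: "w \<in> carrier_vec ?n" using A(1) unfolding w_def by (auto simp: ones_def)
  have inj: "inj_on (nth ?vs) {..<?n}" using bij_betw_nth[OF vl(1) refl refl] vl(3) by (simp add: bij_betw_def)
  have wz: "w $ i = z (?vs ! i)" if "i < ?n" for i
    using the_inv_into_f_f[OF inj, of i] that unfolding z_def by simp
  have o: "ones ?n \<in> carrier_vec ?n" by (simp add: ones_def)
  have "M *\<^sub>v w = (M * Determinant.adj_mat M) *\<^sub>v ones ?n"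
    unfolding w_def by (rule assoc_mult_mat_vec[OF M A(1) o, symmetric])
  also have "\<dots> = det M \<cdot>\<^sub>v ones ?n" unfolding A(2)
    by (rule eq_vecI) (auto simp: o ones_def scalar_prod_def smult_vec_def sum_distrib_left[symmetric])
  finally have Mw: "M *\<^sub>v w = det M \<cdot>\<^sub>v ones ?n" .
  have "resolvent_numerators G z"
    unfolding resolvent_numerators_def
  proof
    fix v assume "v \<in> verts G"
    then obtain i where i: "i < ?n" "v = ?vs ! i" using vl by (metis in_set_conv_nth)
    have "[:0, 1:] * z v - (\<Sum>u\<in>nbrs G v. z u) = (M *\<^sub>v w) $ i"
      unfolding M_def adj_mat_conv[OF G] i(2)
      by (rule char_poly_matrix_mult_vec[OF G vl(1,2), symmetric]) (use w wz i vl(3) in auto)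
    also have "\<dots> = graph_poly G" unfolding Mw using i by (simp add: ones_def M_def char_poly_def)
    finally show "[:0, 1:] * z v - (\<Sum>u\<in>nbrs G v. z u) = graph_poly G" .
  qed
  then show ?thesis by (rule that)
qed

section \<open>The coronal and the polynomial of the complement\<close>

lemma graph_poly_monic:
  "lead_coeff (graph_poly G :: 'a :: comm_ring_1 poly) = 1" "degree (graph_poly G :: 'a poly) = card (verts G)"
  using degree_monic_char_poly[OF adj_mat_carrier[of G], where 'a = 'a] by auto

lemma graph_poly_nonzero: "(graph_poly G :: 'a :: comm_ring_1 poly) \<noteq> 0"
  using graph_poly_monic(1)[of G, where 'a = 'a] by fastforce

text \<open>The fractions \<open>z v / graph_poly G\<close> solve (xI - A)y = 1 over the fraction
  field. The matrix is invertible there, so they are the entries of its inverse applied to the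
  all-one vector.\<close>

lemma coronal_eq:
  assumes G: "simple_graph G" and z: "resolvent_numerators G z"
  shows "coronal G = Fract (\<Sum>v\<in>verts G. z v) (graph_poly G)"
proof -
  let ?vs = "vertex_list G" and ?n = "card (verts G)"
  note vl = vertex_list[OF G]
  define P :: "rat poly mat" where "P = char_poly_matrix (adj_mat G)"
  define M where "M = map_mat to_fract P"
  have P: "P \<in> carrier_mat ?n ?n" unfolding P_def by simp
  have M: "M \<in> carrier_mat ?n ?n" using P unfolding M_def by simp
  interpret tf: comm_ring_hom "to_fract :: rat poly \<Rightarrow> rat poly fract"
    by unfold_locales auto
  have phi: "det P = graph_poly G" unfolding P_def char_poly_def ..
  have dM: "det M = to_fract (graph_poly G)" unfolding M_def tf.hom_det phi ..
  have phi0: "to_fract (graph_poly G :: rat poly) \<noteq> 0" using graph_poly_nonzero[of G] by simp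
  \<comment> \<open>A nonzero determinant ensures that \<open>mat_inverse\<close> returns
    \<open>Some\<close>, so that \<open>the\<close> in the definition of \<open>coronal\<close>
    yields the true inverse.\<close>
  have "M \<in> Units (ring_mat TYPE(rat poly fract) ?n ())"
    by (rule det_non_zero_imp_unit[OF M]) (use dM phi0 in simp)
  then obtain B where B: "mat_inverse M = Some B" using mat_inverse(1)[OF M] by fastforce
  note B' = mat_inverse(2)[OF M B]
  define w where "w = vec ?n (\<lambda>i. z (?vs ! i))"
  define y where "y = vec ?n (\<lambda>i. Fract (z (?vs ! i)) (graph_poly G))"
  have w: "w \<in> carrier_vec ?n" and y: "y \<in> carrier_vec ?n" unfolding w_def y_def by auto
  have o: "ones ?n \<in> carrier_vec ?n" by (simp add: ones_def)
  have Pw: "(P *\<^sub>v w) $ i = graph_poly G" if i: "i < ?n" for i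
  proof -
    have "?vs ! i \<in> verts G" using vl i by (metis nth_mem)
    moreover have "(P *\<^sub>v w) $ i = [:0, 1:] * z (?vs ! i) - (\<Sum>u\<in>nbrs G (?vs ! i). z u)"
      unfolding P_def adj_mat_conv[OF G]
      by (rule char_poly_matrix_mult_vec[OF G vl(1,2)]) (use i vl(3) in \<open>auto simp: w_def\<close>)
    ultimately show ?thesis using z unfolding resolvent_numerators_def by simp
  qed
  have My: "M *\<^sub>v y = ones ?n"
  proof (rule eq_vecI)
    fix i assume "i < dim_vec (ones ?n :: rat poly fract vec)"
    then have i: "i < ?n" by (simp add: ones_def)
    have "(M *\<^sub>v y) $ i = to_fract ((P *\<^sub>v w) $ i) / to_fract (graph_poly G)"
      using i P by (simp add: M_def y_def w_def scalar_prod_def Fract_conv_to_fract sum_divide_distrib)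
    then show "(M *\<^sub>v y) $ i = ones ?n $ i" using i phi0 by (simp add: Pw ones_def)
  qed (use M in \<open>simp add: ones_def\<close>)
  have "B *\<^sub>v ones ?n = y"
  proof -
    have "B *\<^sub>v ones ?n = (B * M) *\<^sub>v y"
      unfolding My[symmetric] using assoc_mult_mat_vec[of B ?n ?n M ?n y] B' M y by simp
    then show ?thesis using B' y by simp
  qed
  then have "coronal G = scalar_prod (ones ?n) y"
    unfolding coronal_def Let_def P_def[symmetric] M_def[symmetric] B by simp
  also have "\<dots> = (\<Sum>i\<in>{0..<?n}. to_fract (z (?vs ! i))) / to_fract (graph_poly G)"
    by (simp add: scalar_prod_def y_def ones_def Fract_conv_to_fract sum_divide_distrib)
  also have "(\<Sum>i\<in>{0..<?n}. to_fract (z (?vs ! i))) = to_fract (\<Sum>v\<in>verts G. z v)"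
    unfolding sum_verts_conv[OF vl(1,2)] vl(3) by simp
  finally show ?thesis by (simp add: Fract_conv_to_fract)
qed

text \<open>The two factorizations of the bordered matrix \<open>[[M, -\<one>], [\<one>\<^sup>T, 1]]\<close> give
  \<open>det (M + J) det M = det M (det M + \<one>\<^sup>T z)\<close> for \<open>M z = det M \<one>\<close>.\<close>

lemma det_add_ones:
  fixes M :: "'a :: idom mat"
  assumes M: "M \<in> carrier_mat n n" and z: "z \<in> carrier_vec n"
    and Mz: "\<And>i. i < n \<Longrightarrow> (M *\<^sub>v z) $ i = d" and d: "det M = d" "d \<noteq> 0"
  shows "det (mat n n (\<lambda>(i, j). M $$ (i, j) + 1)) = d + (\<Sum>i\<in>{0..<n}. z $ i)"
proof -
  define J where "J = mat n n (\<lambda>(i, j). M $$ (i, j) + 1)"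
  define s where "s = (\<Sum>i\<in>{0..<n}. z $ i)"
  define u where "u = mat n 1 (\<lambda>_. - 1 :: 'a)"
  define r where "r = mat 1 n (\<lambda>_. 1 :: 'a)"
  define B where "B = four_block_mat M u r (1\<^sub>m 1)"
  define Z where "Z = mat n 1 (\<lambda>(i, _). z $ i)"
  define D where "D = mat 1 1 (\<lambda>_. d)"
  note [simp] = carrier_matD[OF M] carrier_vecD[OF z]
  have c: "u \<in> carrier_mat n 1" "r \<in> carrier_mat 1 n" "Z \<in> carrier_mat n 1" "D \<in> carrier_mat 1 1"
    "J \<in> carrier_mat n n"
    unfolding u_def r_def Z_def D_def J_def by auto
  have cB: "B \<in> carrier_mat (n + 1) (n + 1)"
    unfolding B_def by (rule four_block_carrier_mat[OF M one_carrier_mat])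
  \<comment> \<open>Right multiplication by \<open>L1\<close> clears the lower left block and adds J
    to M. Right multiplication by \<open>L2\<close> clears the upper right column, because M z is
    the constant vector d, and leaves \<open>s + d\<close> in the corner.\<close>
  define L1 where "L1 = four_block_mat (1\<^sub>m n) (0\<^sub>m n 1) (- r) (1\<^sub>m 1)"
  define L2 where "L2 = four_block_mat (1\<^sub>m n) Z (0\<^sub>m 1 n) D"
  have L: "L1 \<in> carrier_mat (n + 1) (n + 1)" "L2 \<in> carrier_mat (n + 1) (n + 1)"
    unfolding L1_def L2_def by (rule four_block_carrier_mat[OF one_carrier_mat] one_carrier_mat c)+
  have "B * L1 = four_block_mat (M * 1\<^sub>m n + u * (- r)) (M * 0\<^sub>m n 1 + u * 1\<^sub>m 1)
      (r * 1\<^sub>m n + 1\<^sub>m 1 * (- r)) (r * 0\<^sub>m n 1 + 1\<^sub>m 1 * 1\<^sub>m 1)"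
    unfolding B_def L1_def by (rule mult_four_block_mat) (use c in auto)
  also have "M * 1\<^sub>m n + u * (- r) = J" unfolding right_mult_one_mat[OF M]
    by (rule eq_matI) (use c M in \<open>auto simp: J_def u_def r_def scalar_prod_def\<close>)
  also have "M * 0\<^sub>m n 1 + u * 1\<^sub>m 1 = u"
    unfolding right_mult_zero_mat[OF M] right_mult_one_mat[OF c(1)] by (rule left_add_zero_mat[OF c(1)])
  also have "r * 1\<^sub>m n + 1\<^sub>m 1 * (- r) = 0\<^sub>m 1 n" unfolding right_mult_one_mat[OF c(2)]
    by (rule eq_matI) (use c in \<open>auto simp: r_def scalar_prod_def\<close>)
  also have "r * 0\<^sub>m n 1 + 1\<^sub>m 1 * 1\<^sub>m 1 = 1\<^sub>m 1" unfolding right_mult_zero_mat[OF c(2)] by simp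
  finally have "det (B * L1) = det J"
    using det_four_block_mat_lower_left_zero[OF c(5,1) refl, of "1\<^sub>m 1"] by simp
  moreover have "det (B * L1) = det B * det L1" by (rule det_mult[OF cB L(1)])
  moreover have "det L1 = 1"
    unfolding L1_def using c by (subst det_four_block_mat_upper_right_zero[of _ n _ 1]) auto
  ultimately have BJ: "det B = det J" by simp
  have "B * L2 = four_block_mat (M * 1\<^sub>m n + u * 0\<^sub>m 1 n) (M * Z + u * D)
      (r * 1\<^sub>m n + 1\<^sub>m 1 * 0\<^sub>m 1 n) (r * Z + 1\<^sub>m 1 * D)"
    unfolding B_def L2_def by (rule mult_four_block_mat) (use c in auto)
  also have "M * 1\<^sub>m n + u * 0\<^sub>m 1 n = M"
    unfolding right_mult_zero_mat[OF c(1)] right_mult_one_mat[OF M] by (rule right_add_zero_mat[OF M])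
  also have "M * Z + u * D = 0\<^sub>m n 1"
  proof (rule eq_matI)
    fix i j assume "i < dim_row (0\<^sub>m n 1)" "j < dim_col (0\<^sub>m n 1)"
    then have ij: "i < n" "j = 0" by auto
    have "(M * Z) $$ (i, 0) = (M *\<^sub>v z) $ i"
      using ij M z by (simp add: Z_def scalar_prod_def)
    then show "(M * Z + u * D) $$ (i, j) = 0\<^sub>m n 1 $$ (i, j)"
      using ij c M Mz by (simp add: u_def D_def scalar_prod_def)
  qed (use c M in auto)
  also have "r * 1\<^sub>m n + 1\<^sub>m 1 * 0\<^sub>m 1 n = r"
    unfolding right_mult_one_mat[OF c(2)] right_mult_zero_mat[OF one_carrier_mat] by (rule right_add_zero_mat[OF c(2)])
  also have "r * Z + 1\<^sub>m 1 * D = mat 1 1 (\<lambda>_. s + d)"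
    by (rule eq_matI) (use c z in \<open>auto simp: r_def Z_def D_def s_def scalar_prod_def\<close>)
  finally have "det (B * L2) = d * (s + d)"
    using det_four_block_mat_upper_right_zero[OF M refl c(2), of "mat 1 1 (\<lambda>_. s + d)"] d(1)
    by (simp add: det_single)
  moreover have "det (B * L2) = det B * det L2" by (rule det_mult[OF cB L(2)])
  moreover have "det L2 = d"
    unfolding L2_def using c by (subst det_four_block_mat_lower_left_zero[of _ n _ 1]) (auto simp: D_def det_single)
  ultimately have "d * (d + s) = d * det J" using BJ by (metis add.commute mult.commute)
  then have "d + s = det J" using d(2) by simp
  then show ?thesis unfolding J_def s_def by simp
qed

lemma simple_complement: "simple_graph G \<Longrightarrow> simple_graph (complement_graph G)"
  by (auto simp: simple_graph_def complement_graph_def)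

text \<open>The complement has adjacency matrix J - I - A, and putting -1 - x for x in its
  characteristic matrix gives -(xI - A + J). By \<open>det_add_ones\<close> the determinant exposes
  the numerator of the coronal.\<close>

lemma complement_graph_poly:
  fixes z :: "'v \<Rightarrow> 'a :: idom poly"
  assumes G: "simple_graph G" and z: "resolvent_numerators G z"
  shows "pcompose (graph_poly (complement_graph G)) [:- 1, - 1:]
    = (- 1) ^ card (verts G) * (graph_poly G + (\<Sum>v\<in>verts G. z v))"
proof -
  let ?vs = "vertex_list G" and ?n = "card (verts G)"
  note vl = vertex_list[OF G]
  define M :: "'a poly mat" where "M = char_poly_matrix (adj_mat G)"
  define J where "J = mat ?n ?n (\<lambda>(i, j). M $$ (i, j) + 1)"
  define w where "w = vec ?n (\<lambda>i. z (?vs ! i))"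
  have M: "M \<in> carrier_mat ?n ?n" unfolding M_def by simp
  have w: "w \<in> carrier_vec ?n" unfolding w_def by auto
  have Mw: "(M *\<^sub>v w) $ i = graph_poly G" if i: "i < ?n" for i
  proof -
    have "?vs ! i \<in> verts G" using vl i by (metis nth_mem)
    moreover have "(M *\<^sub>v w) $ i = [:0, 1:] * z (?vs ! i) - (\<Sum>u\<in>nbrs G (?vs ! i). z u)"
      unfolding M_def adj_mat_conv[OF G]
      by (rule char_poly_matrix_mult_vec[OF G vl(1,2)]) (use i vl(3) in \<open>auto simp: w_def\<close>)
    ultimately show ?thesis using z unfolding resolvent_numerators_def by simp
  qed
  have "det J = graph_poly G + (\<Sum>i\<in>{0..<?n}. w $ i)"
    unfolding J_def
    by (rule det_add_ones[OF M w Mw]) (use graph_poly_nonzero[of G] in \<open>auto simp: M_def char_poly_def\<close>)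
  also have "(\<Sum>i\<in>{0..<?n}. w $ i) = (\<Sum>v\<in>verts G. z v)"
    unfolding sum_verts_conv[OF vl(1,2)] vl(3) by (simp add: w_def)
  finally have dJ: "det J = graph_poly G + (\<Sum>v\<in>verts G. z v)" .
  define C :: "'a poly mat" where "C = char_poly_matrix (adj_mat (complement_graph G))"
  have vc: "verts (complement_graph G) = verts G" by (simp add: complement_graph_def)
  have vlc: "vertex_list (complement_graph G) = ?vs" by (simp add: vertex_list_def vc)
  have "map_mat (\<lambda>q. pcompose q [:- 1, - 1:]) C = (- 1) \<cdot>\<^sub>m J"
  proof (rule eq_matI)
    fix i j assume "i < dim_row ((- 1) \<cdot>\<^sub>m J)" "j < dim_col ((- 1) \<cdot>\<^sub>m J)"
    then have ij: "i < ?n" "j < ?n" by (auto simp: J_def)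
    have mem: "?vs ! i \<in> verts G" "?vs ! j \<in> verts G" using vl ij by (metis nth_mem)+
    have eq: "?vs ! i = ?vs ! j \<longleftrightarrow> i = j" using vl ij by (simp add: nth_eq_iff_index_eq)
    have Gii: "{?vs ! i} \<notin> edges G" using G by (auto simp: simple_graph_def)
    have comp: "{?vs ! i, ?vs ! j} \<in> edges (complement_graph G) \<longleftrightarrow> i \<noteq> j \<and> {?vs ! i, ?vs ! j} \<notin> edges G"
      using mem eq by (cases "i = j") (auto simp: complement_graph_def)
    show "map_mat (\<lambda>q. pcompose q [:- 1, - 1:]) C $$ (i, j) = ((- 1) \<cdot>\<^sub>m J) $$ (i, j)"
      using ij comp Gii
      by (cases "i = j")
         (auto simp: C_def J_def M_def char_poly_matrix_def adj_mat_def vc vlc pcompose_pCons one_pCons)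
  qed (auto simp: C_def J_def char_poly_matrix_def adj_mat_def vc)
  moreover have "det (map_mat (\<lambda>q. pcompose q [:- 1, - 1:]) C) = pcompose (det C) [:- 1, - 1:]"
    by (rule comm_ring_hom.hom_det[OF pcompose_hom.comm_ring_hom_axioms])
  ultimately have "pcompose (det C) [:- 1, - 1:] = det ((- 1) \<cdot>\<^sub>m J)" by simp
  also have "\<dots> = (- 1) ^ ?n * det J" by (simp add: J_def)
  finally show ?thesis unfolding dJ C_def char_poly_def .
qed

text \<open>The entries 0 and 1 are preserved by field embeddings, so divisibility over the
  rationals and roots over larger fields concern one and the same polynomial.\<close>

lemma graph_poly_of_rat: "(graph_poly G :: 'a :: field_char_0 poly) = map_poly of_rat (graph_poly G)"
proof -
  have "(adj_mat G :: 'a mat) = map_mat of_rat (adj_mat G)"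
    by (rule eq_matI) (auto simp: adj_mat_def)
  then show ?thesis using of_rat_hom.char_poly_hom[OF adj_mat_carrier, of G] by simp
qed

lemma graph_poly_of_real: "(graph_poly G :: complex poly) = map_poly of_real (graph_poly G)"
proof -
  have "(adj_mat G :: complex mat) = map_mat of_real (adj_mat G)"
    by (rule eq_matI) (auto simp: adj_mat_def)
  then show ?thesis using of_real_hom.char_poly_hom[OF adj_mat_carrier, of G] by simp
qed

section \<open>Expansion at infinity\<close>

lemma poly_at_infinity_0 [simp]: "poly_at_infinity 0 = 0"
  by (simp add: poly_at_infinity_def)

lemma poly_at_infinity_pCons:
  "poly_at_infinity (pCons a p) = fls_const a + fls_X_inv * poly_at_infinity p"
  by (cases "pCons a p = 0") (auto simp: poly_at_infinity_def map_poly_pCons)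

lemma poly_at_infinity_nth:
  "fls_nth (poly_at_infinity p) n = (if n \<le> 0 then coeff p (nat (- n)) else 0)"
proof (induction p arbitrary: n)
  case (pCons a p)
  have "nat (- n) = Suc (nat (- (n + 1)))" if "n < 0" using that by linarith
  then show ?case using pCons.IH[of "n + 1"]
    by (cases n "0 :: int" rule: linorder_cases)
       (simp_all add: poly_at_infinity_pCons fls_X_inv_times_conv_shift)
qed simp

lemma poly_at_infinity_inj: "poly_at_infinity p = poly_at_infinity q \<longleftrightarrow> p = q"
proof
  assume eq: "poly_at_infinity p = poly_at_infinity q"
  show "p = q"
  proof (rule poly_eqI)
    fix i
    show "coeff p i = coeff q i"
      using arg_cong[OF eq, of "\<lambda>f. fls_nth f (- int i)"] by (simp add: poly_at_infinity_nth)
  qed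
qed simp

lemma poly_at_infinity_eq_0_iff: "poly_at_infinity p = 0 \<longleftrightarrow> p = 0"
  using poly_at_infinity_inj[of p 0] by simp

lemma poly_at_infinity_add: "poly_at_infinity (p + q) = poly_at_infinity p + poly_at_infinity q"
  by (rule fls_eqI) (simp add: poly_at_infinity_nth)

lemma poly_at_infinity_diff: "poly_at_infinity (p - q) = poly_at_infinity p - poly_at_infinity q"
  by (rule fls_eqI) (simp add: poly_at_infinity_nth)

lemma poly_at_infinity_sum: "poly_at_infinity (\<Sum>i\<in>S. f i) = (\<Sum>i\<in>S. poly_at_infinity (f i))"
  by (induction S rule: infinite_finite_induct) (simp_all add: poly_at_infinity_add)

lemma poly_at_infinity_smult: "poly_at_infinity (Polynomial.smult a p) = fls_const a * poly_at_infinity p"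
  by (rule fls_eqI) (simp add: poly_at_infinity_nth)

lemma poly_at_infinity_mult: "poly_at_infinity (p * q) = poly_at_infinity p * poly_at_infinity q"
proof (induction p)
  case (pCons a p)
  then show ?case
    by (simp add: poly_at_infinity_pCons poly_at_infinity_add poly_at_infinity_smult algebra_simps)
qed simp

text \<open>Multiplication by x lowers the index by one, so the coefficient of x^i in
  \<open>h\<close> picks the entry of \<open>F\<close> at \<open>n + i\<close>. For walk series
  these sums are values of h(A)1.\<close>

lemma poly_at_infinity_mult_nth:
  assumes "degree h \<le> N"
  shows "fls_nth (poly_at_infinity h * F) n = (\<Sum>i\<le>N. coeff h i * fls_nth F (n + int i))"
  using assms
proof (induction h arbitrary: n N)
  case (pCons a h)
  have eq: "fls_nth (poly_at_infinity (pCons a h) * F) n = a * fls_nth F n + fls_nth (poly_at_infinity h * F) (n + 1)"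
    unfolding poly_at_infinity_pCons distrib_right mult.assoc by (simp add: fls_X_inv_times_conv_shift)
  show ?case
  proof (cases N)
    case 0
    then have "h = 0" using pCons.prems by (simp split: if_splits)
    then show ?thesis using eq 0 by simp
  next
    case (Suc M)
    then have "degree h \<le> M" using pCons.prems by (cases "h = 0") simp_all
    from pCons.IH[OF this, of "n + 1"] show ?thesis
      unfolding eq Suc by (subst sum.atMost_Suc_shift) (simp add: add.assoc)
  qed
qed simp

section \<open>Generating series of walks\<close>

text \<open>The \<open>v\<close>-component of the resolvent applied to the all-one vector, expanded
  in 1/x. The index is the length plus one, and the entry at index 0 is 0.\<close>

definition walk_series :: "'v ugraph \<Rightarrow> 'v \<Rightarrow> rat fls" where
  "walk_series G v = fps_to_fls (Abs_fps (\<lambda>k. if k = 0 then 0 else of_nat (walks G (k - 1) v)))"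

definition total_walk_series :: "'v ugraph \<Rightarrow> rat fls" where
  "total_walk_series G = (\<Sum>v\<in>verts G. walk_series G v)"

lemma walk_series_nth:
  "fls_nth (walk_series G v) n = (if n \<le> 0 then 0 else of_nat (walks G (nat (n - 1)) v))"
  by (auto simp: walk_series_def nat_diff_distrib)

lemma fls_nth_sum: "fls_nth (\<Sum>i\<in>S. f i) n = (\<Sum>i\<in>S. fls_nth (f i) n)"
  by (induction S rule: infinite_finite_induct) simp_all

lemma total_walk_series_nth:
  "fls_nth (total_walk_series G) n = (if n \<le> 0 then 0 else of_nat (walk_count G (nat (n - 1))))"
  by (simp add: total_walk_series_def fls_nth_sum walk_series_nth walk_count_def)

text \<open>This is (xI - A)W = 1 in components: a nonempty walk is a step to a neighbour followed
  by a shorter walk, and the walk of length 0 leaves the constant 1.\<close>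

lemma walk_series_step: "fls_X_inv * walk_series G v - (\<Sum>u\<in>nbrs G v. walk_series G u) = 1"
proof (rule fls_eqI)
  fix n
  have "nat n = Suc (nat (n - 1))" if "n > 0" using that by simp
  then have "walks G (nat n) v = (\<Sum>u\<in>nbrs G v. walks G (nat (n - 1)) u)" if "n > 0" using that by simp
  then show "fls_nth (fls_X_inv * walk_series G v - (\<Sum>u\<in>nbrs G v. walk_series G u)) n = fls_nth 1 n"
    by (cases n "0 :: int" rule: linorder_cases)
       (simp_all add: fls_X_inv_times_conv_shift walk_series_nth fls_nth_sum)
qed

text \<open>Injectivity of xI - A on Laurent series. Finitely many series vanish below a common
  index, and the equation passes their vanishing at one index on to the next.\<close>

lemma fls_harmonic_zero:
  fixes d :: "'v \<Rightarrow> 'a :: comm_ring_1 fls"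
  assumes G: "simple_graph G" and d: "\<And>v. v \<in> verts G \<Longrightarrow> fls_X_inv * d v = (\<Sum>u\<in>nbrs G v. d u)"
    and v: "v \<in> verts G"
  shows "d v = 0"
proof -
  define m where "m = Min ((\<lambda>v. fls_subdegree (d v)) ` verts G)"
  have below: "fls_nth (d v) n = 0" if "v \<in> verts G" "n < m" for v n
  proof -
    have "m \<le> fls_subdegree (d v)" unfolding m_def using that finite_verts[OF G] by (intro Min_le) auto
    then show ?thesis using that(2) by (intro fls_eq0_below_subdegree) simp
  qed
  have step: "fls_nth (d v) (n + 1) = (\<Sum>u\<in>nbrs G v. fls_nth (d u) n)" if "v \<in> verts G" for v n
    using arg_cong[OF d[OF that], of "\<lambda>f. fls_nth f n"] by (simp add: fls_X_inv_times_conv_shift fls_nth_sum)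
  \<comment> \<open>The offset -1 places the start of the induction at \<open>m - 1\<close>, where
    all series vanish by the choice of \<open>m\<close>.\<close>
  have "\<forall>v\<in>verts G. fls_nth (d v) (m + int k - 1) = 0" for k
  proof (induction k)
    case 0
    then show ?case using below by simp
  next
    case (Suc k)
    show ?case
    proof
      fix v assume v: "v \<in> verts G"
      have "fls_nth (d v) (m + int (Suc k) - 1) = (\<Sum>u\<in>nbrs G v. fls_nth (d u) (m + int k - 1))"
        using step[OF v, of "m + int k - 1"] by (simp add: algebra_simps)
      also have "\<dots> = 0" by (rule sum.neutral) (use Suc nbrs_subset[OF G] in blast)
      finally show "fls_nth (d v) (m + int (Suc k) - 1) = 0" .
    qed
  qed
  then have above: "fls_nth (d v) (m + int k - 1) = 0" for k using v by blast
  show ?thesis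
  proof (rule fls_eqI)
    fix n
    show "fls_nth (d v) n = fls_nth 0 n"
      using below[OF v, of n] above[of "nat (n - m + 1)"] by (cases "n < m") simp_all
  qed
qed

text \<open>Both sides solve (xI - A)y = phi 1, where phi is the characteristic polynomial; their
  difference is killed by \<open>fls_harmonic_zero\<close>.\<close>

lemma resolvent_numerators_series:
  assumes G: "simple_graph G" and z: "resolvent_numerators G z" and v: "v \<in> verts G"
  shows "poly_at_infinity (z v) = poly_at_infinity (graph_poly G) * walk_series G v"
proof -
  define d where "d v = poly_at_infinity (z v) - poly_at_infinity (graph_poly G) * walk_series G v" for v
  have "d v = 0"
  proof (rule fls_harmonic_zero[OF G _ v])
    fix v assume "v \<in> verts G"
    then have "[:0, 1:] * z v - (\<Sum>u\<in>nbrs G v. z u) = graph_poly G"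
      using z unfolding resolvent_numerators_def by blast
    then have "poly_at_infinity ([:0, 1:] * z v - (\<Sum>u\<in>nbrs G v. z u)) = poly_at_infinity (graph_poly G)" by simp
    then have 1: "fls_X_inv * poly_at_infinity (z v) - (\<Sum>u\<in>nbrs G v. poly_at_infinity (z u)) = poly_at_infinity (graph_poly G)"
      by (simp add: poly_at_infinity_diff poly_at_infinity_sum poly_at_infinity_mult poly_at_infinity_pCons)
    have 2: "poly_at_infinity (graph_poly G) * (fls_X_inv * walk_series G v - (\<Sum>u\<in>nbrs G v. walk_series G u)) = poly_at_infinity (graph_poly G)"
      unfolding walk_series_step by simp
    show "fls_X_inv * d v = (\<Sum>u\<in>nbrs G v. d u)"
      using 1 2 unfolding d_def sum_subtractf by (simp add: algebra_simps sum_distrib_left)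
  qed
  then show ?thesis by (simp add: d_def)
qed

lemma resolvent_total_series:
  assumes G: "simple_graph G" and z: "resolvent_numerators G z"
  shows "poly_at_infinity (\<Sum>v\<in>verts G. z v) = poly_at_infinity (graph_poly G) * total_walk_series G"
  unfolding poly_at_infinity_sum total_walk_series_def sum_distrib_left
  by (rule sum.cong) (auto intro: resolvent_numerators_series[OF G z])

lemma walk_eval_conv_series: "walk_eval G h v = fls_nth (poly_at_infinity h * walk_series G v) 1"
  by (simp add: poly_at_infinity_mult_nth[OF order_refl] walk_eval_def walk_series_nth)

text \<open>Cayley-Hamilton on the all-one vector: the product of the characteristic polynomial with
  a walk series is a polynomial, so it has no term in 1/x, and that term is the value in
  question.\<close>

lemma walk_annih_graph_poly:
  assumes G: "simple_graph G"
  shows "walk_annih G (graph_poly G :: rat poly)"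
proof -
  obtain z :: "'a \<Rightarrow> rat poly" where z: "resolvent_numerators G z" using resolvent_numerators_exist[OF G] .
  show ?thesis unfolding walk_annih_def walk_eval_conv_series
    using resolvent_numerators_series[OF G z, symmetric] by (simp add: poly_at_infinity_nth)
qed

text \<open>The two polynomials determine the sum of the numerators, hence the total walk series
  after division; the sign in \<open>complement_graph_poly\<close> agrees because the degrees
  do.\<close>

lemma walk_count_eq:
  assumes G: "simple_graph G" and H: "simple_graph H"
    and p: "graph_poly G = (graph_poly H :: rat poly)"
    and c: "graph_poly (complement_graph G) = (graph_poly (complement_graph H) :: rat poly)"
  shows "walk_count G k = walk_count H k"
proof -
  obtain z :: "'a \<Rightarrow> rat poly" where z: "resolvent_numerators G z" using resolvent_numerators_exist[OF G] .
  obtain y :: "'b \<Rightarrow> rat poly" where y: "resolvent_numerators H y" using resolvent_numerators_exist[OF H] .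
  have n: "card (verts G) = card (verts H)" using p graph_poly_monic(2)[where 'a = rat] by metis
  have "(\<Sum>v\<in>verts G. z v) = (\<Sum>v\<in>verts H. y v)"
    using complement_graph_poly[OF G z] complement_graph_poly[OF H y] c p n by simp
  then have "total_walk_series G = total_walk_series H"
    using resolvent_total_series[OF G z] resolvent_total_series[OF H y] p
    by (simp add: poly_at_infinity_eq_0_iff graph_poly_nonzero)
  then show ?thesis
    using total_walk_series_nth[of G "int k + 1"] total_walk_series_nth[of H "int k + 1"] by simp
qed

lemma poly_at_infinity_monom: "poly_at_infinity (monom 1 k) = fls_X_inv ^ k"
  by (induction k) (simp_all add: monom_0 monom_Suc poly_at_infinity_pCons)

text \<open>The multiple x^(n-1) h annihilates as well, and its coefficient at index 1 is the
  coefficient at index \<open>n\<close> for \<open>h\<close>.\<close>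

lemma walk_annih_series:
  assumes G: "simple_graph G" and h: "walk_annih G h" and v: "v \<in> verts G" and n: "n \<ge> 1"
  shows "fls_nth (poly_at_infinity h * walk_series G v) n = 0"
proof -
  have "walk_eval G (monom 1 (nat (n - 1)) * h) v = 0"
    using walk_annih_mult[OF G h] v unfolding walk_annih_def by blast
  then have "fls_nth (fls_X_inv ^ nat (n - 1) * (poly_at_infinity h * walk_series G v)) 1 = 0"
    unfolding walk_eval_conv_series poly_at_infinity_mult poly_at_infinity_monom mult.assoc .
  then show ?thesis using n by (simp add: fls_X_inv_power_times_conv_shift)
qed

text \<open>Annihilation removes all negative powers of x from the product, and the series starts at
  1/x, so only powers below \<open>degree h\<close> remain. Thus the walk series is a proper
  fraction with denominator \<open>h\<close>.\<close>

lemma walk_annih_quotient: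
  assumes G: "simple_graph G" and h: "walk_annih G h" and deg: "degree h > 0"
  obtains N where "degree N < degree h" "poly_at_infinity N = poly_at_infinity h * total_walk_series G"
proof -
  define F where "F = poly_at_infinity h * total_walk_series G"
  \<comment> \<open>The coefficient of x^j stands at index -j of the expansion.\<close>
  define N where "N = Poly (map (\<lambda>j. fls_nth F (- int j)) [0..<degree h])"
  have pos: "fls_nth F n = 0" if "n \<ge> 1" for n
    unfolding F_def total_walk_series_def sum_distrib_left fls_nth_sum
    using walk_annih_series[OF G h _ that] by simp
  have neg: "fls_nth F n = 0" if "n \<le> - int (degree h)" for n
    unfolding F_def poly_at_infinity_mult_nth[OF order_refl]
    by (rule sum.neutral) (use that in \<open>auto simp: total_walk_series_nth\<close>)
  have cN: "coeff N j = (if j < degree h then fls_nth F (- int j) else 0)" for j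
    unfolding N_def by (simp add: coeff_Poly_eq nth_default_def)
  have "degree N < degree h"
    by (rule degree_lessI) (use deg cN in auto)
  moreover have "poly_at_infinity N = F"
  proof (rule fls_eqI)
    fix n
    show "fls_nth (poly_at_infinity N) n = fls_nth F n"
      using pos[of n] neg[of n] by (auto simp: poly_at_infinity_nth cN)
  qed
  ultimately show ?thesis using that unfolding F_def by blast
qed

section \<open>The main polynomial\<close>

lemma vec_of_fun_exists:
  fixes w :: "'a vec"
  assumes G: "simple_graph (G :: 'v ugraph)" and w: "w \<in> carrier_vec (card (verts G))"
  obtains x where "\<And>i. i < card (verts G) \<Longrightarrow> w $ i = x (vertex_list G ! i)"
proof -
  note vl = vertex_list[OF G]
  have inj: "inj_on (nth (vertex_list G)) {..<card (verts G)}"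
    using bij_betw_nth[OF vl(1) refl refl] vl(3) by (simp add: bij_betw_def)
  show ?thesis
    by (rule that[of "\<lambda>v. w $ the_inv_into {..<card (verts G)} (nth (vertex_list G)) v"])
       (use the_inv_into_f_f[OF inj] in simp)
qed

text \<open>Eigenvectors as functions on vertices. The zero function is included; a nonzero value or
  a nonzero sum is stated separately.\<close>

definition adj_eigenfun :: "'v ugraph \<Rightarrow> 'a :: comm_ring_1 \<Rightarrow> ('v \<Rightarrow> 'a) \<Rightarrow> bool" where
  "adj_eigenfun G l x \<longleftrightarrow> (\<forall>v\<in>verts G. (\<Sum>u\<in>nbrs G v. x u) = l * x v)"

lemma eigenvector_eigenfun:
  fixes w :: "'a :: comm_ring_1 vec"
  assumes G: "simple_graph (G :: 'v ugraph)" and w: "eigenvector (adj_mat G) w l"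
  obtains x where "adj_eigenfun G l x" "\<exists>v\<in>verts G. x v \<noteq> 0"
    "scalar_prod (ones (card (verts G))) w = (\<Sum>v\<in>verts G. x v)"
proof -
  let ?n = "card (verts G)"
  note vl = vertex_list[OF G]
  have w': "w \<in> carrier_vec ?n" "w \<noteq> 0\<^sub>v ?n" "adj_mat G *\<^sub>v w = l \<cdot>\<^sub>v w"
    using w unfolding eigenvector_def by (auto simp: adj_mat_def)
  obtain x where x: "\<And>i. i < ?n \<Longrightarrow> w $ i = x (vertex_list G ! i)"
    using vec_of_fun_exists[OF G w'(1)] by blast
  have "adj_eigenfun G l x"
    unfolding adj_eigenfun_def
  proof
    fix v assume "v \<in> verts G"
    then obtain i where i: "i < ?n" "v = vertex_list G ! i" using vl by (metis in_set_conv_nth)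
    have "(\<Sum>u\<in>nbrs G v. x u) = (adj_mat G *\<^sub>v w) $ i"
      unfolding i(2) adj_mat_conv[OF G]
      by (rule adj_mat_mult_vec[OF G vl(1,2), symmetric]) (use i w' x vl(3) in auto)
    then show "(\<Sum>u\<in>nbrs G v. x u) = l * x v" using i w' x by simp
  qed
  moreover obtain i where "i < ?n" "w $ i \<noteq> 0"
    using w'(1,2) by (metis carrier_vecD eq_vecI index_zero_vec)
  then have "\<exists>v\<in>verts G. x v \<noteq> 0" using x vl by (metis nth_mem)
  moreover have "scalar_prod (ones ?n) w = (\<Sum>v\<in>verts G. x v)"
    unfolding sum_verts_conv[OF vl(1,2)] using w'(1) x vl(3) by (simp add: scalar_prod_def ones_def)
  ultimately show ?thesis by (rule that)
qed

lemma main_eigenvalues_iff: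
  assumes G: "simple_graph G"
  shows "l \<in> main_eigenvalues G \<longleftrightarrow> (\<exists>x. adj_eigenfun G l x \<and> (\<Sum>v\<in>verts G. x v) \<noteq> 0)"
proof
  assume "l \<in> main_eigenvalues G"
  then obtain w where w: "eigenvector (adj_mat G) w l" "scalar_prod (ones (card (verts G))) w \<noteq> 0"
    unfolding main_eigenvalues_def by blast
  obtain x where "adj_eigenfun G l x" "scalar_prod (ones (card (verts G))) w = (\<Sum>v\<in>verts G. x v)"
    using eigenvector_eigenfun[OF G w(1)] by metis
  then show "\<exists>x. adj_eigenfun G l x \<and> (\<Sum>v\<in>verts G. x v) \<noteq> 0" using w(2) by auto
next
  let ?n = "card (verts G)"
  note vl = vertex_list[OF G]
  assume "\<exists>x. adj_eigenfun G l x \<and> (\<Sum>v\<in>verts G. x v) \<noteq> 0"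
  then obtain x where x: "adj_eigenfun G l x" "(\<Sum>v\<in>verts G. x v) \<noteq> 0" by blast
  define w where "w = vec ?n (\<lambda>i. x (vertex_list G ! i))"
  have w: "w \<in> carrier_vec ?n" by (simp add: w_def)
  have s: "scalar_prod (ones ?n) w = (\<Sum>v\<in>verts G. x v)"
    unfolding sum_verts_conv[OF vl(1,2)] using vl(3) by (simp add: scalar_prod_def ones_def w_def)
  have "adj_mat G *\<^sub>v w = l \<cdot>\<^sub>v w"
  proof (rule eq_vecI)
    fix i assume "i < dim_vec (l \<cdot>\<^sub>v w)"
    then have i: "i < ?n" by (simp add: w_def)
    then have v: "vertex_list G ! i \<in> verts G" using vl by (metis nth_mem)
    have "(adj_mat G *\<^sub>v w) $ i = (\<Sum>u\<in>nbrs G (vertex_list G ! i). x u)"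
      unfolding adj_mat_conv[OF G]
      by (rule adj_mat_mult_vec[OF G vl(1,2)]) (use i vl(3) in \<open>auto simp: w_def\<close>)
    then show "(adj_mat G *\<^sub>v w) $ i = (l \<cdot>\<^sub>v w) $ i"
      using x(1) v i by (simp add: adj_eigenfun_def w_def)
  qed (simp add: w_def adj_mat_def)
  moreover have "w \<noteq> 0\<^sub>v ?n" using s x(2) by (auto simp: scalar_prod_def ones_def)
  ultimately show "l \<in> main_eigenvalues G"
    unfolding main_eigenvalues_def eigenvector_def using w s x(2) by (auto simp: adj_mat_def)
qed

section \<open>Real roots and the factorization of the characteristic polynomial\<close>

text \<open>For an eigenfunction x, the number \<open>S\<close> is its squared norm, and evaluating
  the Hermitian form of A on either side gives both \<open>a * S\<close> and
  \<open>cnj a * S\<close>.\<close>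

lemma graph_poly_complex_root_real:
  assumes G: "simple_graph G" and a: "poly (graph_poly G) (a :: complex) = 0"
  shows "a \<in> \<real>"
proof -
  have "eigenvalue (adj_mat G) a"
    using a eigenvalue_root_char_poly[OF adj_mat_carrier] by blast
  then obtain w where w: "eigenvector (adj_mat G) w a" unfolding eigenvalue_def by blast
  obtain x where x: "adj_eigenfun G a x" "\<exists>v\<in>verts G. x v \<noteq> 0"
    using eigenvector_eigenfun[OF G w] by metis
  define S where "S = (\<Sum>v\<in>verts G. cnj (x v) * x v)"
  have "S = of_real (\<Sum>v\<in>verts G. (cmod (x v))\<^sup>2)"
    unfolding S_def of_real_sum complex_norm_square by (simp add: mult.commute)
  moreover have "(\<Sum>v\<in>verts G. (cmod (x v))\<^sup>2) \<noteq> 0"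
    by (subst sum_nonneg_eq_0_iff) (use finite_verts[OF G] x(2) in auto)
  ultimately have S0: "S \<noteq> 0" by (metis of_real_eq_0_iff)
  have "a * S = (\<Sum>v\<in>verts G. a * (cnj (x v) * x v))"
    by (simp add: S_def sum_distrib_left)
  also have "\<dots> = (\<Sum>v\<in>verts G. cnj (x v) * (\<Sum>u\<in>nbrs G v. x u))"
    using x(1) by (intro sum.cong) (auto simp: adj_eigenfun_def)
  also have "\<dots> = (\<Sum>v\<in>verts G. (\<Sum>u\<in>nbrs G v. cnj (x u)) * x v)"
    by (rule sum_nbrs_swap[OF G, symmetric])
  also have "\<dots> = cnj a * S"
    unfolding S_def sum_distrib_left using x(1) by (intro sum.cong) (auto simp: adj_eigenfun_def simp flip: cnj_sum)
  finally have "a = cnj a" using S0 by simp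
  then show ?thesis by (simp add: Reals_cnj_iff)
qed

text \<open>The complex linear factors have real roots, so the factorization descends to the reals.
  Consequently the multiset of real roots determines the polynomial.\<close>

lemma graph_poly_splits:
  assumes G: "simple_graph G"
  shows "(graph_poly G :: real poly) = (\<Prod>l\<in>#adj_spectrum G. [:- l, 1:])"
proof -
  obtain as where as: "(graph_poly G :: complex poly) = (\<Prod>a\<leftarrow>as. [:- a, 1:])"
    using char_poly_factorized[OF adj_mat_carrier] by blast
  have "a \<in> \<real>" if "a \<in> set as" for a
    using that by (intro graph_poly_complex_root_real[OF G]) (auto simp: as poly_prod_list prod_list_zero_iff)
  then have "map (\<lambda>a. of_real (Re a)) as = as" by (intro map_idI) (auto simp: complex_is_Real_iff complex_eq_iff)
  define bs where "bs = map Re as"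
  have asb: "as = map of_real bs" unfolding bs_def using \<open>map (\<lambda>a. of_real (Re a)) as = as\<close> by (simp add: o_def)
  interpret mp: map_poly_comm_ring_hom complex_of_real by unfold_locales
  have "map_poly complex_of_real (\<Prod>b\<leftarrow>cs. [:- b, 1:]) = (\<Prod>a\<leftarrow>map of_real cs. [:- a, 1:])" for cs
    by (induction cs) (simp_all add: mp.hom_mult del: mult_pCons_left)
  then have eq: "map_poly complex_of_real (graph_poly G) = map_poly complex_of_real (\<Prod>b\<leftarrow>bs. [:- b, 1:])"
    using as asb by (simp add: graph_poly_of_real[symmetric])
  have gp: "graph_poly G = (\<Prod>b\<leftarrow>bs. [:- b, 1:])"
  proof (rule poly_eqI)
    fix n
    show "coeff (graph_poly G :: real poly) n = coeff (\<Prod>b\<leftarrow>bs. [:- b, 1:]) n"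
      using arg_cong[OF eq, of "\<lambda>p. coeff p n"] by (simp add: coeff_map_poly)
  qed
  have nz: "(\<Prod>b\<leftarrow>cs. [:- b, 1:]) \<noteq> (0 :: real poly)" for cs
    by (auto simp: prod_list_zero_iff)
  have "proots (\<Prod>b\<leftarrow>cs. [:- b, 1:]) = mset cs" for cs :: "real list"
  proof (induction cs)
    case (Cons c cs)
    have "proots ([:- c, 1:] * (\<Prod>b\<leftarrow>cs. [:- b, 1:])) = proots [:- c, 1:] + proots (\<Prod>b\<leftarrow>cs. [:- b, 1:])"
      by (rule proots_mult) (use nz in auto)
    then show ?case using Cons.IH by simp
  qed simp
  then have "adj_spectrum G = mset bs" unfolding adj_spectrum_def gp .
  then show ?thesis unfolding gp by (simp add: prod_mset_prod_list flip: mset_map)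
qed

lemma cospectral_graph_poly:
  assumes "simple_graph G" "simple_graph H" "adj_spectrum G = adj_spectrum H"
  shows "graph_poly G = (graph_poly H :: 'a :: field_char_0 poly)"
proof -
  have eq: "map_poly (of_rat :: rat \<Rightarrow> real) (graph_poly G) = map_poly of_rat (graph_poly H)"
    unfolding graph_poly_of_rat[symmetric] using graph_poly_splits assms by metis
  have "graph_poly G = (graph_poly H :: rat poly)"
  proof (rule poly_eqI)
    fix n
    show "coeff (graph_poly G :: rat poly) n = coeff (graph_poly H) n"
      using arg_cong[OF eq, of "\<lambda>p. coeff p n"] by (simp add: coeff_map_poly)
  qed
  then show ?thesis by (metis graph_poly_of_rat)
qed

text \<open>By symmetry h(A) moves to the eigenfunction, where it acts as the scalar h(l).\<close>

lemma adj_eigenfun_pairing: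
  fixes x :: "'v \<Rightarrow> 'a :: comm_ring_1"
  assumes G: "simple_graph G" and x: "adj_eigenfun G l x"
  shows "(\<Sum>v\<in>verts G. walk_eval G h v * x v) = poly h l * (\<Sum>v\<in>verts G. x v)"
proof (induction h)
  case (pCons a h)
  have "(\<Sum>v\<in>verts G. walk_eval G (pCons a h) v * x v)
      = a * (\<Sum>v\<in>verts G. x v) + (\<Sum>v\<in>verts G. (\<Sum>u\<in>nbrs G v. walk_eval G h u) * x v)"
    by (simp add: walk_eval_pCons distrib_right sum.distrib sum_distrib_left)
  also have "(\<Sum>v\<in>verts G. (\<Sum>u\<in>nbrs G v. walk_eval G h u) * x v) = (\<Sum>v\<in>verts G. walk_eval G h v * (l * x v))"
    unfolding sum_nbrs_swap[OF G] using x by (intro sum.cong) (auto simp: adj_eigenfun_def)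
  also have "\<dots> = l * (\<Sum>v\<in>verts G. walk_eval G h v * x v)"
    by (simp add: sum_distrib_left mult_ac)
  finally show ?case unfolding pCons.IH by (simp add: algebra_simps)
qed simp

lemma main_eigenvalue_root:
  assumes G: "simple_graph G" and "l \<in> main_eigenvalues G" and h: "walk_annih G h"
  shows "poly h l = 0"
proof -
  obtain x where x: "adj_eigenfun G l x" "(\<Sum>v\<in>verts G. x v) \<noteq> 0"
    using assms(2) main_eigenvalues_iff[OF G] by blast
  have "(\<Sum>v\<in>verts G. walk_eval G h v * x v) = 0"
    using h unfolding walk_annih_def by simp
  then show ?thesis using adj_eigenfun_pairing[OF G x(1), of h] x(2) by simp
qed

text \<open>For a minimal multiset \<open>S\<close> such that \<open>\<Prod>(x - l)\<close> annihilates \<open>\<one>\<close>, removing one root \<open>l\<close> leaves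
  an eigenvector \<open>r(A) \<one>\<close>, and \<open>|r(A) \<one>|\<^sup>2 = r(l) \<one>\<^sup>T r(A) \<one>\<close> shows that \<open>l\<close> is main and simple.\<close>

lemma main_poly_annih:
  assumes G: "simple_graph G"
  shows "walk_annih G (main_poly G)" "finite (main_eigenvalues G)"
proof -
  define P where "P S = (\<Prod>l\<in>#S. [:- l, 1:])" for S :: "real multiset"
  have "walk_annih G (graph_poly G :: real poly)"
    using walk_annih_graph_poly[OF G] by (subst graph_poly_of_rat) (simp add: walk_annih_of_rat)
  then have "walk_annih G (P (adj_spectrum G))" using graph_poly_splits[OF G] by (simp add: P_def)
  then obtain S where S: "walk_annih G (P S)" and min: "\<And>S'. walk_annih G (P S') \<Longrightarrow> size S \<le> size S'"
    using ex_has_least_nat[of "\<lambda>S. walk_annih G (P S)" _ size] by blast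
  have key: "l \<in> main_eigenvalues G \<and> l \<notin># S - {#l#}" if l: "l \<in># S" for l
  proof -
    define S' where "S' = S - {#l#}"
    define r where "r = P S'"
    have SS: "S = add_mset l S'" using l by (simp add: S'_def)
    have PS: "P S = [:- l, 1:] * r" by (simp add: P_def SS r_def)
    have nr: "\<not> walk_annih G r" using min[of S'] by (auto simp: r_def SS)
    have eig: "adj_eigenfun G l (walk_eval G r)"
      unfolding adj_eigenfun_def
    proof
      fix v assume "v \<in> verts G"
      then have "walk_eval G ([:- l, 1:] * r) v = 0" using S unfolding PS walk_annih_def by blast
      then show "(\<Sum>u\<in>nbrs G v. walk_eval G r u) = l * walk_eval G r v"
        by (simp add: walk_eval_diff walk_eval_smult walk_eval_pCons)
    qed
    have "(\<Sum>v\<in>verts G. walk_eval G r v * walk_eval G r v) \<noteq> 0"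
      by (subst sum_nonneg_eq_0_iff) (use nr finite_verts[OF G] in \<open>auto simp: walk_annih_def\<close>)
    then have "poly r l \<noteq> 0" "(\<Sum>v\<in>verts G. walk_eval G r v) \<noteq> 0"
      unfolding adj_eigenfun_pairing[OF G eig] by auto
    then show ?thesis using main_eigenvalues_iff[OF G] eig
      by (auto simp: r_def P_def S'_def poly_prod_mset)
  qed
  have sub: "set_mset S \<subseteq> main_eigenvalues G" using key by blast
  have sup: "main_eigenvalues G \<subseteq> set_mset S"
  proof
    fix l assume "l \<in> main_eigenvalues G"
    then have "poly (P S) l = 0" by (rule main_eigenvalue_root[OF G _ S])
    then show "l \<in> set_mset S" by (auto simp: P_def poly_prod_mset)
  qed
  have "S = mset_set (set_mset S)"
  proof (rule multiset_eqI)
    fix l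
    have "count S l = 1" if "l \<in># S"
    proof -
      have "\<not> 1 < count S l" using key[OF that] by (simp add: in_diff_count)
      moreover have "0 < count S l" using that by (simp only: count_greater_zero_iff)
      ultimately show ?thesis by linarith
    qed
    then show "count S l = count (mset_set (set_mset S)) l"
      by (cases "l \<in># S") (auto simp: not_in_iff count_mset_set)
  qed
  then have "main_poly G = P S"
    unfolding main_poly_def P_def using sub sup by (metis prod_unfold_prod_mset subset_antisym)
  then show "walk_annih G (main_poly G)" using S by simp
  show "finite (main_eigenvalues G)" using sup by (rule finite_subset) simp
qed

lemma prod_linear_dvd:
  fixes h :: "'a :: idom poly"
  assumes "finite S" "\<And>l. l \<in> S \<Longrightarrow> poly h l = 0"
  shows "(\<Prod>l\<in>S. [:- l, 1:]) dvd h"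
  using assms
proof (induction S rule: finite_induct)
  case (insert a S)
  obtain k where k: "h = (\<Prod>l\<in>S. [:- l, 1:]) * k" using insert by (auto elim: dvdE)
  have "poly (\<Prod>l\<in>S. [:- l, 1:]) a \<noteq> 0" using insert.hyps by (auto simp: poly_prod)
  then have "poly k a = 0" using insert.prems[of a] k by simp
  then have "[:- a, 1:] dvd k" by (simp add: poly_eq_0_iff_dvd)
  then have "[:- a, 1:] * (\<Prod>l\<in>S. [:- l, 1:]) dvd k * (\<Prod>l\<in>S. [:- l, 1:])" by (rule mult_dvd_mono) simp
  then show ?case using insert.hyps k by (simp add: mult.commute)
qed simp

text \<open>The main polynomial is the minimal polynomial of A relative to the all-one vector: it
  annihilates, and every annihilating polynomial vanishes at all main eigenvalues.\<close>

lemma main_poly_dvd_iff: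
  assumes G: "simple_graph G"
  shows "main_poly G dvd h \<longleftrightarrow> walk_annih G h"
  using walk_annih_dvd[OF G main_poly_annih(1)[OF G]]
    prod_linear_dvd[OF main_poly_annih(2)[OF G]] main_eigenvalue_root[OF G]
  unfolding main_poly_def by blast

lemma main_poly_monic: "lead_coeff (main_poly G) = 1"
  unfolding main_poly_def by (rule monic_prod) simp

section \<open>Closed walks and bipartiteness\<close>

definition mat_trace :: "'a :: comm_monoid_add mat \<Rightarrow> 'a" where
  "mat_trace A = (\<Sum>i\<in>{0..<dim_row A}. A $$ (i, i))"

lemma mat_trace_mult_comm:
  fixes A B :: "'a :: comm_semiring_0 mat"
  assumes "A \<in> carrier_mat n n" "B \<in> carrier_mat n n"
  shows "mat_trace (A * B) = mat_trace (B * A)"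
proof -
  have "mat_trace (A * B) = (\<Sum>i\<in>{0..<n}. \<Sum>j\<in>{0..<n}. A $$ (i, j) * B $$ (j, i))"
    using assms by (simp add: mat_trace_def scalar_prod_def)
  also have "\<dots> = (\<Sum>j\<in>{0..<n}. \<Sum>i\<in>{0..<n}. A $$ (i, j) * B $$ (j, i))" by (rule sum.swap)
  also have "\<dots> = mat_trace (B * A)"
    using assms by (simp add: mat_trace_def scalar_prod_def mult.commute)
  finally show ?thesis .
qed

lemma mat_trace_similar:
  fixes A B :: "'a :: comm_ring_1 mat"
  assumes A: "A \<in> carrier_mat n n" and s: "similar_mat_wit A B P Q"
  shows "mat_trace A = mat_trace B"
proof -
  have c: "B \<in> carrier_mat n n" "P \<in> carrier_mat n n" "Q \<in> carrier_mat n n"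
    and QP: "Q * P = 1\<^sub>m n" and AB: "A = P * B * Q"
    using s A unfolding similar_mat_wit_def Let_def by auto
  have "mat_trace A = mat_trace (Q * (P * B))"
    unfolding AB by (rule mat_trace_mult_comm) (use c in auto)
  also have "Q * (P * B) = B"
    unfolding assoc_mult_mat[OF c(3,2,1), symmetric] QP using c by simp
  finally show ?thesis .
qed

lemma upper_triangular_mult_diag:
  fixes A B :: "'a :: semiring_0 mat"
  assumes A: "A \<in> carrier_mat n n" "upper_triangular A" and B: "B \<in> carrier_mat n n" "upper_triangular B"
  shows "upper_triangular (A * B)" and "i < n \<Longrightarrow> (A * B) $$ (i, i) = A $$ (i, i) * B $$ (i, i)"
proof -
  have z: "A $$ (i, l) * B $$ (l, j) = 0" if "i < n" "l < n" "j \<le> i" "l \<noteq> i \<or> j \<noteq> i" for i j l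
  proof (cases "l < i")
    case True then show ?thesis using A that by (simp add: upper_triangularD)
  next
    case False
    then have "j < l" using that by linarith
    then show ?thesis using B that by (simp add: upper_triangularD)
  qed
  have e: "(A * B) $$ (i, j) = (\<Sum>l\<in>{0..<n}. A $$ (i, l) * B $$ (l, j))" if "i < n" "j < n" for i j
    using A B that by (simp add: scalar_prod_def)
  show "upper_triangular (A * B)"
  proof (rule upper_triangularI)
    fix i j assume ij: "j < i" "i < dim_row (A * B)"
    then show "(A * B) $$ (i, j) = 0" using A e[of i j] z[of i _ j] by simp
  qed
  show "(A * B) $$ (i, i) = A $$ (i, i) * B $$ (i, i)" if i: "i < n"
  proof -
    have "(\<Sum>l\<in>{0..<n}. A $$ (i, l) * B $$ (l, i)) = (\<Sum>l\<in>{i}. A $$ (i, l) * B $$ (l, i))"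
      by (rule sum.mono_neutral_right) (use i z[of i _ i] in auto)
    then show ?thesis using e i by simp
  qed
qed

lemma upper_triangular_pow_diag:
  fixes B :: "'a :: semiring_1 mat"
  assumes B: "B \<in> carrier_mat n n" "upper_triangular B"
  shows "upper_triangular (B ^\<^sub>m k) \<and> (\<forall>i<n. (B ^\<^sub>m k) $$ (i, i) = (B $$ (i, i)) ^ k)"
proof (induction k)
  case 0 then show ?case using B by simp
next
  case (Suc k)
  have c: "B ^\<^sub>m k \<in> carrier_mat n n" using B by simp
  show ?case
    using upper_triangular_mult_diag[OF c _ B] Suc by (simp add: power_commutes)
qed

text \<open>Schur triangularization puts the given roots on the diagonal; powers of a triangular
  matrix have the powers on theirs, and similarity preserves the trace.\<close>

lemma mat_trace_pow:
  fixes A :: "complex mat"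
  assumes A: "A \<in> carrier_mat n n" and es: "char_poly A = (\<Prod>e\<leftarrow>es. [:- e, 1:])"
  shows "mat_trace (A ^\<^sub>m k) = (\<Sum>e\<leftarrow>es. e ^ k)"
proof -
  obtain B P Q where "schur_decomposition A es = (B, P, Q)" by (metis prod_cases3)
  then have B: "similar_mat_wit A B P Q" "upper_triangular B" "diag_mat B = es"
    using schur_decomposition[OF A es] by auto
  have cB: "B \<in> carrier_mat n n" using B(1) A unfolding similar_mat_wit_def Let_def by auto
  have "mat_trace (A ^\<^sub>m k) = mat_trace (B ^\<^sub>m k)"
    by (rule mat_trace_similar[OF pow_carrier_mat[OF A] similar_mat_wit_pow[OF B(1)]])
  also have "\<dots> = (\<Sum>i\<in>{0..<n}. (B $$ (i, i)) ^ k)"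
    using upper_triangular_pow_diag[OF cB B(2)] cB by (simp add: mat_trace_def)
  also have "\<dots> = (\<Sum>e\<leftarrow>es. e ^ k)"
    unfolding B(3)[symmetric] diag_mat_def using cB by (simp add: sum_list_sum_nth o_def)
  finally show ?thesis .
qed

text \<open>The recursion peels off the last step, in accordance with the matrix power as
  \<open>A ^\<^sub>m k * A\<close>.\<close>

fun walks_between :: "'v ugraph \<Rightarrow> nat \<Rightarrow> 'v \<Rightarrow> 'v \<Rightarrow> nat" where
  "walks_between G 0 u v = (if u = v then 1 else 0)"
| "walks_between G (Suc k) u v = (\<Sum>w\<in>nbrs G v. walks_between G k u w)"

lemma adj_mat_pow:
  assumes G: "simple_graph G" and ij: "i < card (verts G)" "j < card (verts G)"
  shows "((adj_mat G :: 'a :: comm_semiring_1 mat) ^\<^sub>m k) $$ (i, j)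
    = of_nat (walks_between G k (vertex_list G ! i) (vertex_list G ! j))"
  using ij
proof (induction k arbitrary: j)
  case 0
  then show ?case using vertex_list[OF G] by (auto simp: nth_eq_iff_index_eq adj_mat_def)
next
  case (Suc k)
  let ?A = "adj_mat G :: 'a mat" and ?vl = "vertex_list G" and ?n = "card (verts G)"
  note vl = vertex_list[OF G]
  have c: "?A \<in> carrier_mat ?n ?n" "?A ^\<^sub>m k \<in> carrier_mat ?n ?n" by simp_all
  have "(?A ^\<^sub>m Suc k) $$ (i, j) = (\<Sum>l\<in>{0..<?n}. (?A ^\<^sub>m k) $$ (i, l) * ?A $$ (l, j))"
    using Suc.prems carrier_matD[OF c(1)] carrier_matD[OF c(2)] by (simp add: scalar_prod_def)
  also have "\<dots> = (\<Sum>l\<in>{0..<length ?vl}. if {?vl ! j, ?vl ! l} \<in> edges G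
      then of_nat (walks_between G k (?vl ! i) (?vl ! l)) else 0)"
    using Suc vl(3) by (intro sum.cong) (auto simp: adj_mat_def insert_commute)
  also have "\<dots> = (\<Sum>w\<in>nbrs G (?vl ! j). of_nat (walks_between G k (?vl ! i) w))"
    by (rule sum_row_adj[OF G vl(1,2)])
  finally show ?case by simp
qed

text \<open>The number of closed walks of length \<open>k\<close> is the trace of the
  \<open>k\<close>-th power, a power sum of the roots of the characteristic polynomial.\<close>

lemma closed_walks_eq:
  assumes G: "simple_graph G" and H: "simple_graph H" and p: "graph_poly G = (graph_poly H :: complex poly)"
  shows "(\<Sum>v\<in>verts G. walks_between G k v v) = (\<Sum>v\<in>verts H. walks_between H k v v)"
proof -
  have tr: "mat_trace ((adj_mat G :: complex mat) ^\<^sub>m k) = of_nat (\<Sum>v\<in>verts G. walks_between G k v v)"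
    if G: "simple_graph G" for G :: "'x ugraph"
  proof -
    note vl = vertex_list[OF G]
    have "mat_trace ((adj_mat G :: complex mat) ^\<^sub>m k)
        = (\<Sum>i\<in>{0..<card (verts G)}. of_nat (walks_between G k (vertex_list G ! i) (vertex_list G ! i)))"
      unfolding mat_trace_def by (intro sum.cong) (auto simp: adj_mat_pow[OF G] carrier_matD[OF adj_mat_carrier])
    then show ?thesis unfolding sum_verts_conv[OF vl(1,2)] vl(3) by simp
  qed
  obtain as where as: "(graph_poly G :: complex poly) = (\<Prod>a\<leftarrow>as. [:- a, 1:])"
    using char_poly_factorized[OF adj_mat_carrier] by blast
  have "mat_trace ((adj_mat G :: complex mat) ^\<^sub>m k) = mat_trace ((adj_mat H :: complex mat) ^\<^sub>m k)"
    using mat_trace_pow[OF adj_mat_carrier as] mat_trace_pow[OF adj_mat_carrier, of H as] as p by simp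
  then show ?thesis unfolding tr[OF G] tr[OF H] by (simp only: of_nat_eq_iff)
qed

lemma walks_between_parity:
  assumes c: "\<And>u v. {u, v} \<in> edges G \<Longrightarrow> c u \<noteq> (c v :: bool)"
    and "walks_between G k u v \<noteq> 0"
  shows "c u = c v \<longleftrightarrow> even k"
  using assms(2)
proof (induction k arbitrary: v)
  case (Suc k)
  have "\<exists>w\<in>nbrs G v. walks_between G k u w \<noteq> 0"
    by (rule ccontr) (use Suc.prems in simp)
  then obtain w where "w \<in> nbrs G v" "walks_between G k u w \<noteq> 0" by blast
  then show ?case using Suc.IH[of w] c[of w v] by (auto simp: nbrs_def)
qed (simp split: if_splits)

lemma walks_between_relpow:
  assumes G: "simple_graph G" and "(u, v) \<in> adj_rel G ^^ k"
  shows "walks_between G k u v \<noteq> 0"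
  using assms(2)
proof (induction k arbitrary: v)
  case (Suc k)
  obtain w where w: "(u, w) \<in> adj_rel G ^^ k" "(w, v) \<in> adj_rel G"
    using Suc.prems by (meson relpow_Suc_E)
  have "walks_between G k u w \<le> walks_between G (Suc k) u v"
    using w(2) finite_nbrs[OF G] by (auto simp: adj_rel_iff intro: member_le_sum)
  then show ?case using Suc.IH[OF w(1)] by simp
qed simp

lemma relpow_sym:
  assumes "sym R" "(u, v) \<in> R ^^ k"
  shows "(v, u) \<in> R ^^ k"
  using assms(2)
proof (induction k arbitrary: v)
  case (Suc k)
  obtain w where w: "(u, w) \<in> R ^^ k" "(w, v) \<in> R" using Suc.prems by (meson relpow_Suc_E)
  then show ?case using Suc.IH[OF w(1)] symD[OF assms(1)] by (meson relpow_Suc_I2)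
qed simp

text \<open>Vertices are coloured by whether an even walk from a root reaches them. Some walk
  reaches each vertex, so one end of every edge gets an even walk; if both did, the root would lie
  on an odd closed walk.\<close>

lemma no_odd_closed_walk_colouring:
  assumes G: "simple_graph G" "connected_graph G"
    and odd: "\<And>v k. v \<in> verts G \<Longrightarrow> odd k \<Longrightarrow> (v, v) \<notin> adj_rel G ^^ k"
  obtains c :: "'v \<Rightarrow> bool" where "\<And>u v. {u, v} \<in> edges (G :: 'v ugraph) \<Longrightarrow> c u \<noteq> c v"
proof -
  let ?R = "adj_rel G"
  obtain r where r: "r \<in> verts G" using G(2) unfolding connected_graph_def by blast
  define c where "c v \<longleftrightarrow> (\<exists>k. even k \<and> (r, v) \<in> ?R ^^ k)" for v
  have "c u \<noteq> c v" if e: "{u, v} \<in> edges G" for u v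
  proof -
    have uv: "(u, v) \<in> ?R" "u \<in> verts G" using e simple_graph_edgeD[OF G(1) e] by (auto simp: adj_rel_def)
    obtain k where k: "(r, u) \<in> ?R ^^ k"
      using G(2) r uv(2) unfolding connected_graph_def by (meson rtrancl_imp_relpow)
    then have k': "(r, v) \<in> ?R ^^ Suc k" using uv(1) by auto
    have "\<not> (c u \<and> c v)"
    proof
      assume "c u \<and> c v"
      then obtain m l where ml: "even m" "(r, u) \<in> ?R ^^ m" "even l" "(r, v) \<in> ?R ^^ l"
        unfolding c_def by blast
      \<comment> \<open>Out to \<open>u\<close>, across the edge and back from \<open>v\<close>: the
        total length \<open>m + 1 + l\<close> is odd.\<close>
      have "(r, v) \<in> ?R ^^ Suc m" using ml(2) uv(1) by auto
      from relpow_trans[OF this relpow_sym[OF adj_rel_sym ml(4)]]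
      show False using odd[OF r, of "Suc m + l"] ml by simp
    qed
    moreover have "c u \<or> c v"
    proof (cases "even k")
      case True
      then show ?thesis using k unfolding c_def by blast
    next
      case False
      then have "even (Suc k)" by simp
      then show ?thesis using k' unfolding c_def by blast
    qed
    ultimately show ?thesis by blast
  qed
  then show ?thesis by (rule that)
qed

lemma bipartite_of_colouring:
  assumes G: "simple_graph G" and c: "\<And>u v. {u, v} \<in> edges G \<Longrightarrow> c u \<noteq> (c v :: bool)"
  shows "bipartite_graph G"
  unfolding bipartite_graph_def
proof (intro exI conjI ballI)
  show "{v \<in> verts G. c v} \<union> {v \<in> verts G. \<not> c v} = verts G" by blast
  show "{v \<in> verts G. c v} \<inter> {v \<in> verts G. \<not> c v} = {}" by blast
  fix e assume e: "e \<in> edges G"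
  obtain u v where uv: "e = {u, v}" "u \<in> verts G" "v \<in> verts G" using simple_graph_edgeE[OF G e] by metis
  then have "c u \<noteq> c v" using c e by blast
  then show "\<exists>x\<in>{v \<in> verts G. c v}. \<exists>y\<in>{v \<in> verts G. \<not> c v}. e = {x, y}"
    using uv by (cases "c u") (auto simp: insert_commute)
qed

section \<open>Unions of components\<close>

text \<open>Changing the enumeration conjugates the adjacency matrix by a permutation
  matrix.\<close>

lemma char_poly_adj_mat_of:
  assumes G: "simple_graph (G :: 'v ugraph)" and ws: "distinct ws" "set ws = verts G"
  shows "char_poly (adj_mat_of G ws) = (graph_poly G :: 'a :: comm_ring_1 poly)"
proof -
  let ?vl = "vertex_list G" and ?n = "card (verts G)"
  note vl = vertex_list[OF G]
  have lw: "length ws = ?n" using ws by (metis distinct_card)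
  \<comment> \<open>The permutation matrix between two enumerations, inverse to the one with the
    lists exchanged. Each row has a single 1, so the sums in its products collapse by
    \<open>pick\<close>.\<close>
  define E :: "'v list \<Rightarrow> 'v list \<Rightarrow> 'a mat" where
    "E us vs = mat ?n ?n (\<lambda>(i, j). if us ! i = vs ! j then 1 else 0)" for us vs
  have E: "E us vs \<in> carrier_mat ?n ?n" for us vs by (simp add: E_def)
  have pick: "(\<Sum>l\<in>{0..<?n}. if x = vs ! l then f (vs ! l) else 0) = f x"
    if "distinct vs" "set vs = verts G" "x \<in> verts G" for x vs and f :: "'v \<Rightarrow> 'a"
  proof -
    have "(\<Sum>l\<in>{0..<length vs}. if x = vs ! l then f (vs ! l) else 0) = (\<Sum>v\<in>verts G. if x = v then f v else 0)"
      by (rule sum_verts_conv[OF that(1,2), symmetric])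
    moreover have "length vs = ?n" using that by (metis distinct_card)
    ultimately show ?thesis using that(3) finite_verts[OF G] by simp
  qed
  have mem: "vs ! i \<in> verts G" if "distinct vs" "set vs = verts G" "i < ?n" for vs i
    using that by (metis distinct_card nth_mem)
  have EE: "E us vs * E vs us = 1\<^sub>m ?n" if "distinct us" "set us = verts G" "distinct vs" "set vs = verts G" for us vs
  proof (rule eq_matI)
    fix i j assume "i < dim_row (1\<^sub>m ?n :: 'a mat)" "j < dim_col (1\<^sub>m ?n :: 'a mat)"
    then have ij: "i < ?n" "j < ?n" by auto
    have "length us = ?n" using that by (metis distinct_card)
    then have "us ! i = us ! j \<longleftrightarrow> i = j" using ij that(1) by (simp add: nth_eq_iff_index_eq)
    moreover have "(E us vs * E vs us) $$ (i, j) = (\<Sum>l\<in>{0..<?n}. if us ! i = vs ! l then (if vs ! l = us ! j then 1 else 0) else 0)"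
      using ij by (auto simp: E_def scalar_prod_def intro!: sum.cong)
    moreover have "\<dots> = (if us ! i = us ! j then 1 else 0)"
      by (rule pick[OF that(3,4) mem[OF that(1,2) ij(1)]])
    ultimately show "(E us vs * E vs us) $$ (i, j) = 1\<^sub>m ?n $$ (i, j)" using ij by simp
  qed (auto simp: E_def)
  define a :: "'v \<Rightarrow> 'v \<Rightarrow> 'a" where "a u v = (if {u, v} \<in> edges G then 1 else 0)" for u v
  have A: "adj_mat_of G vs = mat ?n ?n (\<lambda>(i, j). a (vs ! i) (vs ! j))" if "length vs = ?n" for vs
    by (simp add: adj_mat_of_def a_def that)
  define B where "B = mat ?n ?n (\<lambda>(i, j). a (ws ! i) (?vl ! j))"
  have "E ws ?vl * adj_mat_of G ?vl = B"
  proof (rule eq_matI)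
    fix i j assume "i < dim_row B" "j < dim_col B"
    then have ij: "i < ?n" "j < ?n" by (auto simp: B_def)
    have "(E ws ?vl * adj_mat_of G ?vl) $$ (i, j) = (\<Sum>l\<in>{0..<?n}. if ws ! i = ?vl ! l then a (?vl ! l) (?vl ! j) else 0)"
      using ij by (auto simp: E_def A vl(3) scalar_prod_def intro!: sum.cong)
    also have "\<dots> = a (ws ! i) (?vl ! j)" by (rule pick[OF vl(1,2) mem[OF ws ij(1)]])
    finally show "(E ws ?vl * adj_mat_of G ?vl) $$ (i, j) = B $$ (i, j)" using ij by (simp add: B_def)
  qed (auto simp: E_def A vl(3) B_def)
  moreover have "B * E ?vl ws = adj_mat_of G ws"
  proof (rule eq_matI)
    fix i j assume "i < dim_row (adj_mat_of G ws :: 'a mat)" "j < dim_col (adj_mat_of G ws :: 'a mat)"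
    then have ij: "i < ?n" "j < ?n" by (auto simp: A lw)
    have "(B * E ?vl ws) $$ (i, j) = (\<Sum>l\<in>{0..<?n}. if ws ! j = ?vl ! l then a (ws ! i) (?vl ! l) else 0)"
      using ij by (auto simp: E_def B_def scalar_prod_def intro!: sum.cong)
    also have "\<dots> = a (ws ! i) (ws ! j)" by (rule pick[OF vl(1,2) mem[OF ws ij(2)]])
    finally show "(B * E ?vl ws) $$ (i, j) = adj_mat_of G ws $$ (i, j)" using ij by (simp add: A lw)
  qed (auto simp: E_def A lw B_def)
  ultimately have "similar_mat_wit (adj_mat_of G ws) (adj_mat_of G ?vl) (E ws ?vl) (E ?vl ws)"
    unfolding similar_mat_wit_def Let_def
    using EE[OF ws vl(1,2)] EE[OF vl(1,2) ws] E by (auto simp: A lw vl(3))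
  then have "similar_mat (adj_mat_of G ws) (adj_mat_of G ?vl :: 'a mat)" unfolding similar_mat_def by blast
  then show ?thesis unfolding adj_mat_conv[OF G] by (rule char_poly_similar)
qed

lemma char_poly_block_diag:
  fixes A D :: "'a :: idom mat"
  assumes A: "A \<in> carrier_mat n n" and D: "D \<in> carrier_mat m m"
  shows "char_poly (four_block_mat A (0\<^sub>m n m) (0\<^sub>m m n) D) = char_poly A * char_poly D"
proof -
  have "char_poly_matrix (four_block_mat A (0\<^sub>m n m) (0\<^sub>m m n) D)
      = four_block_mat (char_poly_matrix A) (0\<^sub>m n m) (0\<^sub>m m n) (char_poly_matrix D)"
    by (rule eq_matI) (use A D in \<open>auto simp: char_poly_matrix_def\<close>)
  then show ?thesis unfolding char_poly_def
    using det_four_block_mat_upper_right_zero[of "char_poly_matrix A" n "0\<^sub>m n m" m "0\<^sub>m m n" "char_poly_matrix D"] A D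
    by simp
qed

section \<open>Vertex sets closed under adjacency\<close>

definition induced :: "'v ugraph \<Rightarrow> 'v set \<Rightarrow> 'v ugraph" where
  "induced G S = \<lparr>verts = S, edges = {e \<in> edges G. e \<subseteq> S}\<rparr>"

text \<open>Such a set is a union of components. It is described by edges alone, and its complement
  is again of this kind.\<close>

definition closed_in :: "'v ugraph \<Rightarrow> 'v set \<Rightarrow> bool" where
  "closed_in G S \<longleftrightarrow> S \<subseteq> verts G \<and> (\<forall>e\<in>edges G. e \<subseteq> S \<or> e \<inter> S = {})"

lemma induced_simps [simp]: "verts (induced G S) = S" "edges (induced G S) = {e \<in> edges G. e \<subseteq> S}"
  by (simp_all add: induced_def)

lemma induced_simple: "simple_graph G \<Longrightarrow> closed_in G S \<Longrightarrow> simple_graph (induced G S)"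
  by (auto simp: simple_graph_def closed_in_def intro: finite_subset)

lemma closed_in_Diff:
  assumes "simple_graph G" "closed_in G S"
  shows "closed_in G (verts G - S)"
  using assms unfolding closed_in_def simple_graph_def by blast

lemma closed_in_induced:
  assumes "closed_in G S" "closed_in (induced G S) S'"
  shows "closed_in G S'"
proof -
  have "e \<subseteq> S' \<or> e \<inter> S' = {}" if "e \<in> edges G" for e
    using assms that unfolding closed_in_def induced_simps by (cases "e \<subseteq> S") blast+
  then show ?thesis using assms unfolding closed_in_def by auto
qed

lemma induced_induced: "S' \<subseteq> S \<Longrightarrow> induced (induced G S) S' = induced G S'"
  by (auto simp: induced_def)

lemma nbrs_induced: "closed_in G S \<Longrightarrow> v \<in> S \<Longrightarrow> nbrs (induced G S) v = nbrs G v"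
  by (auto simp: nbrs_def closed_in_def)

lemma nbrs_closed: "closed_in G S \<Longrightarrow> v \<in> S \<Longrightarrow> nbrs G v \<subseteq> S"
  by (auto simp: nbrs_def closed_in_def)

text \<open>A walk that starts in a closed set never leaves it.\<close>

lemma walks_induced:
  assumes "closed_in G S" "v \<in> S"
  shows "walks (induced G S) k v = walks G k v"
  using assms(2)
proof (induction k arbitrary: v)
  case (Suc k)
  then show ?case using nbrs_closed[OF assms(1)]
    by (auto simp: nbrs_induced[OF assms(1)] intro!: sum.cong)
qed simp

lemma walk_eval_induced: "closed_in G S \<Longrightarrow> v \<in> S \<Longrightarrow> walk_eval (induced G S) h v = walk_eval G h v"
  by (simp add: walk_eval_def walks_induced)

lemma walk_annih_induced: "closed_in G S \<Longrightarrow> walk_annih G h \<Longrightarrow> walk_annih (induced G S) h"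
  by (auto simp: walk_annih_def walk_eval_induced closed_in_def)

lemma walk_count_induced:
  assumes G: "simple_graph G" and S: "closed_in G S"
  shows "walk_count G k = walk_count (induced G S) k + walk_count (induced G (verts G - S)) k"
proof -
  have "walk_count (induced G S) k + walk_count (induced G (verts G - S)) k
      = (\<Sum>v\<in>S. walks G k v) + (\<Sum>v\<in>verts G - S. walks G k v)"
    unfolding walk_count_def induced_simps
    using walks_induced[OF S, of _ k] walks_induced[OF closed_in_Diff[OF G S], of _ k]
    by (intro arg_cong2[of _ _ _ _ "(+)"] sum.cong) auto
  also have "\<dots> = walk_count G k"
    unfolding walk_count_def using S finite_verts[OF G] unfolding closed_in_def
    by (metis add.commute sum.subset_diff)
  finally show ?thesis by simp
qed

lemma edges_induced:
  assumes G: "simple_graph G" and S: "closed_in G S"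
  shows "edges G = edges (induced G S) \<union> edges (induced G (verts G - S))"
    and "edges (induced G S) \<inter> edges (induced G (verts G - S)) = {}"
proof -
  have "e \<subseteq> S \<or> e \<subseteq> verts G - S" "e \<noteq> {}" if "e \<in> edges G" for e
  proof -
    have "e \<subseteq> verts G" "card e = 2" using G that unfolding simple_graph_def by blast+
    moreover have "e \<subseteq> S \<or> e \<inter> S = {}" using S that unfolding closed_in_def by blast
    ultimately show "e \<subseteq> S \<or> e \<subseteq> verts G - S" "e \<noteq> {}" by auto
  qed
  then show "edges G = edges (induced G S) \<union> edges (induced G (verts G - S))"
    and "edges (induced G S) \<inter> edges (induced G (verts G - S)) = {}"
    by (auto; blast)+
qed

lemma induced_union:
  fixes G :: "'v ugraph"
  assumes G: "simple_graph G" and S: "closed_in G S"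
  shows "G = graph_union (induced G S) (induced G (verts G - S))"
proof -
  have "verts G = S \<union> (verts G - S)" using S unfolding closed_in_def by blast
  then show ?thesis using edges_induced(1)[OF G S]
    by (intro ugraph.equality) (simp_all add: graph_union_def)
qed

text \<open>If the vertices of \<open>S\<close> are listed before the others, the absence of edges
  between the parts makes the adjacency matrix block diagonal.\<close>

lemma graph_poly_induced:
  assumes G: "simple_graph G" and S: "closed_in G S"
  shows "graph_poly G = graph_poly (induced G S) * (graph_poly (induced G (verts G - S)) :: 'a :: idom poly)"
proof -
  let ?S' = "verts G - S"
  have S': "closed_in G ?S'" by (rule closed_in_Diff[OF G S])
  let ?P = "induced G S" and ?Q = "induced G ?S'"
  have P: "simple_graph ?P" and Q: "simple_graph ?Q" using induced_simple[OF G] S S' by auto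
  note vp = vertex_list[OF P] and vq = vertex_list[OF Q]
  let ?a = "vertex_list ?P" and ?b = "vertex_list ?Q"
  have sub: "S \<subseteq> verts G" using S unfolding closed_in_def by blast
  have ab: "distinct (?a @ ?b)" "set (?a @ ?b) = verts G" using vp vq sub by auto
  have nth: "(?a @ ?b) ! i = (if i < length ?a then ?a ! i else ?b ! (i - length ?a))" for i
    by (simp add: nth_append)
  have mp: "?a ! i \<in> S" if "i < length ?a" for i using that vp(2) by (metis nth_mem induced_simps(1))
  have mq: "?b ! i \<in> ?S'" if "i < length ?b" for i using that vq(2) by (metis nth_mem induced_simps(1))
  have cross': "{x, y} \<notin> edges G" if "x \<in> S" "y \<in> ?S'" for x y
  proof
    assume "{x, y} \<in> edges G"
    then have "{x, y} \<subseteq> S \<or> {x, y} \<inter> S = {}"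
      using conjunct2[OF S[unfolded closed_in_def]] by (rule bspec[rotated])
    then show False using that by simp
  qed
  then have cross: "{x, y} \<notin> edges G" "{y, x} \<notin> edges G" if "x \<in> S" "y \<in> ?S'" for x y
    using that by (simp_all add: insert_commute)
  have "adj_mat_of G (?a @ ?b) = four_block_mat (adj_mat_of ?P ?a) (0\<^sub>m (length ?a) (length ?b))
      (0\<^sub>m (length ?b) (length ?a)) (adj_mat_of ?Q ?b :: 'a mat)"
  proof (rule eq_matI)
    fix i j
    assume "i < dim_row (four_block_mat (adj_mat_of ?P ?a) (0\<^sub>m (length ?a) (length ?b))
      (0\<^sub>m (length ?b) (length ?a)) (adj_mat_of ?Q ?b :: 'a mat))"
      "j < dim_col (four_block_mat (adj_mat_of ?P ?a) (0\<^sub>m (length ?a) (length ?b))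
      (0\<^sub>m (length ?b) (length ?a)) (adj_mat_of ?Q ?b :: 'a mat))"
    then have ij: "i < length ?a + length ?b" "j < length ?a + length ?b" by (auto simp: adj_mat_of_def)
    consider "i < length ?a" "j < length ?a" | "i < length ?a" "\<not> j < length ?a"
      | "\<not> i < length ?a" "j < length ?a" | "\<not> i < length ?a" "\<not> j < length ?a" by blast
    then show "adj_mat_of G (?a @ ?b) $$ (i, j) = four_block_mat (adj_mat_of ?P ?a) (0\<^sub>m (length ?a) (length ?b))
      (0\<^sub>m (length ?b) (length ?a)) (adj_mat_of ?Q ?b :: 'a mat) $$ (i, j)"
    proof cases
      case 1
      then show ?thesis using ij mp[of i] mp[of j] by (simp add: adj_mat_of_def nth)
    next
      case 2
      then have "{?a ! i, ?b ! (j - length ?a)} \<notin> edges G" using cross mp[of i] mq[of "j - length ?a"] ij by simp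
      then show ?thesis using ij 2 by (simp add: adj_mat_of_def nth)
    next
      case 3
      then have "{?b ! (i - length ?a), ?a ! j} \<notin> edges G" using cross mp[of j] mq[of "i - length ?a"] ij by simp
      then show ?thesis using ij 3 by (simp add: adj_mat_of_def nth)
    next
      case 4
      then show ?thesis using ij mq[of "i - length ?a"] mq[of "j - length ?a"] by (simp add: adj_mat_of_def nth)
    qed
  qed (simp_all add: adj_mat_of_def)
  then have "char_poly (adj_mat_of G (?a @ ?b)) = char_poly (adj_mat_of ?P ?a) * (char_poly (adj_mat_of ?Q ?b) :: 'a poly)"
    by (simp only:) (rule char_poly_block_diag; simp add: adj_mat_of_def)
  then show ?thesis
    unfolding char_poly_adj_mat_of[OF G ab] char_poly_adj_mat_of[OF P vp(1,2)] char_poly_adj_mat_of[OF Q vq(1,2)] .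
qed

text \<open>The set consists of the vertices reachable from \<open>u\<close>, where no walk joins
  \<open>u\<close> to \<open>v\<close>; an edge with one end in it has both ends there.\<close>

lemma disconnected_closed:
  assumes G: "simple_graph G" and ne: "verts G \<noteq> {}" and dc: "\<not> connected_graph G"
  obtains S where "closed_in G S" "S \<noteq> {}" "verts G - S \<noteq> {}"
proof -
  obtain u v where uv: "u \<in> verts G" "v \<in> verts G" "(u, v) \<notin> (adj_rel G)\<^sup>*"
    using ne dc unfolding connected_graph_def by blast
  define S where "S = {x \<in> verts G. (u, x) \<in> (adj_rel G)\<^sup>*}"
  have step: "b \<in> S" if "a \<in> S" "{a, b} \<in> edges G" for a b
    using that simple_graph_edgeD[OF G that(2)] unfolding S_def adj_rel_def
    by (auto intro: rtrancl_into_rtrancl)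
  have "closed_in G S"
    unfolding closed_in_def
  proof (intro conjI ballI)
    show "S \<subseteq> verts G" unfolding S_def by blast
    fix e assume e: "e \<in> edges G"
    obtain a b where ab: "e = {a, b}" using simple_graph_edgeE[OF G e] by metis
    then show "e \<subseteq> S \<or> e \<inter> S = {}" using step[of a b] step[of b a] e by (auto simp: insert_commute)
  qed
  moreover have "u \<in> S" "v \<in> verts G - S" using uv by (auto simp: S_def)
  ultimately show ?thesis using that by blast
qed

lemma closed_in_relpow:
  assumes "(u, v) \<in> adj_rel (induced G S) ^^ k"
  shows "(u, v) \<in> adj_rel G ^^ k"
  using assms
proof (induction k arbitrary: v)
  case (Suc k)
  then obtain w where "(u, w) \<in> adj_rel (induced G S) ^^ k" "(w, v) \<in> adj_rel (induced G S)"
    by (meson relpow_Suc_E)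
  then show ?case using Suc.IH[of w] by (auto simp: adj_rel_def)
qed simp

section \<open>The two components of the mate\<close>

lemma irreducible_coprime:
  fixes F h :: "rat poly"
  assumes "irreducible F" "\<not> F dvd h"
  shows "coprime F h"
  using assms by (intro prime_elem_imp_coprime irreducible_imp_prime_elem)

lemma coprime_bezout:
  fixes F h :: "rat poly"
  assumes "coprime F h"
  obtains a b where "a * F + b * h = 1"
  using bezout_coefficients_fst_snd[of F h] assms by (metis coprime_iff_gcd_eq_1)

text \<open>With a F + b phi = 1, the polynomial K is the combination a (F K) + (b K) phi of two
  annihilators. A factor missing from the characteristic polynomial can thus be cancelled.\<close>

lemma walk_annih_cofactor:
  fixes F K :: "rat poly"
  assumes P: "simple_graph P" and FK: "walk_annih P (F * K)" and F: "irreducible F" "\<not> F dvd graph_poly P"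
  shows "walk_annih P K"
proof -
  obtain a b where ab: "a * F + b * graph_poly P = 1"
    using coprime_bezout[OF irreducible_coprime[OF F]] by blast
  have "walk_annih P (a * (F * K) + (b * K) * graph_poly P)"
    by (intro walk_annih_add walk_annih_mult[OF P] FK walk_annih_graph_poly[OF P])
  also have "a * (F * K) + (b * K) * graph_poly P = (a * F + b * graph_poly P) * K"
    by (simp add: algebra_simps)
  finally show ?thesis by (simp add: ab)
qed

text \<open>If both factors were missing, both could be cancelled, and the constant 1 would
  annihilate the all-one vector of a nonempty graph.\<close>

lemma factor_dvd_component:
  fixes F K :: "rat poly"
  assumes P: "simple_graph P" "verts P \<noteq> {}" and FK: "walk_annih P (F * K)"
    and F: "irreducible F" and K: "irreducible K"
  shows "F dvd graph_poly P \<or> K dvd graph_poly P"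
proof (rule ccontr)
  assume n: "\<not> (F dvd graph_poly P \<or> K dvd graph_poly P)"
  then have "walk_annih P (K * 1)" using walk_annih_cofactor[OF P(1) FK F] by simp
  then have "walk_annih P (1 :: rat poly)" using walk_annih_cofactor[OF P(1) _ K] n by blast
  then show False using not_walk_annih_1[OF P(2)] by blast
qed

text \<open>A third component would force the square of \<open>F\<close> or of \<open>K\<close> into the characteristic polynomial.\<close>

lemma closed_part_connected:
  fixes F K :: "rat poly"
  assumes H: "simple_graph H" and FK: "walk_annih H (F * K)" and F: "irreducible F" and K: "irreducible K"
    and sq: "\<not> F * F dvd graph_poly H" "\<not> K * K dvd graph_poly H"
    and S: "closed_in H S" "S \<noteq> {}" "verts H - S \<noteq> {}"
  shows "connected_graph (induced H S)"
proof (rule ccontr)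
  assume nc: "\<not> connected_graph (induced H S)"
  have sS: "simple_graph (induced H S)" by (rule induced_simple[OF H S(1)])
  obtain S1 where S1: "closed_in (induced H S) S1" "S1 \<noteq> {}" "S - S1 \<noteq> {}"
    using disconnected_closed[OF sS _ nc] S(2) by auto
  let ?S0 = "verts H - S" and ?S2 = "S - S1"
  have S2: "closed_in (induced H S) ?S2" using closed_in_Diff[OF sS S1(1)] by simp
  have c: "closed_in H ?S0" "closed_in H S1" "closed_in H ?S2"
    using closed_in_Diff[OF H S(1)] closed_in_induced[OF S(1) S1(1)] closed_in_induced[OF S(1) S2] by auto
  have dv: "F dvd graph_poly (induced H X) \<or> K dvd graph_poly (induced H X)"
    if "closed_in H X" "X \<noteq> {}" for X
    using factor_dvd_component[OF induced_simple[OF H that(1)] _ walk_annih_induced[OF that(1) FK] F K] that(2) by simp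
  have "S1 \<subseteq> S" using S1(1) by (simp add: closed_in_def)
  then have "graph_poly (induced H S) = graph_poly (induced H S1) * (graph_poly (induced H ?S2) :: rat poly)"
    using graph_poly_induced[OF sS S1(1)] by (simp add: induced_induced)
  then have prod: "graph_poly H = graph_poly (induced H S1) * graph_poly (induced H ?S2) * (graph_poly (induced H ?S0) :: rat poly)"
    using graph_poly_induced[OF H S(1), where 'a = rat] by simp
  have two: "x * x dvd a * b * d" if "x dvd a \<and> x dvd b \<or> x dvd a \<and> x dvd d \<or> x dvd b \<and> x dvd d"
    for x a b d :: "rat poly"
    using that
  proof (elim disjE conjE)
    assume "x dvd a" "x dvd b"
    then show ?thesis by (simp add: mult_dvd_mono)
  next
    assume "x dvd a" "x dvd d"
    then have "x * x dvd (a * d) * b" by (simp add: mult_dvd_mono)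
    then show ?thesis by (simp add: mult_ac)
  next
    assume "x dvd b" "x dvd d"
    then have "x * x dvd (b * d) * a" by (simp add: mult_dvd_mono)
    then show ?thesis by (simp add: mult_ac)
  qed
  define a where "a = (graph_poly (induced H S1) :: rat poly)"
  define b where "b = (graph_poly (induced H ?S2) :: rat poly)"
  define d where "d = (graph_poly (induced H ?S0) :: rat poly)"
  have "\<not> (F dvd a \<and> F dvd b \<or> F dvd a \<and> F dvd d \<or> F dvd b \<and> F dvd d)"
    "\<not> (K dvd a \<and> K dvd b \<or> K dvd a \<and> K dvd d \<or> K dvd b \<and> K dvd d)"
    using two[of F a b d] two[of K a b d] sq unfolding prod a_def b_def d_def by argo+
  moreover have "F dvd a \<or> K dvd a" "F dvd b \<or> K dvd b" "F dvd d \<or> K dvd d"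
    unfolding a_def b_def d_def using dv[OF c(1) S(3)] dv[OF c(2) S1(2)] dv[OF c(3) S1(3)] by simp_all
  ultimately show False by argo
qed

lemma monic_dvd_eq:
  fixes a b :: "'a :: field poly"
  assumes "a dvd b" "lead_coeff a = 1" "lead_coeff b = 1" "degree b \<le> degree a"
  shows "a = b"
proof -
  obtain c where c: "b = a * c" using assms(1) unfolding dvd_def by blast
  have nz: "a \<noteq> 0" "c \<noteq> 0" using assms(2,3) c by auto
  have "degree c = 0" using c assms(4) degree_mult_eq[OF nz] by simp
  moreover have "lead_coeff c = 1" using c assms(2,3) by (simp add: lead_coeff_mult)
  ultimately have "c = 1" by (metis degree_eq_zeroE lead_coeff_pCons(2) one_pCons coeff_pCons_0)
  then show ?thesis using c by simp
qed

lemma irreducible_monic_coprime: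
  fixes F K :: "rat poly"
  assumes "irreducible F" "irreducible K" "lead_coeff F = 1" "lead_coeff K = 1" "F \<noteq> K"
  shows "coprime F K"
proof (rule irreducible_coprime[OF assms(1)])
  show "\<not> F dvd K"
  proof
    assume FK: "F dvd K"
    then obtain c where c: "K = F * c" by (auto elim: dvdE)
    have "\<not> F dvd 1" using assms(1) by (rule irreducible_not_unit)
    then have "c dvd 1" using assms(2) c unfolding irreducible_def by blast
    then have "degree c = 0" by (simp add: poly_dvd_1)
    moreover have "F \<noteq> 0" "c \<noteq> 0" using assms(4) c by auto
    ultimately have "degree K \<le> degree F" using c by (simp add: degree_mult_eq)
    then show False using monic_dvd_eq[OF FK assms(3,4)] assms(5) by blast
  qed
qed

lemma is_cycle_graph_card:
  assumes "is_cycle_graph n G"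
  shows "n = card (verts G)"
  using assms unfolding is_cycle_graph_def by (auto simp: distinct_card)

lemma complete_graph_of_card:
  assumes G: "simple_graph G" and e: "card (edges G) = card (verts G) choose 2"
  shows "is_complete_graph (card (verts G)) G"
proof -
  have "edges G \<subseteq> {e. e \<subseteq> verts G \<and> card e = 2}" using G unfolding simple_graph_def by blast
  moreover have "card {e. e \<subseteq> verts G \<and> card e = 2} = card (edges G)"
    unfolding e by (rule n_subsets[OF finite_verts[OF G]])
  moreover have "finite {e. e \<subseteq> verts G \<and> card e = 2}" using finite_verts[OF G] by simp
  ultimately have "edges G = {e. e \<subseteq> verts G \<and> card e = 2}" by (simp add: card_subset_eq)
  then show ?thesis unfolding is_complete_graph_def using finite_verts[OF G] by blast
qed

lemma of_int_poly_of_rat: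
  "map_poly (of_int :: int \<Rightarrow> 'a :: field_char_0) p = map_poly of_rat (map_poly of_int p)"
  by (rule poly_eqI) (simp add: coeff_map_poly)

text \<open>The components of A1 are the degrees, so a linear annihilator forces regularity.\<close>

lemma walk_annih_linear:
  fixes a :: int
  assumes "walk_annih G (map_poly of_int [:- a, 1:] :: rat poly)" "v \<in> verts G"
  shows "int (card (nbrs G v)) = a"
proof -
  have "walk_eval G [:- of_int a, 1 :: rat:] v = 0"
    using assms unfolding walk_annih_def by simp
  then have "(of_nat (card (nbrs G v)) :: rat) = of_int a" by (simp add: walk_eval_linear)
  then show ?thesis by (metis of_int_eq_iff of_int_of_nat_eq)
qed

lemma walk_annih_linear_degree_sum:
  fixes a :: int
  assumes G: "simple_graph G" and "walk_annih G (map_poly of_int [:- a, 1:] :: rat poly)"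
  shows "2 * int (card (edges G)) = a * int (card (verts G))"
proof -
  have "int (\<Sum>v\<in>verts G. card (nbrs G v)) = (\<Sum>v\<in>verts G. a)"
    unfolding of_nat_sum by (rule sum.cong) (use walk_annih_linear[OF assms(2)] in auto)
  then show ?thesis by (simp add: sum_card_nbrs[OF G] mult.commute)
qed

text \<open>Both \<open>a/p + b/q\<close> and the walk generating functions of \<open>R\<close> and \<open>U\<close> split the coronal of \<open>T\<close>
  into proper fractions with denominators \<open>p\<close> and \<open>q\<close>.\<close>

lemma factor_moments_eq_walk_counts:
  fixes p q a b :: "rat poly"
  assumes T: "simple_graph T" and R: "simple_graph R" and U: "simple_graph U"
    and cnt: "\<And>k. walk_count T k = walk_count R k + walk_count U k"
    and p: "walk_annih R p" "degree a < degree p" and q: "walk_annih U q" "degree b < degree q"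
    and cop: "coprime p q" and cor: "coronal T = Fract a p + Fract b q"
  shows "factor_moment a p k = of_nat (walk_count R k)" "factor_moment b q k = of_nat (walk_count U k)"
proof -
  let ?P = poly_at_infinity
  have nz: "p \<noteq> 0" "q \<noteq> 0" using p(2) q(2) by auto
  have nz': "?P p \<noteq> 0" "?P q \<noteq> 0" using nz by (simp_all add: poly_at_infinity_eq_0_iff)
  obtain M where M: "degree M < degree p" "?P M = ?P p * total_walk_series R"
    using walk_annih_quotient[OF R p(1)] p(2) by auto
  obtain N where N: "degree N < degree q" "?P N = ?P q * total_walk_series U"
    using walk_annih_quotient[OF U q(1)] q(2) by auto
  have W: "total_walk_series T = total_walk_series R + total_walk_series U"
    by (rule fls_eqI) (simp add: total_walk_series_nth cnt)
  obtain z :: "'a \<Rightarrow> rat poly" where z: "resolvent_numerators T z" using resolvent_numerators_exist[OF T] .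
  let ?phi = "graph_poly T :: rat poly" and ?s = "\<Sum>v\<in>verts T. z v"
  have "Fract ?s ?phi = Fract (a * q + b * p) (p * q)"
    using coronal_eq[OF T z] cor nz by (simp add: mult.commute)
  then have "?s * (p * q) = (a * q + b * p) * ?phi"
    using nz graph_poly_nonzero[of T, where 'a = rat] by (simp add: eq_fract)
  then have "?P (?s * (p * q)) = ?P ((a * q + b * p) * ?phi)" by simp
  then have "?P ?phi * (total_walk_series T * (?P p * ?P q)) = ?P ?phi * (?P a * ?P q + ?P b * ?P p)"
    unfolding poly_at_infinity_mult poly_at_infinity_add resolvent_total_series[OF T z] by (simp add: mult_ac)
  then have "total_walk_series T * (?P p * ?P q) = ?P a * ?P q + ?P b * ?P p"
    by (simp add: poly_at_infinity_eq_0_iff graph_poly_nonzero)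
  then have "?P M * ?P q + ?P N * ?P p = ?P a * ?P q + ?P b * ?P p"
    unfolding W M(2) N(2) by (simp add: algebra_simps)
  then have "?P (M * q + N * p) = ?P (a * q + b * p)" by (simp add: poly_at_infinity_add poly_at_infinity_mult)
  then have e: "M * q + N * p = a * q + b * p" by (simp add: poly_at_infinity_inj)
  then have "(a - M) * q = (N - b) * p" by (simp add: algebra_simps)
  \<comment> \<open>Uniqueness of partial fractions: \<open>p\<close> is coprime to
    \<open>q\<close>, hence divides \<open>a - M\<close>, whose degree is smaller.\<close>
  then have "p dvd (a - M) * q" by (metis dvd_triv_right)
  then have "p dvd a - M" using cop by (simp add: coprime_dvd_mult_left_iff)
  moreover have "degree (a - M) < degree p" using p(2) M(1) by (rule degree_diff_less)
  ultimately have aM: "a = M" by (metis dvd_imp_degree_le leD right_minus_eq)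
  then have bN: "b = N" using e nz by simp
  show "factor_moment a p k = of_nat (walk_count R k)" "factor_moment b q k = of_nat (walk_count U k)"
    unfolding factor_moment_def aM bN M(2) N(2) using nz' by (simp_all add: total_walk_series_nth)
qed

text \<open>Each main polynomial divides the given annihilator. Conversely their product annihilates
  both parts, and because walk functionals add up it also annihilates for \<open>T\<close>, so
  \<open>p * q\<close> divides it; degrees force equality.\<close>

lemma main_poly_components:
  fixes p q :: "real poly"
  assumes T: "simple_graph T" and R: "simple_graph R" and U: "simple_graph U"
    and cnt: "\<And>k. walk_count T k = walk_count R k + walk_count U k"
    and main: "main_poly T = p * q" and p: "walk_annih R p" "lead_coeff p = 1" and q: "walk_annih U q" "lead_coeff q = 1"
  shows "main_poly R = p" "main_poly U = q"
proof -
  let ?r = "main_poly R" and ?u = "main_poly U"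
  have fn: "walk_functional T h = walk_functional R h + walk_functional U h" for h :: "real poly"
    unfolding walk_functional_def cnt by (simp add: distrib_left sum.distrib)
  have ann: "walk_annih R (?r * ?u)" "walk_annih U (?r * ?u)"
    using walk_annih_dvd[OF R main_poly_annih(1)[OF R]] walk_annih_dvd[OF U main_poly_annih(1)[OF U]] by simp_all
  then have "walk_functional T ((?r * ?u) * (?r * ?u)) = 0"
    unfolding fn using walk_annih_iff_functional[OF R] walk_annih_iff_functional[OF U] by (metis add_0)
  then have "walk_annih T (?r * ?u)" using walk_annih_iff_functional[OF T] by blast
  then have dvd: "p * q dvd ?r * ?u" using main_poly_dvd_iff[OF T] main by metis
  have rp: "?r dvd p" "?u dvd q" using main_poly_dvd_iff[OF R] main_poly_dvd_iff[OF U] p q by blast+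
  have nz: "?r \<noteq> 0" "?u \<noteq> 0" "p \<noteq> 0" "q \<noteq> 0"
    using main_poly_monic[of R] main_poly_monic[of U] p(2) q(2) by auto
  have "degree (p * q) \<le> degree (?r * ?u)" by (rule dvd_imp_degree_le[OF dvd]) (use nz in simp)
  then have "degree p + degree q \<le> degree ?r + degree ?u" using nz by (simp add: degree_mult_eq)
  moreover have "degree ?r \<le> degree p" "degree ?u \<le> degree q" using rp nz by (auto intro: dvd_imp_degree_le)
  ultimately have "degree p \<le> degree ?r" "degree q \<le> degree ?u" by linarith+
  then show "?r = p" "?u = q" using monic_dvd_eq rp main_poly_monic p(2) q(2) by blast+
qed

text \<open>A 2-coloured tree has no closed walk of odd length. The mate has the same total, and one
  such walk would make this sum of natural numbers positive.\<close>

lemma no_odd_closed_walks: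
  assumes T: "tree_graph T" and H: "simple_graph H" and p: "graph_poly H = (graph_poly T :: complex poly)"
    and v: "v \<in> verts H" and k: "odd k"
  shows "(v, v) \<notin> adj_rel H ^^ k"
proof
  assume vv: "(v, v) \<in> adj_rel H ^^ k"
  have G: "simple_graph T" "connected_graph T" using T unfolding tree_graph_def by auto
  obtain c :: "'a \<Rightarrow> bool" where c: "\<And>u v. {u, v} \<in> edges T \<Longrightarrow> c u \<noteq> c v"
    using connected_card_eq_bipartite[OF G tree_graph_card[OF T]] by metis
  have "walks_between T k u u = 0" for u
    using walks_between_parity[of T c k u u, OF c] k by auto
  then have "(\<Sum>v\<in>verts H. walks_between H k v v) = 0"
    using closed_walks_eq[OF H G(1) p, of k] by simp
  then have "walks_between H k v v = 0" using v finite_verts[OF H] by simp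
  then show False using walks_between_relpow[OF H vv] by simp
qed

lemma square_not_dvd:
  fixes F \<phi> :: "rat poly"
  assumes "multiplicity F \<phi> = 1" "F \<noteq> 0" "\<not> F dvd 1" "\<phi> \<noteq> 0"
  shows "\<not> F * F dvd \<phi>"
  using power_dvd_iff_le_multiplicity[of \<phi> F 2] assms by (simp add: power2_eq_square)

text \<open>Both factors occur among the main factors with multiplicity at least one, and the
  multiplicities add up to at most 2.\<close>

lemma main_factors_multiplicity:
  fixes F K :: "rat poly"
  assumes T: "simple_graph T" and kappa: "main_factor_mult T = 2"
    and main: "main_poly T = map_poly of_rat (F * K)"
    and F: "irreducible F" "lead_coeff F = 1" and K: "irreducible K" "lead_coeff K = 1" and FK: "F \<noteq> K"
  shows "\<not> F * F dvd graph_poly T" "\<not> K * K dvd graph_poly T"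
proof -
  let ?phi = "graph_poly T :: rat poly"
  have "walk_annih T (map_poly of_rat ?phi :: real poly)"
    using walk_annih_graph_poly[OF T] by (simp only: walk_annih_of_rat)
  then have "map_poly of_rat (F * K) dvd (map_poly of_rat ?phi :: real poly)"
    using main_poly_dvd_iff[OF T] main by metis
  then have dvd: "F * K dvd ?phi" by (rule of_rat_hom.dvd_map_poly_hom_imp_dvd)
  interpret mp: map_poly_comm_ring_hom "of_rat :: rat \<Rightarrow> real" by unfold_locales
  have "map_poly of_rat F dvd main_poly T" "map_poly of_rat K dvd main_poly T"
    unfolding main by (simp_all add: mp.hom_mult)
  moreover have "F dvd ?phi" "K dvd ?phi" using dvd by (auto intro: dvd_mult_left dvd_mult_right)
  ultimately have mem: "{F, K} \<subseteq> main_factors T" unfolding main_factors_def using F K by simp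
  \<comment> \<open>A sum over an infinite set is 0 by convention, which contradicts the value
    2.\<close>
  have fin: "finite (main_factors T)"
    using kappa unfolding main_factor_mult_def by (metis sum.infinite zero_neq_numeral)
  have "(\<Sum>h\<in>{F, K}. multiplicity h ?phi) \<le> (\<Sum>h\<in>main_factors T. multiplicity h ?phi)"
    by (rule sum_mono2[OF fin mem]) simp
  then have le: "multiplicity F ?phi + multiplicity K ?phi \<le> 2"
    using kappa FK unfolding main_factor_mult_def by simp
  have ge: "multiplicity F ?phi \<ge> 1" "multiplicity K ?phi \<ge> 1"
    using \<open>F dvd ?phi\<close> \<open>K dvd ?phi\<close> F K graph_poly_nonzero[of T, where 'a = rat]
    by (auto intro!: multiplicity_geI dest: irreducible_not_unit)
  from le ge have "multiplicity F ?phi = 1" "multiplicity K ?phi = 1" by linarith+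
  then show "\<not> F * F dvd ?phi" "\<not> K * K dvd ?phi"
    using square_not_dvd[of F ?phi] square_not_dvd[of K ?phi] F K graph_poly_nonzero[of T, where 'a = rat]
    by (auto dest: irreducible_not_unit)
qed

section \<open>Linear factors\<close>

text \<open>Regularity and the edge count give a n = 2n - 2, that is n(2 - a) = 2, so n divides
  2.\<close>

lemma tree_linear_factor:
  fixes a :: int
  assumes R: "tree_graph R" and ann: "walk_annih R (map_poly of_int [:- a, 1:] :: rat poly)"
  shows "a = 0 \<and> card (verts R) = 1 \<and> is_complete_graph 1 R \<or> a = 1 \<and> card (verts R) = 2 \<and> is_complete_graph 2 R"
proof -
  have G: "simple_graph R" "connected_graph R" using R unfolding tree_graph_def by auto
  let ?n = "card (verts R)"
  note e = tree_graph_card[OF R]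
  have eq: "a * int ?n = 2 * int ?n - 2" using walk_annih_linear_degree_sum[OF G(1) ann] e by simp
  then have m: "int ?n * (2 - a) = 2" by (simp add: algebra_simps)
  then have "int ?n dvd 2" by (metis dvd_triv_left)
  then have "int ?n \<le> 2" by (rule zdvd_imp_le) simp
  then have "?n = 1 \<or> ?n = 2" using e by linarith
  then show ?thesis
  proof
    assume n: "?n = 1"
    then have "is_complete_graph ?n R" using complete_graph_of_card[OF G(1)] e by simp
    then show ?thesis using n m by simp
  next
    assume n: "?n = 2"
    then have "is_complete_graph ?n R" using complete_graph_of_card[OF G(1)] e by (simp add: numeral_2_eq_2)
    then show ?thesis using n m by simp
  qed
qed

text \<open>The degree sum reads a n = 2n, and a connected 2-regular graph is a cycle.\<close>

lemma unicyclic_linear_factor: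
  fixes a :: int
  assumes U: "unicyclic_graph U" and eq: "card (verts U) = card (edges U)"
    and ann: "walk_annih U (map_poly of_int [:- a, 1:] :: rat poly)"
  shows "a = 2 \<and> is_cycle_graph (card (verts U)) U"
proof -
  have G: "simple_graph U" "verts U \<noteq> {}" using U unfolding unicyclic_graph_def connected_graph_def by auto
  have "card (verts U) \<noteq> 0" using G(2) finite_verts[OF G(1)] by simp
  then have a: "a = 2" using walk_annih_linear_degree_sum[OF G(1) ann] eq by simp
  then have "card (nbrs U v) \<le> 2" if "v \<in> verts U" for v using walk_annih_linear[OF ann that] by simp
  then show ?thesis using unicyclic_regular_cycle[OF U eq] a by blast
qed

text \<open>All numerical conclusions once the roles are fixed: \<open>p\<close> annihilates for
  \<open>R\<close> and \<open>q\<close> for \<open>U\<close>. Since the factor moments are walk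
  counts, each claim reduces to counting vertices, edges or squared degrees.\<close>

lemma tree_unicyclic_pair:
  fixes T :: "'v ugraph" and R U :: "'w ugraph" and p q :: "int poly" and a b :: "rat poly"
    and c :: "'w \<Rightarrow> bool"
  defines "wp \<equiv> factor_moment a (map_poly of_int p)" and "wq \<equiv> factor_moment b (map_poly of_int q)"
  assumes T: "simple_graph T"
    and cnt: "\<And>k. walk_count T k = walk_count R k + walk_count U k"
    and R: "simple_graph R" "connected_graph R" "card (verts R) = card (edges R) + 1"
    and U: "simple_graph U" "connected_graph U" "card (verts U) = card (edges U)"
    and c: "\<And>u v. {u, v} \<in> edges U \<Longrightarrow> c u \<noteq> c v"
    and p: "walk_annih R (map_poly of_int p :: rat poly)" "irreducible (map_poly of_int p :: rat poly)" "lead_coeff p = 1"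
    and q: "walk_annih U (map_poly of_int q :: rat poly)" "irreducible (map_poly of_int q :: rat poly)" "lead_coeff q = 1"
    and pq: "p \<noteq> q"
    and main: "main_poly T = map_poly of_int (p * q)"
    and decomp: "factor_coronal_decomp T (map_poly of_int p) (map_poly of_int q) a b"
  shows "tree_graph R \<and> unicyclic_graph U \<and> bipartite_graph U \<and>
      main_poly R = map_poly of_int p \<and> main_poly U = map_poly of_int q \<and>
      (\<forall>k. wp k \<in> \<int> \<and> wp k \<ge> 0 \<and> wq k \<in> \<int> \<and> wq k \<ge> 0) \<and> wp 0 \<ge> 1 \<and> wq 0 \<ge> 4 \<and>
      wp 1 - 2 * wp 0 = -2 \<and> wq 1 - 2 * wq 0 = 0 \<and>
      (\<exists>i j :: int. wp 2 = 2 * of_int i \<and> wq 2 = 2 * of_int j) \<and>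
      wp 2 \<ge> max 0 (4 * wp 0 - 6) \<and> wq 2 \<ge> 4 * wq 0 \<and>
      (wp 0 \<ge> 2 \<longrightarrow> (wp 2 = 4 * wp 0 - 6 \<longleftrightarrow> is_path_graph R)) \<and>
      (wq 2 = 4 * wq 0 \<longleftrightarrow> (\<exists>n. is_cycle_graph n U)) \<and>
      (\<forall>a :: int. p = [:- a, 1:] \<longrightarrow>
         (a = 0 \<and> wp 0 = 1 \<and> is_complete_graph 1 R) \<or>
         (a = 1 \<and> wp 0 = 2 \<and> is_complete_graph 2 R)) \<and>
      (\<forall>a :: int. q = [:- a, 1:] \<longrightarrow>
         a = 2 \<and> (\<exists>n. even n \<and> of_nat n = wq 0 \<and> is_cycle_graph n U))"
proof -
  let ?p = "map_poly of_int p :: rat poly" and ?q = "map_poly of_int q :: rat poly"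
  have tree: "tree_graph R" using R connected_acyclic_iff unfolding tree_graph_def by blast
  have uni: "unicyclic_graph U" by (rule connected_card_eq_unicyclic[OF U])
  have lc: "lead_coeff ?p = 1" "lead_coeff ?q = 1" using p(3) q(3) by simp_all
  have "?p \<noteq> ?q"
  proof
    assume "?p = ?q"
    then have "coeff ?p n = coeff ?q n" for n by simp
    then have "p = q" by (intro poly_eqI) (simp add: coeff_map_poly)
    then show False using pq by simp
  qed
  then have cop: "coprime ?p ?q" by (rule irreducible_monic_coprime[OF p(2) q(2) lc])
  have d: "coronal T = Fract a ?p + Fract b ?q" "degree a < degree ?p" "degree b < degree ?q"
    using decomp unfolding factor_coronal_decomp_def by auto
  have wp: "wp k = of_nat (walk_count R k)" and wq: "wq k = of_nat (walk_count U k)" for k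
    using factor_moments_eq_walk_counts[OF T R(1) U(1) cnt p(1) d(2) q(1) d(3) cop d(1)]
    unfolding wp_def wq_def by auto
  have mains: "main_poly R = map_poly of_int p" "main_poly U = map_poly of_int q"
  proof -
    have annR: "walk_annih R (map_poly of_int p :: real poly)" "walk_annih U (map_poly of_int q :: real poly)"
      unfolding of_int_poly_of_rat[where 'a = real] walk_annih_of_rat by (fact p(1) q(1))+
    have lr: "lead_coeff (map_poly of_int p :: real poly) = 1" "lead_coeff (map_poly of_int q :: real poly) = 1"
      using p(3) q(3) by simp_all
    have "main_poly T = map_poly of_int p * map_poly of_int q" unfolding main by (simp add: of_int_poly_hom.hom_mult)
    from main_poly_components[OF T R(1) U(1) cnt this annR(1) lr(1) annR(2) lr(2)]
    show "main_poly R = map_poly of_int p" "main_poly U = map_poly of_int q" .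
  qed
  have n1: "card (verts R) \<ge> 1" using R(3) by simp
  have n4: "card (verts U) \<ge> 4" by (rule bipartite_unicyclic_card[OF uni, of c]) (rule c)
  have w2R: "int (walk_count R 2) \<ge> 4 * int (card (verts R)) - 6" by (rule tree_walk_count_2(1)[OF tree])
  \<comment> \<open>For a single vertex \<open>4 * wp 0 - 6\<close> is -2, so the bound 0 is the
    stronger one there; it holds because \<open>wp 2\<close> is a count.\<close>
  then have w2R': "wp 2 \<ge> max 0 (4 * wp 0 - 6)"
  proof -
    have "(of_int (4 * int (card (verts R)) - 6) :: rat) \<le> of_int (int (walk_count R 2))"
      using w2R by (simp only: of_int_le_iff)
    then show ?thesis unfolding wp walk_count_0 by simp
  qed
  have w2U: "wq 2 \<ge> 4 * wq 0"
  proof -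
    have "(of_nat (4 * card (verts U)) :: rat) \<le> of_nat (walk_count U 2)"
      using unicyclic_walk_count_2(1)[OF uni U(3)] by (simp only: of_nat_le_iff)
    then show ?thesis unfolding wq walk_count_0 by simp
  qed
  have path: "wp 0 \<ge> 2 \<longrightarrow> (wp 2 = 4 * wp 0 - 6 \<longleftrightarrow> is_path_graph R)"
  proof
    assume "wp 0 \<ge> 2"
    then have "card (verts R) \<ge> 2" unfolding wp walk_count_0 by simp
    moreover have "wp 2 = 4 * wp 0 - 6 \<longleftrightarrow>
        (of_int (int (walk_count R 2)) :: rat) = of_int (4 * int (card (verts R)) - 6)"
      unfolding wp walk_count_0 by simp
    ultimately show "wp 2 = 4 * wp 0 - 6 \<longleftrightarrow> is_path_graph R"
      unfolding of_int_eq_iff using tree_walk_count_2(2)[OF tree] by simp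
  qed
  have cyc: "wq 2 = 4 * wq 0 \<longleftrightarrow> (\<exists>n. is_cycle_graph n U)"
  proof -
    have "wq 2 = 4 * wq 0 \<longleftrightarrow> (of_nat (walk_count U 2) :: rat) = of_nat (4 * card (verts U))"
      unfolding wq walk_count_0 by simp
    also have "\<dots> \<longleftrightarrow> is_cycle_graph (card (verts U)) U"
      unfolding of_nat_eq_iff by (rule unicyclic_walk_count_2(2)[OF uni U(3)])
    finally show ?thesis using is_cycle_graph_card[of _ U] by blast
  qed
  have ev: "\<exists>i j :: int. wp 2 = 2 * of_int i \<and> wq 2 = 2 * of_int j"
  proof -
    obtain i j where "walk_count R 2 = 2 * i" "walk_count U 2 = 2 * j"
      using walk_count_2_even[OF R(1)] walk_count_2_even[OF U(1)] by (auto elim!: evenE)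
    then have "wp 2 = 2 * of_int (int i) \<and> wq 2 = 2 * of_int (int j)" unfolding wp wq by simp
    then show ?thesis by blast
  qed
  have lin_p: "\<forall>d. p = [:- d, 1:] \<longrightarrow>
      (d = 0 \<and> wp 0 = 1 \<and> is_complete_graph 1 R) \<or> (d = 1 \<and> wp 0 = 2 \<and> is_complete_graph 2 R)"
  proof (intro allI impI)
    fix d assume "p = [:- d, 1:]"
    then have "walk_annih R (map_poly of_int [:- d, 1:] :: rat poly)" using p(1) by metis
    from tree_linear_factor[OF tree this]
    show "(d = 0 \<and> wp 0 = 1 \<and> is_complete_graph 1 R) \<or> (d = 1 \<and> wp 0 = 2 \<and> is_complete_graph 2 R)"
      unfolding wp walk_count_0 by (elim disjE conjE) simp_all
  qed
  have lin_q: "\<forall>d. q = [:- d, 1:] \<longrightarrow> d = 2 \<and> (\<exists>n. even n \<and> of_nat n = wq 0 \<and> is_cycle_graph n U)"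
  proof (intro allI impI)
    fix d assume "q = [:- d, 1:]"
    then have d: "d = 2" "is_cycle_graph (card (verts U)) U"
      using unicyclic_linear_factor[OF uni U(3), of d] q(1) by auto
    moreover have "even (card (verts U))" by (rule bipartite_cycle_even[OF d(2), of c]) (rule c)
    ultimately show "d = 2 \<and> (\<exists>n. even n \<and> of_nat n = wq 0 \<and> is_cycle_graph n U)"
      unfolding wq walk_count_0 by blast
  qed
  have w1: "wp 1 - 2 * wp 0 = -2" "wq 1 - 2 * wq 0 = 0"
    unfolding wp wq walk_count_0 One_nat_def walk_count_1[OF R(1)] walk_count_1[OF U(1)] R(3) U(3) by simp_all
  have w0: "wp 0 \<ge> 1" "wq 0 \<ge> 4" unfolding wp wq walk_count_0 using n1 n4 by simp_all
  have ints: "\<forall>k. wp k \<in> \<int> \<and> wp k \<ge> 0 \<and> wq k \<in> \<int> \<and> wq k \<ge> 0" unfolding wp wq by simp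
  have bip: "bipartite_graph U" by (rule bipartite_of_colouring[OF U(1), of c]) (rule c)
  show ?thesis
    by (intro conjI tree uni bip mains ints w0 w1 ev w2R' w2U path cyc lin_p lin_q)
qed

lemma disconnected_mate_parts:
  fixes T :: "'v ugraph" and H :: "'w ugraph" and F K :: "rat poly"
  assumes T: "tree_graph T" and kappa: "main_factor_mult T = 2"
    and main: "main_poly T = map_poly of_rat (F * K)"
    and F: "irreducible F" "lead_coeff F = 1" and K: "irreducible K" "lead_coeff K = 1" and FK: "F \<noteq> K"
    and H: "simple_graph H" and mate: "gen_cospectral H T" and dc: "\<not> connected_graph H"
  obtains R U c where "H = graph_union R U" "verts R \<inter> verts U = {}"
    "\<And>k. walk_count T k = walk_count R k + walk_count U k"
    "simple_graph R" "connected_graph R" "card (verts R) = card (edges R) + 1"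
    "simple_graph U" "connected_graph U" "card (verts U) = card (edges U)"
    "\<And>u v. {u, v} \<in> edges U \<Longrightarrow> c u \<noteq> (c v :: bool)"
    "walk_annih R F \<and> walk_annih U K \<or> walk_annih R K \<and> walk_annih U F"
proof -
  have sT: "simple_graph T" using T unfolding tree_graph_def by auto
  have gp: "graph_poly H = (graph_poly T :: rat poly)" "graph_poly H = (graph_poly T :: complex poly)"
    using cospectral_graph_poly[OF H sT] mate unfolding gen_cospectral_def by blast+
  have gpc: "graph_poly (complement_graph H) = (graph_poly (complement_graph T) :: rat poly)"
    using cospectral_graph_poly[OF simple_complement[OF H] simple_complement[OF sT]] mate
    unfolding gen_cospectral_def by blast
  have wc: "walk_count H k = walk_count T k" for k by (rule walk_count_eq[OF H sT gp(1) gpc])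
  have sq: "\<not> F * F dvd graph_poly H" "\<not> K * K dvd graph_poly H"
    using main_factors_multiplicity[OF sT kappa main F K FK] unfolding gp by blast+
  have annT: "walk_annih T (F * K)"
    using main_poly_annih(1)[OF sT] unfolding main walk_annih_of_rat .
  have annH: "walk_annih H (F * K)"
    using walk_annih_cong[OF H sT wc] annT by blast
  \<comment> \<open>Walks of length 0 count the vertices, walks of length 1 count the edges
    twice.\<close>
  have card_eq: "card (verts H) = card (verts T)" "card (edges H) = card (edges T)"
    using wc[of 0] wc[of "Suc 0"] unfolding walk_count_0 walk_count_1[OF H] walk_count_1[OF sT] by simp_all
  have eH: "card (verts H) = card (edges H) + 1" using tree_graph_card[OF T] card_eq by simp
  have conn: "connected_graph (induced H S)" if "closed_in H S" "S \<noteq> {}" "verts H - S \<noteq> {}" for S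
    by (rule closed_part_connected[OF H annH F(1) K(1) sq that])
  have counts: "card (verts H) = card S + card (verts H - S)"
    "card (edges H) = card (edges (induced H S)) + card (edges (induced H (verts H - S)))"
    if S: "closed_in H S" for S
  proof -
    have sub: "S \<subseteq> verts H" using S unfolding closed_in_def by blast
    show "card (verts H) = card S + card (verts H - S)"
      using card_Diff_subset[OF finite_subset[OF sub finite_verts[OF H]] sub] card_mono[OF finite_verts[OF H] sub] by simp
    show "card (edges H) = card (edges (induced H S)) + card (edges (induced H (verts H - S)))"
      using edges_induced[OF H S] card_Un_disjoint[OF finite_edges[OF induced_simple[OF H S]]
          finite_edges[OF induced_simple[OF H closed_in_Diff[OF H S]]]] by metis
  qed
  obtain S where S: "closed_in H S" "S \<noteq> {}" "verts H - S \<noteq> {}" "card S = card (edges (induced H S)) + 1"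
  proof -
    have "verts H \<noteq> {}" using eH by auto
    then obtain S where S: "closed_in H S" "S \<noteq> {}" "verts H - S \<noteq> {}"
      using disconnected_closed[OF H _ dc] by blast
    let ?S' = "verts H - S"
    have S': "closed_in H ?S'" by (rule closed_in_Diff[OF H S(1)])
    have dd: "verts H - ?S' \<noteq> {}" using S(1,2) unfolding closed_in_def by blast
    have "card S \<le> card (edges (induced H S)) + 1" "card ?S' \<le> card (edges (induced H ?S')) + 1"
      using connected_card_le[OF induced_simple[OF H S(1)] conn[OF S]]
        connected_card_le[OF induced_simple[OF H S'] conn[OF S' S(3) dd]] unfolding induced_simps(1) by blast+
    \<comment> \<open>The excesses e - v + 1 of the two connected parts are nonnegative, and they
      add up to 1 because \<open>H\<close> has one edge fewer than vertices. So one part has excess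
      0 and the other 1.\<close>
    then consider "card S = card (edges (induced H S)) + 1" | "card ?S' = card (edges (induced H ?S')) + 1"
      using counts[OF S(1)] eH by linarith
    then show thesis using that[OF S] that[OF S' S(3) dd] by cases
  qed
  let ?S' = "verts H - S" and ?R = "induced H S" and ?U = "induced H (verts H - S)"
  have S': "closed_in H ?S'" by (rule closed_in_Diff[OF H S(1)])
  have sR: "simple_graph ?R" and sU: "simple_graph ?U" using induced_simple[OF H] S(1) S' by auto
  have cU: "connected_graph ?U"
    by (rule conn[OF S' S(3)]) (use S(1,2) in \<open>auto simp: closed_in_def\<close>)
  have eU: "card (verts ?U) = card (edges ?U)" using counts[OF S(1)] eH S(4) by simp
  have gpm: "graph_poly H = graph_poly ?R * (graph_poly ?U :: rat poly)" by (rule graph_poly_induced[OF H S(1)])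
  have annR: "walk_annih ?R (F * K)" and annU: "walk_annih ?U (F * K)"
    using walk_annih_induced[OF S(1) annH] walk_annih_induced[OF S' annH] by auto
  have dR: "F dvd graph_poly ?R \<or> K dvd graph_poly ?R"
    by (rule factor_dvd_component[OF sR _ annR F(1) K(1)]) (use S in simp)
  have dU: "F dvd graph_poly ?U \<or> K dvd graph_poly ?U"
    by (rule factor_dvd_component[OF sU _ annU F(1) K(1)]) (use S in simp)
  \<comment> \<open>A factor common to both parts would have its square in the product
    \<open>gpm\<close>.\<close>
  have nF: "\<not> (F dvd graph_poly ?R \<and> F dvd graph_poly ?U)" and nK: "\<not> (K dvd graph_poly ?R \<and> K dvd graph_poly ?U)"
    using sq unfolding gpm by (auto dest: mult_dvd_mono)
  have annih_R: "walk_annih ?R K" if "\<not> F dvd graph_poly ?R" by (rule walk_annih_cofactor[OF sR annR F(1) that])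
  have annih_R': "walk_annih ?R F" if "\<not> K dvd graph_poly ?R"
    by (rule walk_annih_cofactor[OF sR _ K(1) that]) (use annR in \<open>simp add: mult.commute\<close>)
  have annih_U: "walk_annih ?U K" if "\<not> F dvd graph_poly ?U" by (rule walk_annih_cofactor[OF sU annU F(1) that])
  have annih_U': "walk_annih ?U F" if "\<not> K dvd graph_poly ?U"
    by (rule walk_annih_cofactor[OF sU _ K(1) that]) (use annU in \<open>simp add: mult.commute\<close>)
  \<comment> \<open>Every part contains a factor and no factor lies in both parts, so each part
    contains exactly one; the missing one is cancelled and the present one annihilates.\<close>
  have roles: "walk_annih ?R F \<and> walk_annih ?U K \<or> walk_annih ?R K \<and> walk_annih ?U F"
    using dR dU nF nK annih_R annih_R' annih_U annih_U' by blast
  have "(v, v) \<notin> adj_rel ?U ^^ k" if "v \<in> verts ?U" "odd k" for v k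
    using no_odd_closed_walks[OF T H gp(2) _ that(2), of v] closed_in_relpow[where G = H and S = ?S'] that(1) by auto
  then obtain c :: "'w \<Rightarrow> bool" where c: "\<And>u v. {u, v} \<in> edges ?U \<Longrightarrow> c u \<noteq> c v"
    using no_odd_closed_walk_colouring[OF sU cU] by blast
  show thesis
    by (rule that[of ?R ?U c])
       (use induced_union[OF H S(1)] walk_count_induced[OF H S(1)] wc sR conn[OF S(1-3)] S(4) sU cU eU c roles in auto)
qed

theorem theorem4p3:
  fixes T :: "'v ugraph" and H :: "'w ugraph"
    and f g :: "int poly" and A B :: "rat poly"
  assumes tree_T: "tree_graph T"
    and kappa_T: "main_factor_mult T = 2"
    and main_T: "main_poly T = map_poly of_int (f * g)"
    and distinct_fg: "f \<noteq> g"
    and monic_f: "lead_coeff f = 1"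
    and monic_g: "lead_coeff g = 1"
    and irred_f: "irreducible (map_poly of_int f :: rat poly)"
    and irred_g: "irreducible (map_poly of_int g :: rat poly)"
    and decomp: "factor_coronal_decomp T (map_poly of_int f) (map_poly of_int g) A B"
    and simple_H: "simple_graph H"
    and mate_H: "gen_cospectral H T"
    and disconnected_H: "\<not> connected_graph H"
  shows "\<exists>(R :: 'w ugraph) (U :: 'w ugraph) (p :: int poly) (q :: int poly)
            (wp :: nat \<Rightarrow> rat) (wq :: nat \<Rightarrow> rat).
      H = graph_union R U \<and> verts R \<inter> verts U = {} \<and>
      tree_graph R \<and> unicyclic_graph U \<and> bipartite_graph U \<and>
      (p, wp, q, wq) \<in>
        {(f, factor_moment A (map_poly of_int f), g, factor_moment B (map_poly of_int g)),
         (g, factor_moment B (map_poly of_int g), f, factor_moment A (map_poly of_int f))} \<and>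
      main_poly R = map_poly of_int p \<and> main_poly U = map_poly of_int q \<and>
      \<comment> \<open>(i)\<close>
      (\<forall>k. wp k \<in> \<int> \<and> wp k \<ge> 0 \<and> wq k \<in> \<int> \<and> wq k \<ge> 0) \<and> wp 0 \<ge> 1 \<and> wq 0 \<ge> 4 \<and>
      \<comment> \<open>(ii)\<close>
      wp 1 - 2 * wp 0 = -2 \<and> wq 1 - 2 * wq 0 = 0 \<and>
      \<comment> \<open>(iii)\<close>
      (\<exists>i j :: int. wp 2 = 2 * of_int i \<and> wq 2 = 2 * of_int j) \<and>
      wp 2 \<ge> max 0 (4 * wp 0 - 6) \<and> wq 2 \<ge> 4 * wq 0 \<and>
      (wp 0 \<ge> 2 \<longrightarrow> (wp 2 = 4 * wp 0 - 6 \<longleftrightarrow> is_path_graph R)) \<and>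
      (wq 2 = 4 * wq 0 \<longleftrightarrow> (\<exists>n. is_cycle_graph n U)) \<and>
      \<comment> \<open>(iv)\<close>
      (\<forall>a :: int. p = [:- a, 1:] \<longrightarrow>
         (a = 0 \<and> wp 0 = 1 \<and> is_complete_graph 1 R) \<or>
         (a = 1 \<and> wp 0 = 2 \<and> is_complete_graph 2 R)) \<and>
      (\<forall>a :: int. q = [:- a, 1:] \<longrightarrow>
         a = 2 \<and> (\<exists>n. even n \<and> of_nat n = wq 0 \<and> is_cycle_graph n U))"
proof -
  let ?F = "map_poly of_int f :: rat poly" and ?K = "map_poly of_int g :: rat poly"
  have sT: "simple_graph T" using tree_T unfolding tree_graph_def by auto
  have main: "main_poly T = map_poly of_rat (?F * ?K)"
    unfolding main_T of_int_poly_of_rat[where 'a = real] by (simp add: of_int_poly_hom.hom_mult)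
  have lc: "lead_coeff ?F = 1" "lead_coeff ?K = 1" using monic_f monic_g by simp_all
  have FK: "?F \<noteq> ?K"
  proof
    assume eq: "?F = ?K"
    have "f = g"
    proof (rule poly_eqI)
      fix n
      show "coeff f n = coeff g n" using arg_cong[OF eq, of "\<lambda>h. coeff h n"] by (simp add: coeff_map_poly)
    qed
    then show False using distinct_fg by simp
  qed
  obtain R U c where P: "H = graph_union R U" "verts R \<inter> verts U = {}"
    "\<And>k. walk_count T k = walk_count R k + walk_count U k"
    "simple_graph R" "connected_graph R" "card (verts R) = card (edges R) + 1"
    "simple_graph U" "connected_graph U" "card (verts U) = card (edges U)"
    and c: "\<And>u v. {u, v} \<in> edges U \<Longrightarrow> c u \<noteq> (c v :: bool)"
    and roles: "walk_annih R ?F \<and> walk_annih U ?K \<or> walk_annih R ?K \<and> walk_annih U ?F"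
    using disconnected_mate_parts[OF tree_T kappa_T main irred_f lc(1) irred_g lc(2) FK simple_H mate_H disconnected_H]
    by metis
  \<comment> \<open>Either factor may belong to the tree. The second case exchanges the factors
    together with the summands of the coronal.\<close>
  from roles show ?thesis
  proof (elim disjE conjE)
    assume r: "walk_annih R ?F" "walk_annih U ?K"
    show ?thesis
      using tree_unicyclic_pair[OF sT P(3-9) c r(1) irred_f monic_f r(2) irred_g monic_g distinct_fg main_T decomp] P(1,2)
      by (intro exI[of _ R] exI[of _ U] exI[of _ f] exI[of _ g] exI[of _ "factor_moment A ?F"] exI[of _ "factor_moment B ?K"]) simp
  next
    assume r: "walk_annih R ?K" "walk_annih U ?F"
    have main': "main_poly T = map_poly of_int (g * f)" using main_T by (simp add: mult.commute)
    have decomp': "factor_coronal_decomp T ?K ?F B A"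
      using decomp unfolding factor_coronal_decomp_def by (simp add: add.commute)
    show ?thesis
      using tree_unicyclic_pair[OF sT P(3-9) c r(1) irred_g monic_g r(2) irred_f monic_f distinct_fg[symmetric] main' decomp'] P(1,2)
      by (intro exI[of _ R] exI[of _ U] exI[of _ g] exI[of _ f] exI[of _ "factor_moment B ?K"] exI[of _ "factor_moment A ?F"]) simp
  qed
qed

end
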